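(* Let $p,n,r\ge 1$ be integers with $r\le p$, let $\bm{B}$ be an unknown real $p\times r$ matrix such that $\bm{\Sigma}=\bm{B}\bm{B}^{\top}$ has rank $r$, and let $\bm{X}=\bm{B}\bm{Z}$, where $\bm{Z}$ is an $r\times n$ random matrix whose columns are independent and identically distributed as $\mathcal N_r(0_r,\bm{I}_r)$. Put $\bm{S}=\bm{X}\bm{X}^{\top}$, $q=\min(n,r)$, $m=\max(n,r)$ and $a_o=1/m$. Let $\bm{S}=\bm{H}\bm{L}\bm{H}^{\top}$ be the eigenvalue decomposition of $\bm{S}$, with $\bm{H}$ a $p\times q$ semi-orthogonal matrix of eigenvectors and $\bm{L}=\mathrm{diag}(l_1,\dots,l_q)$, $l_1>\dots>l_q>0$ (this holds with probability one). For real $\alpha\ge 1$ and $b>0$, consider the Haff type estimator $$\hat{\bm{\Sigma}}_{\alpha}=a_o\big(\bm{S}+\bm{H}\bm{L}\bm{\Psi}(\bm{L})\bm{H}^{\top}\big),\qquad \bm{\Psi}(\bm{L})=b\,\frac{\bm{L}^{-\alpha}}{\mathrm{tr}(\bm{L}^{-\alpha})},$$ and the estimator $\hat{\bm{\Sigma}}_{a_o}=a_o\bm{S}$. If $$0<b\le b_o=\frac{2(q-1)}{m-q+1},$$ then $\hat{\bm{\Sigma}}_{\alpha}$ improves over $\hat{\bm{\Sigma}}_{a_o}$ under the Stein type loss $L(\hat{\bm{\Sigma}},\bm{\Sigma})=\mathrm{tr}(\bm{\Sigma}^{+}\hat{\bm{\Sigma}})-\ln|\Lambda(\bm{\Sigma}^{+}\hat{\bm{\Sigma}})|-q$;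 that is, the risk difference is non-positive: $$R(\hat{\bm{\Sigma}}_{\alpha},\bm{\Sigma})-R(\hat{\bm{\Sigma}}_{a_o},\bm{\Sigma})\le 0\quad\text{for every such }\bm{\Sigma}.$$
   Context: All matrices are real; bold letters $\bm{A}$ (i.e. \boldsymbol) denote matrices. $\bm{\Sigma}^{+}$ is the Moore-Penrose inverse of $\bm{\Sigma}$. The columns of $\bm{X}$ are i.i.d. $\mathcal N_p(0_p,\bm{\Sigma})$, and $\bm{S}$ has rank $q=\min(n,r)$ with probability one. No ordering between $n$ and $p$ or between $n$ and $r$ is assumed, so $\bm{\Sigma}$ and $\bm{S}$ may each be invertible or singular. Semi-orthogonal means $\bm{H}^{\top}\bm{H}=\bm{I}_q$. $\bm{L}^{-\alpha}=\mathrm{diag}(l_1^{-\alpha},\dots,l_q^{-\alpha})$. For an estimator $\hat{\bm{\Sigma}}$ of $\bm{\Sigma}$ (here $\hat{\bm{\Sigma}}_\alpha$ or $\hat{\bm{\Sigma}}_{a_o}$), $\Lambda(\bm{\Sigma}^{+}\hat{\bm{\Sigma}})$ is the $q\times q$ diagonal matrix of the $q$ positive eigenvalues of $\bm{\Sigma}^{+}\hat{\bm{\Sigma}}$, and $|\cdot|$ is the determinant, so $|\Lambda(\bm{\Sigma}^{+}\hat{\bm{\Sigma}})|$ is the product of these eigenvalues. The risk is $R(\hat{\bm{\Sigma}},\bm{\Sigma})=E[L(\hat{\bm{\Sigma}},\bm{\Sigma})]$, where $E$ is the expectation with respect to the model $\bm{X}=\bm{B}\bm{Z}$. "Improves over"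 means that the risk is less than or equal to that of the other estimator for every $\bm{\Sigma}$. *)

theory Defs
  imports
    "HOL-Probability.Probability"
    "Jordan_Normal_Form.Char_Poly"
    "Jordan_Normal_Form.DL_Rank"
begin

definition mat_trace :: "real mat \<Rightarrow> real" where
  "mat_trace A = (\<Sum>i<dim_row A. A $$ (i, i))"

definition is_mp_inverse :: "real mat \<Rightarrow> real mat \<Rightarrow> bool" where
  "is_mp_inverse A P \<longleftrightarrow>
     P \<in> carrier_mat (dim_col A) (dim_row A) \<and>
     A * P * A = A \<and> P * A * P = P \<and>
     (A * P)\<^sup>T = A * P \<and> (P * A)\<^sup>T = P * A"

text \<open>The four Penrose equations determine at most one matrix (shown below) and are always
  solvable over the reals, so the description is proper.\<close>

definition mp_inverse :: "real mat \<Rightarrow> real mat" where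
  "mp_inverse A = (THE P. is_mp_inverse A P)"

lemma is_mp_inverse_unique:
  assumes P: "is_mp_inverse A P" and Q: "is_mp_inverse A Q"
  shows "P = Q"
proof -
  define a b where "a = dim_row A" and "b = dim_col A"
  have A: "A \<in> carrier_mat a b" by (auto simp: a_def b_def)
  have Pc: "P \<in> carrier_mat b a" and Qc: "Q \<in> carrier_mat b a"
    using P Q by (auto simp: is_mp_inverse_def a_def b_def)
  note P' = P[unfolded is_mp_inverse_def] and Q' = Q[unfolded is_mp_inverse_def]
  have AP: "A * P = A * Q"
  proof -
    have eq: "(A * Q) * (A * P) = A * P"
    proof -
      have "(A * Q) * (A * P) = (A * Q * A) * P"
        by (rule assoc_mult_mat[symmetric, of _ a a _ b _ a]) (use A Pc Qc in auto)
      then show ?thesis using Q' by simp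
    qed
    have eq': "(A * P) * (A * Q) = A * Q"
    proof -
      have "(A * P) * (A * Q) = (A * P * A) * Q"
        by (rule assoc_mult_mat[symmetric, of _ a a _ b _ a]) (use A Pc Qc in auto)
      then show ?thesis using P' by simp
    qed
    have "A * P = ((A * Q) * (A * P))\<^sup>T" unfolding eq using P' by simp
    also have "\<dots> = (A * P)\<^sup>T * (A * Q)\<^sup>T"
      by (rule transpose_mult[of _ a a _ a]) (use A Pc Qc in auto)
    also have "\<dots> = A * Q" using P' Q' eq' by simp
    finally show ?thesis .
  qed
  have PA: "P * A = Q * A"
  proof -
    have eq: "(P * A) * (Q * A) = P * A"
    proof -
      have "(P * A) * (Q * A) = P * (A * (Q * A))"
        by (rule assoc_mult_mat[of _ b a _ b _ b]) (use A Pc Qc in auto)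
      also have "A * (Q * A) = A * Q * A"
        by (rule assoc_mult_mat[symmetric, of _ a b _ a _ b]) (use A Pc Qc in auto)
      finally show ?thesis using Q' by simp
    qed
    have eq': "(Q * A) * (P * A) = Q * A"
    proof -
      have "(Q * A) * (P * A) = Q * (A * (P * A))"
        by (rule assoc_mult_mat[of _ b a _ b _ b]) (use A Pc Qc in auto)
      also have "A * (P * A) = A * P * A"
        by (rule assoc_mult_mat[symmetric, of _ a b _ a _ b]) (use A Pc Qc in auto)
      finally show ?thesis using P' by simp
    qed
    have "P * A = ((P * A) * (Q * A))\<^sup>T" unfolding eq using P' by simp
    also have "\<dots> = (Q * A)\<^sup>T * (P * A)\<^sup>T"
      by (rule transpose_mult[of _ b b _ b]) (use A Pc Qc in auto)
    also have "\<dots> = Q * A" using P' Q' eq' by simp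
    finally show ?thesis .
  qed
  have "P = Q * A * P" using P' PA by simp
  also have "\<dots> = Q * (A * P)"
    by (rule assoc_mult_mat[of _ b a _ b _ a]) (use A Pc Qc in auto)
  also have "\<dots> = Q * A * Q" unfolding AP
    by (rule assoc_mult_mat[symmetric, of _ b a _ b _ a]) (use A Qc in auto)
  also have "\<dots> = Q" using Q' by simp
  finally show ?thesis .
qed

text \<open>Algebraic multiplicity is counted: \<open>proots\<close> lists each root of the characteristic
  polynomial as often as its order.\<close>

definition pos_eigenvalues :: "real mat \<Rightarrow> real multiset" where
  "pos_eigenvalues A = filter_mset (\<lambda>x. 0 < x) (proots (char_poly A))"

text \<open>Its size is the number of positive eigenvalues; the entries are listed in
  decreasing order.\<close>

definition pos_eigenvalue_mat :: "real mat \<Rightarrow> real mat" where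
  "pos_eigenvalue_mat A =
     (let es = rev (sorted_list_of_multiset (pos_eigenvalues A))
      in mat_diag (length es) (\<lambda>i. es ! i))"

definition std_normal_vector :: "'w measure \<Rightarrow> nat \<Rightarrow> ('w \<Rightarrow> nat \<Rightarrow> real) \<Rightarrow> bool" where
  "std_normal_vector M r Y \<longleftrightarrow>
     distributed M (Pi\<^sub>M {..<r} (\<lambda>_. lborel)) Y (\<lambda>y. \<Prod>i<r. ennreal (std_normal_density (y i)))"

text \<open>Vectors in \<open>r\<close>-space are extensional functions on \<open>{..<r}\<close>.\<close>

definition mat_column :: "nat \<Rightarrow> ('w \<Rightarrow> real mat) \<Rightarrow> nat \<Rightarrow> 'w \<Rightarrow> nat \<Rightarrow> real" where
  "mat_column r Z j \<omega> = (\<lambda>i\<in>{..<r}. Z \<omega> $$ (i, j))"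

definition iid_std_normal_columns ::
    "'w measure \<Rightarrow> nat \<Rightarrow> nat \<Rightarrow> ('w \<Rightarrow> real mat) \<Rightarrow> bool" where
  "iid_std_normal_columns M r n Z \<longleftrightarrow>
     (\<forall>\<omega>\<in>space M. Z \<omega> \<in> carrier_mat r n) \<and>
     prob_space.indep_vars M (\<lambda>_. Pi\<^sub>M {..<r} (\<lambda>_. lborel)) (mat_column r Z) {..<n} \<and>
     (\<forall>j<n. std_normal_vector M r (mat_column r Z j))"

definition eigen_decomposition ::
    "nat \<Rightarrow> real mat \<Rightarrow> real mat \<Rightarrow> (nat \<Rightarrow> real) \<Rightarrow> bool" where
  "eigen_decomposition q S H l \<longleftrightarrow>
     H \<in> carrier_mat (dim_row S) q \<and> H\<^sup>T * H = 1\<^sub>m q \<and>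
     (\<forall>i<q. 0 < l i) \<and> (\<forall>i j. i < j \<longrightarrow> j < q \<longrightarrow> l j < l i) \<and>
     S = H * mat_diag q l * H\<^sup>T"

definition haff_Psi :: "nat \<Rightarrow> real \<Rightarrow> real \<Rightarrow> (nat \<Rightarrow> real) \<Rightarrow> real mat" where
  "haff_Psi q \<alpha> b l =
     (let La = mat_diag q (\<lambda>i. l i powr (- \<alpha>)) in (b / mat_trace La) \<cdot>\<^sub>m La)"

definition haff_estimator ::
    "nat \<Rightarrow> real \<Rightarrow> real \<Rightarrow> real \<Rightarrow> real mat \<Rightarrow> real mat \<Rightarrow> (nat \<Rightarrow> real) \<Rightarrow> real mat" where
  "haff_estimator q a \<alpha> b S H l =
     a \<cdot>\<^sub>m (S + H * mat_diag q l * haff_Psi q \<alpha> b l * H\<^sup>T)"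

definition stein_loss :: "nat \<Rightarrow> real mat \<Rightarrow> real mat \<Rightarrow> real" where
  "stein_loss q Shat Sig =
     mat_trace (mp_inverse Sig * Shat)
       - ln (Determinant.det (pos_eigenvalue_mat (mp_inverse Sig * Shat))) - real q"

text \<open>The estimators are determined only almost surely (through the eigenvalue decomposition),
  so expectations are taken over the completed measure: there the values on null sets
  affect neither measurability nor the integral.\<close>

definition stein_risk :: "'w measure \<Rightarrow> nat \<Rightarrow> ('w \<Rightarrow> real mat) \<Rightarrow> real mat \<Rightarrow> real" where
  "stein_risk M q Shat Sig = (\<integral>\<omega>. stein_loss q (Shat \<omega>) Sig \<partial>(completion M))"

definition finite_stein_risk :: "'w measure \<Rightarrow> nat \<Rightarrow> ('w \<Rightarrow> real mat) \<Rightarrow> real mat \<Rightarrow> bool" where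
  "finite_stein_risk M q Shat Sig \<longleftrightarrow>
     integrable (completion M) (\<lambda>\<omega>. stein_loss q (Shat \<omega>) Sig)"

end

theory Submission
  imports Defs
begin

text \<open>
  With \<open>w\<^sub>i = l\<^sub>i powr (- \<alpha>) / (\<Sum>j. l\<^sub>j powr (- \<alpha>))\<close> the difference of the two losses is
  \<open>a\<^sub>o * b * t - (\<Sum>i. ln (1 + b * w\<^sub>i))\<close>, where \<open>t\<close> is a trace of the Gaussian Gram matrix against
  the spectral function of \<open>S\<close> with values \<open>w\<^sub>i\<close>. Since the \<open>w\<^sub>i\<close> are non-negative with sum one,
  \<open>(\<Sum>i. ln (1 + b * w\<^sub>i)) \<ge> ln (1 + b) \<ge> 2 * b / (2 + b)\<close>, so for \<open>b \<le> b\<^sub>o\<close> the bound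
  \<open>E t \<le> m - q + 1\<close> suffices.

  That bound is Stein's identity \<open>E (x * g) = E g'\<close> applied entrywise. To avoid differentiating eigenvalues
  and eigenvectors, which are smooth only off a null set, \<open>y powr \<alpha>\<close> is replaced by a polynomial
  \<open>\<phi> y = y * P y\<close>, with \<open>P\<close> positive and increasing, evaluated at the regularised inverse
  \<open>(\<Gamma> + \<epsilon>)\<^sup>-\<^sup>1\<close> of the Gram matrix \<open>\<Gamma>\<close> that carries the spectrum of \<open>S\<close>. The divergence is then a rational
  function of the entries, which for increasing \<open>P\<close> is at most
  \<open>m - (q - 1) * (1 - \<epsilon> * tr (\<Gamma> + \<epsilon>)\<^sup>-\<^sup>1)\<close>;
  letting \<open>P y\<close> tend to \<open>y powr (\<alpha> - 1)\<close> and \<open>\<epsilon>\<close> to zero gives the claim.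

  The logarithms are integrable because the Gram determinant of an \<open>m \<times> q\<close> Gaussian matrix dominates the square
  of its leading \<open>q \<times> q\<close> minor, and a leading minor is affine in its last diagonal entry.
\<close>

hide_const (open) Finite_Cartesian_Product.mat Finite_Cartesian_Product.vec Finite_Cartesian_Product.transpose
no_notation inner (infix \<open>\<bullet>\<close> 70)
no_notation vec_nth (infixl \<open>$\<close> 90)

section \<open>Real spectral theorem\<close>

text \<open>The constant \<open>b\<^sub>o\<close> is where the two bounds meet: with
  \<open>a\<^sub>o = 1 / m\<close> and b > 0,
  \<open>b * (m - q + 1) / m \<le> 2 * b / (2 + b)\<close> is equivalent to
  \<open>b \<le> 2 * (q - 1) / (m - q + 1)\<close>. The gain from m to m - q + 1 comes from pairs of
  distinct eigenvalues: each pair contributes a symmetrised divided difference of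
  \<open>\<phi>\<close> that is at least the sum of its two values. This is where \<open>P\<close>
  has to increase, hence where \<alpha> \<ge> 1 enters. The regularisation answers a growth problem:
  the inverse Gram matrix is unbounded near singular matrices, while the entries of the regularised
  inverse are bounded by a multiple of 1 / \<epsilon>, so that the field and its derivatives grow at
  most polynomially and Stein's identity applies. The limits are harmless because the weights stay
  nonnegative with sum one. A second obstacle is that neither the eigenvectors nor the eigenvalues
  are assumed to depend measurably on the sample point. Integrals are therefore taken of limits of
  functions of the Gaussian entries, and the losses are identified with these almost surely.\<close>

lemma mat_mult_index:
  assumes "i < dim_row A" "j < dim_col B" "dim_col A = dim_row B"
  shows "(A * B) $$ (i,j) = (\<Sum>k<dim_row B. A $$ (i,k) * B $$ (k,j))"
  using assms by (simp add: scalar_prod_def atLeast0LessThan)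

text \<open>Dimension equations replace the \<open>carrier_mat\<close> premises, so that the
  simplifier can discharge them. Long products are normalised to right-nested form with this rule;
  \<open>mat_mult_cancel\<close> then removes adjacent inverse pairs.\<close>

lemma mat_mult_assoc:
  fixes A B C :: "'a::semiring_0 mat"
  shows "dim_col A = dim_row B \<Longrightarrow> dim_col B = dim_row C \<Longrightarrow> (A * B) * C = A * (B * C)"
  by (rule assoc_mult_mat) (auto intro: carrier_matI)

lemma mat_transpose_mult:
  fixes A B :: "'a::comm_semiring_0 mat"
  shows "dim_col A = dim_row B \<Longrightarrow> (A * B)\<^sup>T = B\<^sup>T * A\<^sup>T"
  by (rule transpose_mult) (auto intro: carrier_matI)

lemma mat_one_mult:
  fixes A :: "'a::semiring_1 mat"
  shows "dim_row A = n \<Longrightarrow> 1\<^sub>m n * A = A" "dim_col A = n \<Longrightarrow> A * 1\<^sub>m n = A"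
  by (auto intro: left_mult_one_mat right_mult_one_mat carrier_matI)

lemma mat_trace_mult:
  assumes "dim_col A = dim_row B" "dim_row A = dim_col B"
  shows "mat_trace (A * B) = (\<Sum>i<dim_row A. \<Sum>k<dim_row B. A $$ (i,k) * B $$ (k,i))"
  unfolding mat_trace_def using assms by (simp add: mat_mult_index del: index_mult_mat(1))

lemma mat_trace_commute:
  assumes "dim_col A = dim_row B" "dim_row A = dim_col B"
  shows "mat_trace (A * B) = mat_trace (B * A)"
  unfolding mat_trace_mult[OF assms] mat_trace_mult[OF assms(2)[symmetric] assms(1)[symmetric]]
  by (subst sum.swap) (use assms in \<open>simp add: mult.commute\<close>)

lemma mat_trace_add:
  "dim_row A = dim_row B \<Longrightarrow> dim_row B = dim_col B \<Longrightarrow> mat_trace (A + B) = mat_trace A + mat_trace B"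
  unfolding mat_trace_def by (simp add: sum.distrib)

lemma mat_trace_transpose: "dim_row A = dim_col A \<Longrightarrow> mat_trace (A\<^sup>T) = mat_trace A"
  unfolding mat_trace_def by simp

lemma mat_diag_dims [simp]: "dim_row (mat_diag n f) = n" "dim_col (mat_diag n f) = n"
  by (simp_all add: mat_diag_def)

lemma mat_diag_index [simp]: "i < n \<Longrightarrow> j < n \<Longrightarrow> mat_diag n f $$ (i,j) = (if i = j then f j else 0)"
  by (simp add: mat_diag_def)

lemma mat_diag_transpose [simp]: "(mat_diag n f)\<^sup>T = mat_diag n f"
  by (rule eq_matI) auto

lemma mat_diag_cong: "(\<And>i. i < n \<Longrightarrow> f i = g i) \<Longrightarrow> mat_diag n f = mat_diag n g"
  by (rule eq_matI) auto

lemma mat_trace_diag [simp]: "mat_trace (mat_diag n f) = (\<Sum>i<n. f i)"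
  unfolding mat_trace_def by simp

lemma det_mat_diag: "Determinant.det (mat_diag n (f :: nat \<Rightarrow> 'a::idom)) = (\<Prod>i<n. f i)"
proof -
  have "Determinant.det (mat_diag n f) = prod_list (diag_mat (mat_diag n f))"
    by (rule det_upper_triangular[of _ n]) auto
  also have "\<dots> = (\<Prod>i<n. f i)"
    unfolding diag_mat_def
    by (simp add: prod.distinct_set_conv_list[symmetric] atLeast0LessThan cong: prod.cong map_cong)
      (metis (no_types, lifting) atLeast0LessThan atLeastLessThan_upt distinct_upt interv_sum_list_conv_sum_set_nat
        prod.distinct_set_conv_list prod.cong mat_diag_index lessThan_iff map_cong set_upt)
  finally show ?thesis .
qed

definition orthogonal_matrix :: "nat \<Rightarrow> real mat \<Rightarrow> bool" where
  "orthogonal_matrix n V \<longleftrightarrow> V \<in> carrier_mat n n \<and> V\<^sup>T * V = 1\<^sub>m n \<and> V * V\<^sup>T = 1\<^sub>m n"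

lemma orthogonal_matrixI:
  assumes "V \<in> carrier_mat n n" "V\<^sup>T * V = 1\<^sub>m n"
  shows "orthogonal_matrix n V"
  using assms mat_mult_left_right_inverse[of "V\<^sup>T" n V] by (auto simp: orthogonal_matrix_def)

text \<open>The characteristic polynomial splits over the complex numbers, so there is a complex
  eigenpair \<open>a\<close>, \<open>w\<close>. The Hermitian form \<open>s\<close> of A at
  \<open>w\<close> equals \<open>a\<close> times a positive number and is self-conjugate by
  symmetry, which makes \<open>a\<close> real. It is then a root of the real characteristic
  polynomial, and a real eigenvector exists.\<close>

lemma symmetric_real_eigenvector:
  fixes A :: "real mat"
  assumes A: "A \<in> carrier_mat n n" and sym: "A\<^sup>T = A" and n: "0 < n"
  obtains v e where "v \<in> carrier_vec n" "v \<noteq> 0\<^sub>v n" "A *\<^sub>v v = e \<cdot>\<^sub>v v"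
proof -
  let ?C = "map_mat complex_of_real A"
  have C: "?C \<in> carrier_mat n n" using A by simp
  from char_poly_factorized[OF C] obtain as where
    as: "char_poly ?C = (\<Prod> a \<leftarrow> as. [:- a, 1:])" "length as = n" by blast
  obtain a where a: "a \<in> set as" using as(2) n by (cases as) auto
  have root: "poly (char_poly ?C) a = 0" unfolding as(1) poly_prod_list using a
    by (induct as) auto
  then have "eigenvalue ?C a" using eigenvalue_root_char_poly[OF C] by blast
  then obtain w where w: "w \<in> carrier_vec n" "w \<noteq> 0\<^sub>v n" "?C *\<^sub>v w = a \<cdot>\<^sub>v w"
    using C unfolding eigenvalue_def eigenvector_def by auto
  define s where "s = (\<Sum>i<n. \<Sum>j<n. cnj (w $ i) * complex_of_real (A $$ (i,j)) * w $ j)"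
  have Cw: "(\<Sum>j<n. complex_of_real (A $$ (i,j)) * w $ j) = a * w $ i" if "i < n" for i
  proof -
    have "(?C *\<^sub>v w) $ i = a * w $ i" using w that by simp
    moreover have "(?C *\<^sub>v w) $ i = (\<Sum>j<n. complex_of_real (A $$ (i,j)) * w $ j)"
      using A w(1) that by (simp add: scalar_prod_def atLeast0LessThan)
    ultimately show ?thesis by simp
  qed
  have s1: "s = a * complex_of_real (\<Sum>i<n. (cmod (w $ i))\<^sup>2)"
  proof -
    have "s = (\<Sum>i<n. cnj (w $ i) * (\<Sum>j<n. complex_of_real (A $$ (i,j)) * w $ j))"
      unfolding s_def by (simp add: sum_distrib_left mult.assoc)
    also have "\<dots> = (\<Sum>i<n. a * (w $ i * cnj (w $ i)))"
      by (rule sum.cong) (auto simp: Cw)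
    also have "\<dots> = a * complex_of_real (\<Sum>i<n. (cmod (w $ i))\<^sup>2)"
      by (simp add: sum_distrib_left complex_norm_square[symmetric])
    finally show ?thesis .
  qed
  have symA: "A $$ (i,j) = A $$ (j,i)" if "i < n" "j < n" for i j
    using arg_cong[OF sym, of "\<lambda>X. X $$ (i,j)"] A that by simp
  have "cnj s = (\<Sum>i<n. \<Sum>j<n. w $ i * complex_of_real (A $$ (i,j)) * cnj (w $ j))"
    unfolding s_def by simp
  also have "\<dots> = (\<Sum>j<n. \<Sum>i<n. w $ i * complex_of_real (A $$ (i,j)) * cnj (w $ j))"
    by (rule sum.swap)
  also have "\<dots> = s" unfolding s_def
    by (intro sum.cong) (auto simp: symA mult_ac)
  finally have s2: "cnj s = s" .
  have pos: "(\<Sum>i<n. (cmod (w $ i))\<^sup>2) > 0"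
  proof -
    obtain i where "i < n" "w $ i \<noteq> 0" using w(1,2) by (metis carrier_vecD eq_vecI index_zero_vec)
    then show ?thesis by (intro sum_pos2[of _ i]) auto
  qed
  have "cnj a = a" using s1 s2 pos by (simp del: of_real_sum)
  then obtain e where e: "a = complex_of_real e" by (metis Reals_cases Reals_cnj_iff)
  have "char_poly ?C = map_poly complex_of_real (char_poly A)"
    by (rule of_real_hom.char_poly_hom[OF A])
  with root e have "poly (char_poly A) e = 0" by simp
  then have "eigenvalue A e" using eigenvalue_root_char_poly[OF A] by blast
  then show thesis using that A unfolding eigenvalue_def eigenvector_def by auto
qed

text \<open>The reflection that exchanges v with the first basis vector. It is symmetric and its own
  inverse, so the conjugation in the spectral theorem needs one matrix only. If v already is that
  basis vector the reflection degenerates and the identity serves.\<close>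

lemma householder:
  fixes v :: "real vec"
  assumes v: "v \<in> carrier_vec n" and v1: "(\<Sum>i<n. (v $ i)\<^sup>2) = 1" and n: "0 < n"
  obtains W where "orthogonal_matrix n W" "W\<^sup>T = W" "\<And>i. i < n \<Longrightarrow> W $$ (i,0) = v $ i"
proof (cases "v $ 0 = 1")
  case True
  have "v $ i = (if i = 0 then 1 else 0)" if "i < n" for i
  proof (cases "i = 0")
    case False
    have "(\<Sum>i<n. (v $ i)\<^sup>2) = (v $ 0)\<^sup>2 + (\<Sum>i\<in>{..<n}-{0}. (v $ i)\<^sup>2)"
      using n by (intro sum.remove) auto
    then have "(\<Sum>i\<in>{..<n}-{0}. (v $ i)\<^sup>2) = 0" using v1 True by simp
    then show ?thesis using False that by (subst (asm) sum_nonneg_eq_0_iff) auto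
  qed (use True in auto)
  then show thesis by (intro that[of "1\<^sub>m n"]) (auto simp: orthogonal_matrix_def)
next
  case False
  define u where "u i = v $ i - (if i = 0 then 1 else 0)" for i
  \<comment> \<open>Half the squared length of \<open>u\<close> (see \<open>uu\<close>), so
    \<open>W\<close> below is the usual reflection along \<open>u\<close> without a factor
    2.\<close>
  define c where "c = 1 - v $ 0"
  have c: "c \<noteq> 0" using False c_def by simp
  have uu: "(\<Sum>i<n. u i * u i) = 2 * c"
  proof -
    have "(\<Sum>i<n. u i * u i) = (\<Sum>i<n. (v $ i)\<^sup>2 + (if i = 0 then 1 - 2 * v $ 0 else 0))"
      by (rule sum.cong) (auto simp: u_def power2_eq_square algebra_simps)
    also have "\<dots> = 2 * c" using n v1 by (simp add: sum.distrib c_def)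
    finally show ?thesis .
  qed
  define W where "W = Matrix.mat n n (\<lambda>(i,j). (if i = j then 1 else 0) - u i * u j / c)"
  have W: "W \<in> carrier_mat n n" unfolding W_def by simp
  have WT: "W\<^sup>T = W" unfolding W_def by (rule eq_matI) auto
  have "W * W = 1\<^sub>m n"
  proof (rule eq_matI)
    fix i j assume "i < dim_row (1\<^sub>m n)" "j < dim_col (1\<^sub>m n)"
    then have ij: "i < n" "j < n" by auto
    have "(W * W) $$ (i,j) = (\<Sum>k<n. ((if i = k then 1 else 0) - u i * u k / c) * ((if k = j then 1 else 0) - u k * u j / c))"
      using ij W by (subst mat_mult_index) (auto simp: W_def)
    also have "\<dots> = (\<Sum>k<n. (if i = k then (if k = j then 1 else 0) - u k * u j / c else 0) - (if k = j then u i * u k / c else 0)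
         + u i * u j / (c * c) * (u k * u k))"
      by (rule sum.cong) (auto simp: algebra_simps diff_divide_distrib add_divide_distrib)
    also have "\<dots> = (if i = j then 1 else 0) - u i * u j / c - u i * u j / c + u i * u j / (c * c) * (2 * c)"
      unfolding sum.distrib sum_subtractf sum_distrib_left[symmetric] uu using ij by simp
    also have "\<dots> = 1\<^sub>m n $$ (i,j)" using ij c by (simp add: field_simps)
    finally show "(W * W) $$ (i,j) = 1\<^sub>m n $$ (i,j)" .
  qed (use W in auto)
  moreover have "W $$ (i,0) = v $ i" if "i < n" for i
    using that n c by (auto simp: W_def u_def c_def field_simps)
  ultimately show thesis using that[of W] W WT by (auto simp: orthogonal_matrix_def)
qed


text \<open>Deflation, by induction on the size: conjugation by the reflection with a unit
  eigenvector as first column clears the first column off the diagonal, symmetry clears the first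
  row, and the induction hypothesis diagonalises the remaining block.\<close>

lemma spectral_theorem_exists:
  fixes A :: "real mat"
  assumes "A \<in> carrier_mat n n" and "A\<^sup>T = A"
  shows "\<exists>V l. orthogonal_matrix n V \<and> A = V * mat_diag n l * V\<^sup>T"
  using assms
proof (induction n arbitrary: A)
  case 0
  then show ?case
    by (intro exI[of _ "1\<^sub>m 0"] exI[of _ "\<lambda>_. 0"]) (auto simp: orthogonal_matrix_def)
next
  case (Suc n)
  obtain v e where v: "v \<in> carrier_vec (Suc n)" "v \<noteq> 0\<^sub>v (Suc n)" "A *\<^sub>v v = e \<cdot>\<^sub>v v"
    using symmetric_real_eigenvector[OF Suc.prems] by blast
  define s where "s = (\<Sum>i<Suc n. (v $ i)\<^sup>2)"
  have s: "s > 0"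
  proof -
    obtain i where "i < Suc n" "v $ i \<noteq> 0" using v(1,2) by (metis carrier_vecD eq_vecI index_zero_vec)
    then show ?thesis unfolding s_def by (intro sum_pos2[of _ i]) auto
  qed
  define w where "w = (1 / sqrt s) \<cdot>\<^sub>v v"
  have w: "w \<in> carrier_vec (Suc n)" using v by (simp add: w_def)
  have "(\<Sum>i<Suc n. (w $ i)\<^sup>2) = (\<Sum>i<Suc n. (v $ i)\<^sup>2 / s)"
    using v(1) s by (intro sum.cong) (auto simp: w_def power_divide)
  also have "\<dots> = 1" using s unfolding sum_divide_distrib[symmetric] s_def[symmetric] by simp
  finally obtain W where W: "orthogonal_matrix (Suc n) W" "W\<^sup>T = W" "\<And>i. i < Suc n \<Longrightarrow> W $$ (i,0) = w $ i"
    using householder[OF w] by blast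
  have Aw: "(\<Sum>j<Suc n. A $$ (i,j) * w $ j) = e * w $ i" if "i < Suc n" for i
  proof -
    have "(A *\<^sub>v v) $ i = (\<Sum>j<Suc n. A $$ (i,j) * v $ j)"
      using Suc.prems v(1) that by (simp add: scalar_prod_def atLeast0LessThan del: sum.lessThan_Suc)
    moreover have "(A *\<^sub>v v) $ i = e * v $ i" using v that by simp
    moreover have "(\<Sum>j<Suc n. A $$ (i,j) * w $ j) = (1 / sqrt s) * (\<Sum>j<Suc n. A $$ (i,j) * v $ j)"
      unfolding sum_distrib_left using v(1) by (intro sum.cong) (auto simp: w_def)
    ultimately show ?thesis using v(1) that by (simp add: w_def)
  qed
  have Wc: "W \<in> carrier_mat (Suc n) (Suc n)" and WW: "W * W = 1\<^sub>m (Suc n)"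
    using W(1,2) by (auto simp: orthogonal_matrix_def)
  define A' where "A' = W * A * W"
  have Ac: "A \<in> carrier_mat (Suc n) (Suc n)" by fact
  note dims = carrier_matD[OF Ac] carrier_matD[OF Wc]
  have A'c: "A' \<in> carrier_mat (Suc n) (Suc n)" using Wc Ac by (simp add: A'_def)
  have A'T: "A'\<^sup>T = A'" using W(2) Suc.prems(2)
    by (simp add: A'_def mat_transpose_mult mat_mult_assoc dims)
  have AWW: "A = W * A' * W"
  proof -
    have "W * A' * W = (W * W) * A * (W * W)" unfolding A'_def by (simp add: mat_mult_assoc dims)
    then show ?thesis using WW by (simp add: mat_one_mult dims)
  qed
  have AW0: "(A * W) $$ (i,0) = e * W $$ (i,0)" if "i < Suc n" for i
    using that dims W(3) Aw[OF that] by (subst mat_mult_index) (auto simp del: sum.lessThan_Suc)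
  have A'0: "A' $$ (i,0) = (if i = 0 then e else 0)" if "i < Suc n" for i
  proof -
    have "A' $$ (i,0) = (W * (A * W)) $$ (i,0)" by (simp add: A'_def mat_mult_assoc dims)
    also have "\<dots> = (\<Sum>k<Suc n. W $$ (i,k) * (e * W $$ (k,0)))"
      using that dims AW0 by (subst mat_mult_index) (auto simp del: sum.lessThan_Suc index_mult_mat(1))
    also have "\<dots> = e * (W * W) $$ (i,0)"
      using that dims by (subst mat_mult_index) (auto simp: sum_distrib_left mult_ac simp del: sum.lessThan_Suc index_mult_mat(1))
    also have "\<dots> = (if i = 0 then e else 0)" unfolding WW using that by simp
    finally show ?thesis .
  qed
  have A'0': "A' $$ (0,i) = (if i = 0 then e else 0)" if "i < Suc n" for i
    using arg_cong[OF A'T, of "\<lambda>X. X $$ (0,i)"] A'0[OF that] A'c that by simp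
  define A3 where "A3 = Matrix.mat n n (\<lambda>(i,j). A' $$ (Suc i, Suc j))"
  have A3: "A3 \<in> carrier_mat n n" "A3\<^sup>T = A3"
  proof -
    show "A3\<^sup>T = A3"
    proof (rule eq_matI)
      fix i j assume "i < dim_row A3" "j < dim_col A3"
      then have ij: "i < n" "j < n" by (auto simp: A3_def)
      then show "A3\<^sup>T $$ (i,j) = A3 $$ (i,j)"
        using arg_cong[OF A'T, of "\<lambda>X. X $$ (Suc i,Suc j)"] A'c by (simp add: A3_def)
    qed (auto simp: A3_def)
  qed (simp add: A3_def)
  obtain U m where U: "orthogonal_matrix n U" "A3 = U * mat_diag n m * U\<^sup>T"
    using Suc.IH[OF A3] by blast
  have Uc: "U \<in> carrier_mat n n" "U\<^sup>T * U = 1\<^sub>m n" using U by (auto simp: orthogonal_matrix_def)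
  define F where "F X = four_block_mat (1\<^sub>m 1) (0\<^sub>m 1 n) (0\<^sub>m n 1) X" for X :: "real mat"
  define E where "E = four_block_mat (mat_diag 1 (\<lambda>_. e)) (0\<^sub>m 1 n) (0\<^sub>m n 1) (mat_diag n m)"
  define l where "l i = (if i = 0 then e else m (i - 1))" for i
  have El: "E = mat_diag (Suc n) l"
    by (rule eq_matI) (auto simp: E_def l_def)
  have FU: "F U \<in> carrier_mat (Suc n) (Suc n)" using Uc by (auto simp: F_def)
  have FT: "(F U)\<^sup>T = F (U\<^sup>T)"
    using Uc by (simp add: F_def transpose_four_block_mat[of _ 1 1 _ n _ n])
  have "(F U)\<^sup>T * F U = 1\<^sub>m (Suc n)"
  proof -
    have "(F U)\<^sup>T * F U = F (U\<^sup>T * U)"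
      unfolding FT unfolding F_def using Uc
      by (subst mult_four_block_mat[of _ 1 1 _ n _ n]) auto
    also have "\<dots> = 1\<^sub>m (Suc n)" unfolding Uc(2) F_def by (rule eq_matI) auto
    finally show ?thesis .
  qed
  then have oF: "orthogonal_matrix (Suc n) (F U)" by (rule orthogonal_matrixI[OF FU])
  have A'F: "A' = F U * E * (F U)\<^sup>T"
  proof -
    have "A' = four_block_mat (mat_diag 1 (\<lambda>_. e)) (0\<^sub>m 1 n) (0\<^sub>m n 1) A3"
      by (rule eq_matI) (use A'c A'0 A'0' A3 in \<open>auto simp: A3_def\<close>)
    also have "\<dots> = F U * E * F (U\<^sup>T)"
    proof -
      have "F U * E = four_block_mat (mat_diag 1 (\<lambda>_. e)) (0\<^sub>m 1 n) (0\<^sub>m n 1) (U * mat_diag n m)"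
        unfolding F_def E_def using Uc
        by (subst mult_four_block_mat[of _ 1 1 _ n _ n]) (auto simp: mat_one_mult mult_carrier_mat[of _ n n])
      then show ?thesis
        unfolding U(2) using Uc
        apply (simp only:)
        unfolding F_def
        by (subst mult_four_block_mat[of _ 1 1 _ n _ n]) (auto simp: mat_one_mult mult_carrier_mat[of _ n n])
    qed
    finally show ?thesis unfolding FT .
  qed
  define V where "V = W * F U"
  note dims = dims carrier_matD[OF FU]
  have VT: "V\<^sup>T = (F U)\<^sup>T * W" using W(2) by (simp add: V_def mat_transpose_mult dims)
  have "V\<^sup>T * V = (F U)\<^sup>T * (W * W) * F U" unfolding VT unfolding V_def
    by (simp add: mat_mult_assoc dims)
  also have "\<dots> = 1\<^sub>m (Suc n)" using oF WW by (simp add: mat_one_mult dims orthogonal_matrix_def)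
  finally have oV: "orthogonal_matrix (Suc n) V"
    using Wc FU by (intro orthogonal_matrixI) (auto simp: V_def)
  have "V * mat_diag (Suc n) l * V\<^sup>T = W * (F U * E * (F U)\<^sup>T) * W"
    unfolding VT unfolding V_def El by (simp add: mat_mult_assoc dims)
  then have "A = V * mat_diag (Suc n) l * V\<^sup>T" using AWW A'F by simp
  with oV show ?case by blast
qed

section \<open>Positive eigenvalues\<close>

lemma const_poly_mat_mult:
  fixes A B :: "real mat"
  assumes "dim_col A = dim_row B"
  shows "map_mat (\<lambda>a. [:a:]) (A * B) = map_mat (\<lambda>a. [:a:]) A * map_mat (\<lambda>a. [:a:]) B"
proof -
  have sum_const: "[:sum f S:] = (\<Sum>i\<in>S. [:f i:])" for f :: "nat \<Rightarrow> real" and S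
  proof (induction S rule: infinite_finite_induct)
    case (insert x F)
    then show ?case by (simp flip: insert.IH)
  qed auto
  show ?thesis
    by (rule eq_matI) (use assms in \<open>auto simp: mat_mult_index sum_const mult.commute simp del: index_mult_mat(1)\<close>)
qed

lemma char_poly_matrix_eq:
  fixes A :: "real mat"
  assumes "A \<in> carrier_mat n n"
  shows "char_poly_matrix A = [:0,1:] \<cdot>\<^sub>m 1\<^sub>m n - map_mat (\<lambda>a. [:a:]) A"
  unfolding char_poly_matrix_def by (rule eq_matI) (use assms in auto)

text \<open>The bordered matrix \<open>M\<close> is made block triangular in two ways.
  Multiplication by \<open>N1\<close> on the right keeps the determinant and exposes the
  characteristic polynomial of A B; multiplication by \<open>N2\<close> on the left costs the factor
  \<open>[:0,1:] ^ q\<close> and exposes that of B A.\<close>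

lemma char_poly_mult_commute:
  fixes A B :: "real mat"
  assumes A: "A \<in> carrier_mat p q" and B: "B \<in> carrier_mat q p"
  shows "char_poly (A * B) * [:0,1:] ^ q = [:0,1:] ^ p * char_poly (B * A)"
proof -
  define a where "a = map_mat (\<lambda>x. [:x:]) A"
  define b where "b = map_mat (\<lambda>x. [:x:]) B"
  let ?X = "[:0,1::real:]"
  have a: "a \<in> carrier_mat p q" and b: "b \<in> carrier_mat q p" using A B by (auto simp: a_def b_def)
  define M where "M = four_block_mat (?X \<cdot>\<^sub>m 1\<^sub>m p) a b (1\<^sub>m q)"
  define N1 where "N1 = four_block_mat (1\<^sub>m p) (0\<^sub>m p q) (- b) (1\<^sub>m q)"
  define N2 where "N2 = four_block_mat (1\<^sub>m p) (0\<^sub>m p q) (- b) (?X \<cdot>\<^sub>m 1\<^sub>m q)"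
  have M: "M \<in> carrier_mat (p+q) (p+q)" using a b by (auto simp: M_def)
  have N1: "N1 \<in> carrier_mat (p+q) (p+q)" using a b by (auto simp: N1_def)
  have N2: "N2 \<in> carrier_mat (p+q) (p+q)" using a b by (auto simp: N2_def)
  have ab: "a * b \<in> carrier_mat p p" "b * a \<in> carrier_mat q q" using a b by auto
  have MN1: "M * N1 = four_block_mat (?X \<cdot>\<^sub>m 1\<^sub>m p - a * b) a (0\<^sub>m q p) (1\<^sub>m q)"
  proof -
    have "M * N1 = four_block_mat (?X \<cdot>\<^sub>m 1\<^sub>m p * 1\<^sub>m p + a * (- b)) (?X \<cdot>\<^sub>m 1\<^sub>m p * 0\<^sub>m p q + a * 1\<^sub>m q)
        (b * 1\<^sub>m p + 1\<^sub>m q * (- b)) (b * 0\<^sub>m p q + 1\<^sub>m q * 1\<^sub>m q)"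
      unfolding M_def N1_def using a b by (subst mult_four_block_mat[of _ p p _ q _ q]) auto
    also have "\<dots> = four_block_mat (?X \<cdot>\<^sub>m 1\<^sub>m p - a * b) a (0\<^sub>m q p) (1\<^sub>m q)"
      by (rule cong_four_block_mat; rule eq_matI) (use a b ab in auto)
    finally show ?thesis .
  qed
  have N2M: "N2 * M = four_block_mat (?X \<cdot>\<^sub>m 1\<^sub>m p) a (0\<^sub>m q p) (?X \<cdot>\<^sub>m 1\<^sub>m q - b * a)"
  proof -
    have "N2 * M = four_block_mat (1\<^sub>m p * (?X \<cdot>\<^sub>m 1\<^sub>m p) + 0\<^sub>m p q * b) (1\<^sub>m p * a + 0\<^sub>m p q * 1\<^sub>m q)
        (- b * (?X \<cdot>\<^sub>m 1\<^sub>m p) + ?X \<cdot>\<^sub>m 1\<^sub>m q * b) (- b * a + ?X \<cdot>\<^sub>m 1\<^sub>m q * 1\<^sub>m q)"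
      unfolding M_def N2_def using a b by (subst mult_four_block_mat[of _ p p _ q _ q]) auto
    also have "\<dots> = four_block_mat (?X \<cdot>\<^sub>m 1\<^sub>m p) a (0\<^sub>m q p) (?X \<cdot>\<^sub>m 1\<^sub>m q - b * a)"
    proof (rule cong_four_block_mat)
      have "- b * (?X \<cdot>\<^sub>m 1\<^sub>m p) = ?X \<cdot>\<^sub>m (- b)"
        using b by (subst mult_smult_distrib[of _ q p _ p]) auto
      moreover have "?X \<cdot>\<^sub>m 1\<^sub>m q * b = ?X \<cdot>\<^sub>m b"
        using b by (subst mult_smult_assoc_mat[of _ q q _ p]) auto
      ultimately show "- b * (?X \<cdot>\<^sub>m 1\<^sub>m p) + ?X \<cdot>\<^sub>m 1\<^sub>m q * b = 0\<^sub>m q p"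
        using b by (auto intro!: eq_matI)
      show "- b * a + ?X \<cdot>\<^sub>m 1\<^sub>m q * 1\<^sub>m q = ?X \<cdot>\<^sub>m 1\<^sub>m q - b * a"
        by (rule eq_matI) (use a b ab in auto)
    qed (use a b in auto)
    finally show ?thesis .
  qed
  have cAB: "char_poly (A * B) = Determinant.det (?X \<cdot>\<^sub>m 1\<^sub>m p - a * b)"
    unfolding char_poly_def using A B
    by (subst char_poly_matrix_eq[of _ p]) (auto simp: const_poly_mat_mult a_def b_def)
  have cBA: "char_poly (B * A) = Determinant.det (?X \<cdot>\<^sub>m 1\<^sub>m q - b * a)"
    unfolding char_poly_def using A B
    by (subst char_poly_matrix_eq[of _ q]) (auto simp: const_poly_mat_mult a_def b_def)
  have dX: "Determinant.det (?X \<cdot>\<^sub>m 1\<^sub>m n) = ?X ^ n" for n by (subst det_smult) auto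
  have dXa: "?X \<cdot>\<^sub>m 1\<^sub>m p - a * b \<in> carrier_mat p p" "?X \<cdot>\<^sub>m 1\<^sub>m q - b * a \<in> carrier_mat q q"
    by (rule minus_carrier_mat[OF ab(1)], rule minus_carrier_mat[OF ab(2)])
  have 1: "Determinant.det (M * N1) = char_poly (A * B)"
    unfolding MN1 det_four_block_mat_lower_left_zero[OF dXa(1) a refl one_carrier_mat] cAB by simp
  have "?X \<cdot>\<^sub>m 1\<^sub>m p \<in> carrier_mat p p" by simp
  from det_four_block_mat_lower_left_zero[OF this a refl dXa(2)]
  have 2: "Determinant.det (N2 * M) = ?X ^ p * char_poly (B * A)"
    unfolding N2M cBA dX .
  have mb: "- b \<in> carrier_mat q p" using b by simp
  have 3: "Determinant.det N1 = 1"
    unfolding N1_def det_four_block_mat_upper_right_zero[OF one_carrier_mat refl mb one_carrier_mat] by simp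
  have "?X \<cdot>\<^sub>m 1\<^sub>m q \<in> carrier_mat q q" by simp
  from det_four_block_mat_upper_right_zero[OF one_carrier_mat refl mb this]
  have 4: "Determinant.det N2 = ?X ^ q"
    unfolding N2_def dX by simp
  show ?thesis using 1 2 unfolding det_mult[OF M N1] det_mult[OF N2 M] 3 4
    by (simp add: mult.commute)
qed

lemma char_poly_nonzero: "A \<in> carrier_mat n n \<Longrightarrow> char_poly (A :: real mat) \<noteq> 0"
  using degree_monic_char_poly[of A n] by auto

text \<open>The two characteristic polynomials differ by powers of the variable only, whose roots
  are zero and are removed by the filter. This cyclicity replaces the nonsymmetric p by p product of
  the pseudoinverse with an estimator by a q by q matrix.\<close>

lemma pos_eigenvalues_mult_commute:
  fixes A B :: "real mat"
  assumes A: "A \<in> carrier_mat p q" and B: "B \<in> carrier_mat q p"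
  shows "pos_eigenvalues (A * B) = pos_eigenvalues (B * A)"
proof -
  have nz: "char_poly (A * B) \<noteq> 0" "char_poly (B * A) \<noteq> 0"
    using char_poly_nonzero[OF mult_carrier_mat[OF A B]] char_poly_nonzero[OF mult_carrier_mat[OF B A]] by auto
  have X: "proots ([:0,1::real:] ^ n) = repeat_mset n {#0#}" for n
    using proots_linear_factor[of "0::real"] by (simp add: proots_power)
  have F: "filter_mset (\<lambda>x. 0 < x) (replicate_mset n (0::real)) = {#}" for n by (induction n) auto
  have "proots (char_poly (A * B)) + repeat_mset q {#0#} = repeat_mset p {#0#} + proots (char_poly (B * A))"
    using arg_cong[OF char_poly_mult_commute[OF A B], of proots] nz
    by (simp add: proots_mult X)
  from arg_cong[OF this, of "filter_mset (\<lambda>x. 0 < x)"] show ?thesis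
    by (simp add: pos_eigenvalues_def F)
qed

lemma orthogonal_matrix_det: "orthogonal_matrix n V \<Longrightarrow> (Determinant.det V)\<^sup>2 = 1"
  using det_mult[of "V\<^sup>T" n V] det_transpose[of V n]
  by (auto simp: orthogonal_matrix_def power2_eq_square)

lemma spectral_det:
  assumes "orthogonal_matrix n V"
  shows "Determinant.det (V * mat_diag n l * V\<^sup>T) = (\<Prod>i<n. l i)"
proof -
  have V: "V \<in> carrier_mat n n" using assms by (simp add: orthogonal_matrix_def)
  have "Determinant.det (V * mat_diag n l * V\<^sup>T) = (Determinant.det V)\<^sup>2 * Determinant.det (mat_diag n l)"
    using V det_transpose[OF V] by (simp add: det_mult[of _ n] power2_eq_square mult_carrier_mat[of _ n n])
  then show ?thesis unfolding orthogonal_matrix_det[OF assms] det_mat_diag by simp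
qed

lemma spectral_char_poly:
  assumes "orthogonal_matrix n V"
  shows "char_poly (V * mat_diag n l * V\<^sup>T) = (\<Prod>i<n. [:- l i, 1:])"
proof -
  have V: "V \<in> carrier_mat n n" "V\<^sup>T * V = 1\<^sub>m n" "V * V\<^sup>T = 1\<^sub>m n"
    using assms by (auto simp: orthogonal_matrix_def)
  have "similar_mat (V * mat_diag n l * V\<^sup>T) (mat_diag n l)"
    unfolding similar_mat_def using V
    by (intro exI[of _ V] exI[of _ "V\<^sup>T"] similar_mat_witI[of _ _ n]) auto
  then have "char_poly (V * mat_diag n l * V\<^sup>T) = char_poly (mat_diag n l)"
    by (rule char_poly_similar)
  also have "\<dots> = (\<Prod>a \<leftarrow> diag_mat (mat_diag n l). [:- a, 1:])"
    by (rule char_poly_upper_triangular[of _ n]) auto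
  also have "diag_mat (mat_diag n l) = map l [0..<n]" by (simp add: diag_mat_def)
  also have "(\<Prod>a \<leftarrow> map l [0..<n]. [:- a, 1:]) = (\<Prod>i<n. [:- l i, 1:])"
    by (induction n) simp_all
  finally show ?thesis .
qed

lemma spectral_pos_eigenvalues:
  assumes "orthogonal_matrix n V" "\<And>i. i < n \<Longrightarrow> 0 < l i"
  shows "pos_eigenvalues (V * mat_diag n l * V\<^sup>T) = image_mset l (mset_set {..<n})"
proof -
  have sum: "(\<Sum>i\<in>S. {#l i#}) = image_mset l (mset_set S)" if "finite S" for S
    using that by (induction S rule: finite_induct) auto
  have "proots (\<Prod>i\<in>S. [:- l i, 1:]) = image_mset l (mset_set S)" if "finite S" for S
    using sum[OF that] by (subst proots_prod) auto
  then have "proots (\<Prod>i<n. [:- l i, 1:]) = image_mset l (mset_set {..<n})" by simp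
  then show ?thesis unfolding pos_eigenvalues_def spectral_char_poly[OF assms(1)]
    using assms(2) by (subst filter_mset_eq_conv) auto
qed

lemma det_pos_eigenvalue_mat: "Determinant.det (pos_eigenvalue_mat A) = prod_mset (pos_eigenvalues A)"
proof -
  define es where "es = rev (sorted_list_of_multiset (pos_eigenvalues A))"
  have "Determinant.det (pos_eigenvalue_mat A) = (\<Prod>i<length es. es ! i)"
    unfolding pos_eigenvalue_mat_def es_def[symmetric] Let_def by (rule det_mat_diag)
  also have "\<dots> = prod_list es"
    by (simp add: prod.list_conv_set_nth atLeast0LessThan)
  also have "\<dots> = prod_mset (mset es)" by (simp add: prod_mset_prod_list)
  also have "mset es = pos_eigenvalues A" by (simp add: es_def)
  finally show ?thesis .
qed

lemma spectral_diag:
  assumes "orthogonal_matrix n V" "A = V * mat_diag n l * V\<^sup>T"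
  shows "V\<^sup>T * A * V = mat_diag n l"
proof -
  have V: "V \<in> carrier_mat n n" "V\<^sup>T * V = 1\<^sub>m n" using assms by (auto simp: orthogonal_matrix_def)
  have "V\<^sup>T * A * V = (V\<^sup>T * V) * mat_diag n l * (V\<^sup>T * V)"
    unfolding assms(2) using V(1) by (simp add: mat_mult_assoc)
  then show ?thesis using V(2) by (simp add: mat_one_mult)
qed

lemma gram_spectral_nonneg:
  assumes V: "orthogonal_matrix n V" and Y: "Y \<in> carrier_mat m n"
    and eq: "Y\<^sup>T * Y = V * mat_diag n l * V\<^sup>T" and i: "i < n"
  shows "0 \<le> l i"
proof -
  have Vc: "V \<in> carrier_mat n n" using V by (simp add: orthogonal_matrix_def)
  have "mat_diag n l = (Y * V)\<^sup>T * (Y * V)"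
    unfolding spectral_diag[OF V eq, symmetric] using Y Vc by (simp add: mat_transpose_mult mat_mult_assoc)
  then have "l i = ((Y * V)\<^sup>T * (Y * V)) $$ (i,i)" using i by (metis mat_diag_index)
  also have "\<dots> = (\<Sum>k<m. ((Y * V) $$ (k,i))\<^sup>2)"
    using Y Vc i by (subst mat_mult_index) (auto simp: power2_eq_square simp del: index_mult_mat(1))
  finally show ?thesis by (simp add: sum_nonneg)
qed

lemma gram_spectral_decomposition:
  assumes Y: "Y \<in> carrier_mat m n"
  obtains V l where "orthogonal_matrix n V" "Y\<^sup>T * Y = V * mat_diag n l * V\<^sup>T" "\<And>i. i < n \<Longrightarrow> 0 \<le> l i"
proof -
  have "Y\<^sup>T * Y \<in> carrier_mat n n" "(Y\<^sup>T * Y)\<^sup>T = Y\<^sup>T * Y" using Y by (auto simp: mat_transpose_mult)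
  from spectral_theorem_exists[OF this] obtain V l where
    *: "orthogonal_matrix n V" "Y\<^sup>T * Y = V * mat_diag n l * V\<^sup>T" by blast
  show thesis by (rule that[OF *]) (rule gram_spectral_nonneg[OF *(1) Y *(2)])
qed

lemma det_gram_square:
  fixes Y :: "real mat"
  assumes Y: "Y \<in> carrier_mat n n"
  shows "Determinant.det (Y\<^sup>T * Y) = (Determinant.det Y)\<^sup>2"
  using det_mult[of "Y\<^sup>T" n Y] det_transpose[OF Y] Y by (simp add: power2_eq_square)

lemma gram_square_pos_eigenvalues:
  assumes Y: "Y \<in> carrier_mat n n" and det: "Determinant.det Y \<noteq> 0"
  shows "prod_mset (pos_eigenvalues (Y\<^sup>T * Y)) = (Determinant.det Y)\<^sup>2"
proof -
  obtain V l where V: "orthogonal_matrix n V" and eq: "Y\<^sup>T * Y = V * mat_diag n l * V\<^sup>T"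
    and l: "\<And>i. i < n \<Longrightarrow> 0 \<le> l i"
    using gram_spectral_decomposition[OF Y] by blast
  have prod: "(\<Prod>i<n. l i) = (Determinant.det Y)\<^sup>2"
    using spectral_det[OF V, of l] eq det_gram_square[OF Y] by simp
  have "0 < l i" if "i < n" for i
  proof -
    have "l i \<noteq> 0"
    proof
      assume "l i = 0"
      then have "(\<Prod>i<n. l i) = 0" using that by (intro prod_zero) auto
      then show False using prod det by simp
    qed
    then show ?thesis using l[OF that] by simp
  qed
  then show ?thesis
    unfolding eq spectral_pos_eigenvalues[OF V, of l] prod[symmetric]
    by (subst spectral_pos_eigenvalues[OF V]) (auto simp: prod_unfold_prod_mset)
qed

text \<open>A product of two Gram matrices need not be symmetric. Moving \<open>N\<close> cyclically
  to the front turns it into the Gram matrix of M N^T, whose eigenvalues are under control.\<close>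

lemma det_pos_eigenvalue_mat_gram_mult:
  assumes M: "M \<in> carrier_mat n n" "Determinant.det M \<noteq> 0" and N: "N \<in> carrier_mat n n" "Determinant.det N \<noteq> 0"
  shows "prod_mset (pos_eigenvalues ((M\<^sup>T * M) * (N\<^sup>T * N))) = (Determinant.det M)\<^sup>2 * (Determinant.det N)\<^sup>2"
proof -
  have "pos_eigenvalues ((M\<^sup>T * M) * (N\<^sup>T * N)) = pos_eigenvalues ((M\<^sup>T * M * N\<^sup>T) * N)"
    using M N by (simp add: mat_mult_assoc)
  also have "\<dots> = pos_eigenvalues (N * (M\<^sup>T * M * N\<^sup>T))"
    by (rule pos_eigenvalues_mult_commute[of _ n n]) (use M N in auto)
  also have "N * (M\<^sup>T * M * N\<^sup>T) = (M * N\<^sup>T)\<^sup>T * (M * N\<^sup>T)"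
    using M N by (simp add: mat_mult_assoc mat_transpose_mult)
  finally show ?thesis
    using gram_square_pos_eigenvalues[of "M * N\<^sup>T" n] M N
    by (simp add: det_mult[of _ n] det_transpose power_mult_distrib)
qed

section \<open>Moore-Penrose inverse and eigenvalues of the estimators\<close>

lemma mat_mult_cancel:
  fixes A B W :: "real mat"
  assumes "A * B = 1\<^sub>m n" "dim_col A = dim_row B" "dim_col B = dim_row W" "dim_row W = n"
  shows "A * (B * W) = W"
  using mat_mult_assoc[OF assms(2,3)] assms by (simp add: mat_one_mult)

lemma mat_mult_transpose_self_zero:
  fixes Y :: "real mat"
  assumes "Y * Y\<^sup>T = 0\<^sub>m (dim_row Y) (dim_row Y)"
  shows "Y = 0\<^sub>m (dim_row Y) (dim_col Y)"
proof (rule eq_matI)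
  fix i j assume "i < dim_row (0\<^sub>m (dim_row Y) (dim_col Y))" "j < dim_col (0\<^sub>m (dim_row Y) (dim_col Y))"
  then have ij: "i < dim_row Y" "j < dim_col Y" by auto
  have "(\<Sum>k<dim_col Y. (Y $$ (i,k))\<^sup>2) = (Y * Y\<^sup>T) $$ (i,i)"
    using ij by (subst mat_mult_index) (auto simp: power2_eq_square)
  also have "\<dots> = 0" using ij assms by simp
  finally have "Y $$ (i,j) = 0" using ij by (subst (asm) sum_nonneg_eq_0_iff) auto
  then show "Y $$ (i,j) = 0\<^sub>m (dim_row Y) (dim_col Y) $$ (i,j)" using ij by simp
qed auto

text \<open>Besides the products of positive definite matrices, this square root supplies the factor
  of B^T B on which both cases of the final proof rest.\<close>

lemma mat_sqrt_gram:
  assumes V: "orthogonal_matrix n V" and l: "\<And>i. i < n \<Longrightarrow> 0 \<le> l i"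
  defines "M \<equiv> mat_diag n (\<lambda>i. sqrt (l i)) * V\<^sup>T"
  shows "M \<in> carrier_mat n n" "M\<^sup>T * M = V * mat_diag n l * V\<^sup>T" "(Determinant.det M)\<^sup>2 = (\<Prod>i<n. l i)"
proof -
  have Vc: "V \<in> carrier_mat n n" using V by (simp add: orthogonal_matrix_def)
  show M: "M \<in> carrier_mat n n" using Vc by (auto simp: M_def)
  have "M\<^sup>T * M = V * (mat_diag n (\<lambda>i. sqrt (l i)) * mat_diag n (\<lambda>i. sqrt (l i))) * V\<^sup>T"
    unfolding M_def using Vc by (simp add: mat_transpose_mult mat_mult_assoc del: mat_diag_diag)
  also have "mat_diag n (\<lambda>i. sqrt (l i)) * mat_diag n (\<lambda>i. sqrt (l i)) = mat_diag n l"
    using l by (auto intro: mat_diag_cong)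
  finally show eq: "M\<^sup>T * M = V * mat_diag n l * V\<^sup>T" .
  show "(Determinant.det M)\<^sup>2 = (\<Prod>i<n. l i)"
    using det_gram_square[OF M] spectral_det[OF V, of l] eq by simp
qed

lemma prod_pos_eigenvalues_pd_mult:
  assumes V: "orthogonal_matrix n V" "\<And>i. i < n \<Longrightarrow> 0 < l i"
    and W: "orthogonal_matrix n W" "\<And>i. i < n \<Longrightarrow> 0 < k i"
  shows "prod_mset (pos_eigenvalues ((V * mat_diag n l * V\<^sup>T) * (W * mat_diag n k * W\<^sup>T))) = (\<Prod>i<n. l i) * (\<Prod>i<n. k i)"
proof -
  define M where "M = mat_diag n (\<lambda>i. sqrt (l i)) * V\<^sup>T"
  define N where "N = mat_diag n (\<lambda>i. sqrt (k i)) * W\<^sup>T"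
  have l0: "\<And>i. i < n \<Longrightarrow> 0 \<le> l i" and k0: "\<And>i. i < n \<Longrightarrow> 0 \<le> k i"
    using V(2) W(2) by (auto intro: less_imp_le)
  have M: "M \<in> carrier_mat n n" "M\<^sup>T * M = V * mat_diag n l * V\<^sup>T" "(Determinant.det M)\<^sup>2 = (\<Prod>i<n. l i)"
    unfolding M_def by (rule mat_sqrt_gram[OF V(1) l0]; assumption)+
  have N: "N \<in> carrier_mat n n" "N\<^sup>T * N = W * mat_diag n k * W\<^sup>T" "(Determinant.det N)\<^sup>2 = (\<Prod>i<n. k i)"
    unfolding N_def by (rule mat_sqrt_gram[OF W(1) k0]; assumption)+
  have "0 < (Determinant.det M)\<^sup>2" "0 < (Determinant.det N)\<^sup>2"
    unfolding M(3) N(3) using V W by (auto intro!: prod_pos)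
  then have nz: "Determinant.det M \<noteq> 0" "Determinant.det N \<noteq> 0" by auto
  have "prod_mset (pos_eigenvalues ((M\<^sup>T * M) * (N\<^sup>T * N))) = (Determinant.det M)\<^sup>2 * (Determinant.det N)\<^sup>2"
    by (rule det_pos_eigenvalue_mat_gram_mult[OF M(1) nz(1) N(1) nz(2)])
  then show ?thesis unfolding M(2,3) N(2,3) .
qed

lemma spectral_pos_of_det:
  assumes "orthogonal_matrix n V" "\<And>i. i < n \<Longrightarrow> 0 \<le> l i"
    "Determinant.det (V * mat_diag n l * V\<^sup>T) \<noteq> 0" "i < n"
  shows "0 < l i"
proof -
  have "l i \<noteq> 0" using assms(3,4) unfolding spectral_det[OF assms(1)] by auto
  then show ?thesis using assms(2)[OF assms(4)] by simp
qed

lemma rank_sum_outer_le: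
  fixes Y :: "real mat"
  assumes "finite S"
  shows "vec_space.rank p (Matrix.mat p p (\<lambda>(i,j). \<Sum>k\<in>S. Y $$ (i,k) * Y $$ (j,k))) \<le> card S"
  using assms
proof (induction S)
  case empty
  have "Matrix.mat p p (\<lambda>(i,j). \<Sum>k\<in>{}. Y $$ (i,k) * Y $$ (j,k)) = 0\<^sub>m p p" by (rule eq_matI) auto
  then show ?case by (simp only: vec_space.rank_0I)
next
  case (insert k S)
  let ?O = "Matrix.mat p p (\<lambda>(i,j). Y $$ (i,k) * Y $$ (j,k))"
  let ?M = "\<lambda>S. Matrix.mat p p (\<lambda>(i,j). \<Sum>k\<in>S. Y $$ (i,k) * Y $$ (j,k))"
  have eq: "?M (insert k S) = ?O + ?M S" by (rule eq_matI) (use insert in auto)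
  have "vec_space.rank p ?O \<le> 1"
    by (rule vec_space.rank_le_1_product_entries[where f = "\<lambda>i. Y $$ (i,k)" and g = "\<lambda>j. Y $$ (j,k)"]) auto
  moreover have "vec_space.rank p (?O + ?M S) \<le> vec_space.rank p ?O + vec_space.rank p (?M S)"
    by (rule vec_space.rank_subadditive[of _ _ p]) auto
  ultimately show ?case unfolding eq using insert by simp
qed

text \<open>With \<open>Y = B * V\<close> for an eigenbasis V of B^T B, a zero eigenvalue makes a
  column of \<open>Y\<close> vanish. Then B B^T = Y Y^T is a sum of r - 1 outer products, and its
  rank is below r.\<close>

lemma det_gram_of_full_rank:
  fixes B :: "real mat"
  assumes B: "B \<in> carrier_mat p r" and rank: "vec_space.rank p (B * B\<^sup>T) = r"
  shows "Determinant.det (B\<^sup>T * B) \<noteq> 0"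
proof
  assume det: "Determinant.det (B\<^sup>T * B) = 0"
  obtain V l where V: "orthogonal_matrix r V" and eq: "B\<^sup>T * B = V * mat_diag r l * V\<^sup>T"
    and l: "\<And>i. i < r \<Longrightarrow> 0 \<le> l i"
    using gram_spectral_decomposition[OF B] by blast
  obtain j where j: "j < r" "l j = 0"
    using det unfolding eq spectral_det[OF V] by auto
  have Vc: "V \<in> carrier_mat r r" "V * V\<^sup>T = 1\<^sub>m r" using V by (auto simp: orthogonal_matrix_def)
  define Y where "Y = B * V"
  have Y: "Y \<in> carrier_mat p r" using B Vc by (simp add: Y_def)
  have "Y\<^sup>T * Y = mat_diag r l"
    unfolding spectral_diag[OF V eq, symmetric] Y_def using B Vc by (simp add: mat_transpose_mult mat_mult_assoc)
  from arg_cong[OF this, of "\<lambda>X. X $$ (j,j)"] have "(\<Sum>i<p. (Y $$ (i,j))\<^sup>2) = 0"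
    using Y j by (subst (asm) mat_mult_index) (auto simp: power2_eq_square)
  then have Y0: "Y $$ (i,j) = 0" if "i < p" for i
    using that by (subst (asm) sum_nonneg_eq_0_iff) auto
  have "B * B\<^sup>T = Y * Y\<^sup>T"
    unfolding Y_def using B Vc by (simp add: mat_transpose_mult mat_mult_assoc mat_mult_cancel[OF Vc(2)])
  also have "\<dots> = Matrix.mat p p (\<lambda>(i,k). \<Sum>t\<in>{..<r}-{j}. Y $$ (i,t) * Y $$ (k,t))"
  proof (rule eq_matI)
    fix i k assume "i < dim_row (Matrix.mat p p (\<lambda>(i,k). \<Sum>t\<in>{..<r}-{j}. Y $$ (i,t) * Y $$ (k,t)))"
      "k < dim_col (Matrix.mat p p (\<lambda>(i,k). \<Sum>t\<in>{..<r}-{j}. Y $$ (i,t) * Y $$ (k,t)))"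
    then have ik: "i < p" "k < p" by auto
    have "(Y * Y\<^sup>T) $$ (i,k) = (\<Sum>t<r. Y $$ (i,t) * Y $$ (k,t))"
      using ik Y by (subst mat_mult_index) auto
    also have "\<dots> = (\<Sum>t\<in>{..<r}-{j}. Y $$ (i,t) * Y $$ (k,t))"
      using j Y0[OF ik(1)] by (subst sum.remove[of _ j]) auto
    finally show "(Y * Y\<^sup>T) $$ (i,k) = Matrix.mat p p (\<lambda>(i,k). \<Sum>t\<in>{..<r}-{j}. Y $$ (i,t) * Y $$ (k,t)) $$ (i,k)"
      using ik by simp
  qed (use Y in auto)
  finally have "r \<le> card ({..<r} - {j})" using rank_sum_outer_le[of "{..<r}-{j}" p Y] rank by simp
  then show False using j by simp
qed

lemma det_nonzero_inverse:
  fixes A :: "real mat"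
  assumes A: "A \<in> carrier_mat n n" and det: "Determinant.det A \<noteq> 0"
  obtains Ai where "Ai \<in> carrier_mat n n" "A * Ai = 1\<^sub>m n" "Ai * A = 1\<^sub>m n"
proof -
  define Ai where "Ai = (1 / Determinant.det A) \<cdot>\<^sub>m adj_mat A"
  have Ai: "Ai \<in> carrier_mat n n" using adj_mat[OF A] by (simp add: Ai_def)
  have "A * Ai = 1\<^sub>m n" unfolding Ai_def using adj_mat[OF A] A det
    by (subst mult_smult_distrib[of _ n n _ n]) auto
  moreover have "Ai * A = 1\<^sub>m n" unfolding Ai_def using adj_mat[OF A] A det
    by (subst mult_smult_assoc_mat[of _ n n _ n]) auto
  ultimately show thesis using that Ai by blast
qed

lemma gram_inverse_symmetric:
  fixes K Ki :: "real mat"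
  assumes "K \<in> carrier_mat n n" "K\<^sup>T = K" "Ki \<in> carrier_mat n n" "K * Ki = 1\<^sub>m n" "Ki * K = 1\<^sub>m n"
  shows "Ki\<^sup>T = Ki"
proof -
  have "(K * Ki)\<^sup>T = Ki\<^sup>T * K" using assms by (subst mat_transpose_mult) auto
  then have "Ki\<^sup>T * K = 1\<^sub>m n" using assms(4) by simp
  then have "Ki\<^sup>T * K * Ki = Ki" using assms by (simp add: mat_one_mult)
  then show ?thesis using assms by (simp add: mat_mult_assoc mat_one_mult)
qed

text \<open>For B of full column rank the pseudoinverse of B B^T is B (B^T B)^-2 B^T; the Penrose
  equations follow by cancelling B^T B against \<open>Ki\<close>.\<close>

lemma mp_inverse_gram:
  fixes B Ki :: "real mat"
  assumes B: "B \<in> carrier_mat p r" and Ki: "Ki \<in> carrier_mat r r" "B\<^sup>T * B * Ki = 1\<^sub>m r" "Ki * (B\<^sup>T * B) = 1\<^sub>m r"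
  shows "mp_inverse (B * B\<^sup>T) = B * Ki * Ki * B\<^sup>T"
proof -
  have sym: "Ki\<^sup>T = Ki"
    by (rule gram_inverse_symmetric[of "B\<^sup>T * B" r]) (use B Ki in \<open>auto simp: mat_transpose_mult\<close>)
  note dims = carrier_matD[OF B] carrier_matD[OF Ki(1)]
  have c1: "B\<^sup>T * (B * (Ki * W)) = W" if "dim_row W = r" for W
    using mat_mult_cancel[OF Ki(2), of W] that dims by (simp add: mat_mult_assoc)
  have c2: "Ki * (B\<^sup>T * (B * W)) = W" if "dim_row W = r" for W
    using mat_mult_cancel[OF Ki(3), of W] that dims by (simp add: mat_mult_assoc)
  have "is_mp_inverse (B * B\<^sup>T) (B * Ki * Ki * B\<^sup>T)"
    unfolding is_mp_inverse_def using B Ki(1)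
    by (simp add: mat_mult_assoc mat_transpose_mult c1 c2 sym)
  then show ?thesis unfolding mp_inverse_def
    by (intro the_equality) (auto intro: is_mp_inverse_unique)
qed

text \<open>The residual \<open>N = X - H * (H\<^sup>T * X)\<close> satisfies N X^T = 0 because H
  H^T fixes X X^T. Hence N N^T = 0, which forces N = 0: the columns of X lie in the span of the
  eigenvectors.\<close>

lemma eigen_decomposition_project:
  fixes X :: "real mat"
  assumes X: "X \<in> carrier_mat p n" and eig: "eigen_decomposition q (X * X\<^sup>T) H l"
  shows "H * (H\<^sup>T * X) = X"
proof -
  have H: "H \<in> carrier_mat p q" and HH: "H\<^sup>T * H = 1\<^sub>m q" and S: "X * X\<^sup>T = H * mat_diag q l * H\<^sup>T"
    using eig X by (auto simp: eigen_decomposition_def)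
  note dims = carrier_matD[OF H] carrier_matD[OF X]
  define N where "N = X - H * (H\<^sup>T * X)"
  have N: "N \<in> carrier_mat p n" using H X by (auto simp: N_def)
  have NX: "N * X\<^sup>T = 0\<^sub>m p p"
  proof -
    have "N * X\<^sup>T = X * X\<^sup>T - H * (H\<^sup>T * X) * X\<^sup>T"
      unfolding N_def by (rule minus_mult_distrib_mat[of _ p n _ _ p]) (use H X in auto)
    also have "H * (H\<^sup>T * X) * X\<^sup>T = H * (H\<^sup>T * (X * X\<^sup>T))" by (simp add: mat_mult_assoc dims)
    also have "\<dots> = X * X\<^sup>T" unfolding S
      by (simp add: mat_mult_assoc mat_mult_cancel[OF HH] dims)
    finally show ?thesis using X by simp
  qed
  have "N * N\<^sup>T = N * X\<^sup>T - N * (H * (H\<^sup>T * X))\<^sup>T"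
    unfolding N_def by (subst transpose_minus[of _ p n]) (use H X in \<open>auto intro!: mult_minus_distrib_mat[of _ p n _ p]\<close>)
  also have "N * (H * (H\<^sup>T * X))\<^sup>T = (N * X\<^sup>T) * (H * H\<^sup>T)"
    using N by (simp add: mat_mult_assoc mat_transpose_mult dims)
  also have "N * X\<^sup>T - (N * X\<^sup>T) * (H * H\<^sup>T) = 0\<^sub>m p p"
    unfolding NX using H by (auto simp: left_mult_zero_mat[of _ p p])
  finally have "N * N\<^sup>T = 0\<^sub>m p p" .
  then have "N = 0\<^sub>m p n" using mat_mult_transpose_self_zero[of N] N by simp
  then have "X - H * (H\<^sup>T * X) = 0\<^sub>m p n" by (simp add: N_def)
  then have "(X - H * (H\<^sup>T * X)) $$ (i,j) = 0" if "i < p" "j < n" for i j using that by simp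
  then show ?thesis
    using X H by (intro eq_matI) (auto simp del: index_mult_mat(1))
qed

text \<open>Used for n \<le> r. \<open>V\<close> collects the right singular vectors of X = B Z, so
  H (l d) H^T becomes X (V d V^T) X^T. The pseudoinverse of B B^T maps B Z to B (B^T B)^-1 Z, and
  moving Z^T B^T to the front cancels B^T B. What remains is the Gaussian Gram matrix Z^T Z times a
  spectral function, and B enters only through \<open>V\<close>.\<close>

lemma haff_bridge_wide:
  fixes B Z :: "real mat"
  assumes B: "B \<in> carrier_mat p r" and Z: "Z \<in> carrier_mat r n"
    and rank: "vec_space.rank p (B * B\<^sup>T) = r"
    and eig: "eigen_decomposition n (B * Z * (B * Z)\<^sup>T) H l"
  obtains V where "orthogonal_matrix n V" "Z\<^sup>T * (B\<^sup>T * B) * Z = V * mat_diag n l * V\<^sup>T"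
    "0 < Determinant.det (Z\<^sup>T * Z)"
    "\<And>d. (\<And>i. i < n \<Longrightarrow> 0 < d i) \<Longrightarrow>
       mat_trace (mp_inverse (B * B\<^sup>T) * (H * mat_diag n (\<lambda>i. l i * d i) * H\<^sup>T)) = mat_trace (Z\<^sup>T * Z * (V * mat_diag n d * V\<^sup>T)) \<and>
       prod_mset (pos_eigenvalues (mp_inverse (B * B\<^sup>T) * (H * mat_diag n (\<lambda>i. l i * d i) * H\<^sup>T)))
         = (\<Prod>i<n. d i) * Determinant.det (Z\<^sup>T * Z)"
proof -
  define X where "X = B * Z"
  have X: "X \<in> carrier_mat p n" using B Z by (simp add: X_def)
  have H: "H \<in> carrier_mat p n" and HH: "H\<^sup>T * H = 1\<^sub>m n" and S: "X * X\<^sup>T = H * mat_diag n l * H\<^sup>T"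
    and l: "\<And>i. i < n \<Longrightarrow> 0 < l i"
    using eig X by (auto simp: eigen_decomposition_def X_def)
  have HHX: "H * (H\<^sup>T * X) = X" using eigen_decomposition_project[OF X] eig by (simp add: X_def)
  have K: "B\<^sup>T * B \<in> carrier_mat r r" using B by auto
  obtain Ki where Ki: "Ki \<in> carrier_mat r r" "B\<^sup>T * B * Ki = 1\<^sub>m r" "Ki * (B\<^sup>T * B) = 1\<^sub>m r"
    using det_nonzero_inverse[OF K det_gram_of_full_rank[OF B rank]] by blast
  note mp = mp_inverse_gram[OF B Ki]
  note dims = carrier_matD[OF H] carrier_matD[OF X] carrier_matD[OF B] carrier_matD[OF Z] carrier_matD[OF Ki(1)]
  define V where "V = X\<^sup>T * H * mat_diag n (\<lambda>i. 1 / sqrt (l i))"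
  have Vc: "V \<in> carrier_mat n n" using X H by (auto simp: V_def)
  have HS: "H\<^sup>T * (X * (X\<^sup>T * (H * W))) = mat_diag n l * W" if "dim_row W = n" for W
  proof -
    have "H\<^sup>T * (X * (X\<^sup>T * (H * W))) = H\<^sup>T * ((X * X\<^sup>T) * (H * W))"
      using that by (simp add: mat_mult_assoc dims)
    then show ?thesis unfolding S using that
      by (simp add: mat_mult_assoc mat_mult_cancel[OF HH] dims)
  qed
  have dd: "mat_diag n (\<lambda>i. 1 / sqrt (l i)) * (mat_diag n l * mat_diag n (\<lambda>i. 1 / sqrt (l i))) = 1\<^sub>m n"
  proof -
    have "1 / sqrt (l i) * (l i * (1 / sqrt (l i))) = 1" if "i < n" for i
      using l[OF that] by (simp add: field_simps)
    then show ?thesis by (simp, subst mat_diag_one[symmetric], intro mat_diag_cong) simp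
  qed
  have VT: "V\<^sup>T = mat_diag n (\<lambda>i. 1 / sqrt (l i)) * (H\<^sup>T * X)"
    unfolding V_def by (simp add: mat_mult_assoc mat_transpose_mult dims)
  have "V\<^sup>T * V = 1\<^sub>m n"
    unfolding VT unfolding V_def by (simp add: mat_mult_assoc HS dims dd del: mat_diag_diag)
  then have V: "orthogonal_matrix n V" by (rule orthogonal_matrixI[OF Vc])
  have VlV: "V * mat_diag n l * V\<^sup>T = X\<^sup>T * X"
  proof -
    have "mat_diag n (\<lambda>i. 1 / sqrt (l i)) * (mat_diag n l * (mat_diag n (\<lambda>i. 1 / sqrt (l i)) * W)) = W"
      if "dim_row W = n" for W using mat_mult_cancel[of "mat_diag n (\<lambda>i. 1 / sqrt (l i))" "mat_diag n l * mat_diag n (\<lambda>i. 1 / sqrt (l i))" n W] dd that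
      by (simp add: mat_mult_assoc del: mat_diag_diag)
    then show ?thesis unfolding VT unfolding V_def
      by (simp add: mat_mult_assoc dims HHX del: mat_diag_diag)
  qed
  have gram: "Z\<^sup>T * (B\<^sup>T * B) * Z = X\<^sup>T * X"
    unfolding X_def by (simp add: mat_mult_assoc mat_transpose_mult dims)
  have XV: "X * V = H * mat_diag n (\<lambda>i. sqrt (l i))"
  proof -
    have "X * V = (X * X\<^sup>T) * (H * mat_diag n (\<lambda>i. 1 / sqrt (l i)))"
      unfolding V_def by (simp add: mat_mult_assoc dims)
    also have "\<dots> = H * (mat_diag n l * mat_diag n (\<lambda>i. 1 / sqrt (l i)))"
      unfolding S by (simp add: mat_mult_assoc dims mat_mult_cancel[OF HH] del: mat_diag_diag)
    also have "mat_diag n l * mat_diag n (\<lambda>i. 1 / sqrt (l i)) = mat_diag n (\<lambda>i. sqrt (l i))"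
      using l by (auto intro!: mat_diag_cong simp: real_div_sqrt less_imp_le)
    finally show ?thesis .
  qed
  have HdH: "H * mat_diag n (\<lambda>i. l i * d i) * H\<^sup>T = X * (V * mat_diag n d * V\<^sup>T) * X\<^sup>T" for d
  proof -
    have "X * (V * mat_diag n d * V\<^sup>T) * X\<^sup>T = (X * V) * mat_diag n d * (X * V)\<^sup>T"
      using Vc by (simp add: mat_mult_assoc mat_transpose_mult dims)
    also have "\<dots> = H * (mat_diag n (\<lambda>i. sqrt (l i)) * (mat_diag n d * mat_diag n (\<lambda>i. sqrt (l i)))) * H\<^sup>T"
      unfolding XV by (simp add: mat_mult_assoc mat_transpose_mult dims del: mat_diag_diag)
    also have "mat_diag n (\<lambda>i. sqrt (l i)) * (mat_diag n d * mat_diag n (\<lambda>i. sqrt (l i))) = mat_diag n (\<lambda>i. l i * d i)"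
      using l by (auto intro!: mat_diag_cong simp: less_imp_le mult.commute mult.left_commute)
    finally show ?thesis by simp
  qed
  have c1: "B\<^sup>T * (B * (Ki * W)) = W" if "dim_row W = r" for W
    using mat_mult_cancel[OF Ki(2), of W] that dims by (simp add: mat_mult_assoc)
  have c2: "Ki * (B\<^sup>T * (B * W)) = W" if "dim_row W = r" for W
    using mat_mult_cancel[OF Ki(3), of W] that dims by (simp add: mat_mult_assoc)
  have prod: "mp_inverse (B * B\<^sup>T) * (H * mat_diag n (\<lambda>i. l i * d i) * H\<^sup>T)
      = (B * (Ki * (Z * (V * mat_diag n d * V\<^sup>T)))) * (Z\<^sup>T * B\<^sup>T)" for d
    unfolding mp HdH unfolding X_def using Vc
    by (simp add: mat_mult_assoc mat_transpose_mult dims c2)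
  have swap: "(Z\<^sup>T * B\<^sup>T) * (B * (Ki * (Z * (V * mat_diag n d * V\<^sup>T)))) = Z\<^sup>T * Z * (V * mat_diag n d * V\<^sup>T)" for d
    using Vc by (simp add: mat_mult_assoc dims c1)
  obtain U u where U: "orthogonal_matrix n U" and Uu: "Z\<^sup>T * Z = U * mat_diag n u * U\<^sup>T"
    and u0: "\<And>i. i < n \<Longrightarrow> 0 \<le> u i"
    using gram_spectral_decomposition[OF Z] by blast
  \<comment> \<open>A kernel vector of Z^T Z is killed by Z and hence by X, whereas X^T X has the
    positive eigenvalues \<open>l\<close>. Invertibility of the Gaussian Gram matrix is thus read
    off the eigenvalue decomposition, without a null-set argument.\<close>
  have detZ: "Determinant.det (Z\<^sup>T * Z) \<noteq> 0"
  proof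
    assume "Determinant.det (Z\<^sup>T * Z) = 0"
    then obtain v where v: "v \<in> carrier_vec n" "v \<noteq> 0\<^sub>v n" "(Z\<^sup>T * Z) *\<^sub>v v = 0\<^sub>v n"
      using det_0_iff_vec_prod_zero_field[of "Z\<^sup>T * Z" n] Z by auto
    define w where "w = Matrix.mat n 1 (\<lambda>(i,_). v $ i)"
    have w: "w \<in> carrier_mat n 1" by (simp add: w_def)
    have aux: "(A * w) $$ (i,0) = (A *\<^sub>v v) $ i" if "A \<in> carrier_mat k n" "i < k" for A k i
      using that v(1) by (simp add: w_def scalar_prod_def)
    have ZZ: "Z\<^sup>T * Z \<in> carrier_mat n n" and XX: "X\<^sup>T * X \<in> carrier_mat n n" using X Z by auto
    have "(Z\<^sup>T * Z) * w = 0\<^sub>m n 1"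
      by (rule eq_matI) (use aux[OF ZZ] v(3) Z w in \<open>auto simp del: index_mult_mat(1)\<close>)
    then have "(Z * w)\<^sup>T * ((Z * w)\<^sup>T)\<^sup>T = 0\<^sub>m 1 1" using Z w
      by (simp add: mat_mult_assoc mat_transpose_mult)
    then have "(Z * w)\<^sup>T = 0\<^sub>m 1 r" using mat_mult_transpose_self_zero[of "(Z * w)\<^sup>T"] Z w by simp
    then have "((Z * w)\<^sup>T)\<^sup>T = (0\<^sub>m 1 r)\<^sup>T" by simp
    also have "(0\<^sub>m 1 r)\<^sup>T = (0\<^sub>m r 1 :: real mat)" by (rule eq_matI) auto
    finally have Zw: "Z * w = 0\<^sub>m r 1" by simp
    have "X\<^sup>T * X * w = 0\<^sub>m n 1" unfolding X_def using B Z w Zw by (simp add: mat_mult_assoc mat_transpose_mult)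
    moreover have "(X\<^sup>T * X *\<^sub>v v) $ i = (X\<^sup>T * X * w) $$ (i,0)" if "i < n" for i
      using aux[OF XX that] by simp
    ultimately have "X\<^sup>T * X *\<^sub>v v = 0\<^sub>v n" using X by (intro eq_vecI) auto
    then have "Determinant.det (X\<^sup>T * X) = 0"
      using det_0_iff_vec_prod_zero_field[of "X\<^sup>T * X" n] X v by auto
    moreover have "0 < (\<Prod>i<n. l i)" using l by (intro prod_pos) auto
    ultimately show False unfolding VlV[symmetric] spectral_det[OF V] by linarith
  qed
  have u: "0 < u i" if "i < n" for i
    by (rule spectral_pos_of_det[OF U u0 _ that]) (use detZ Uu in auto)
  have detpos: "0 < Determinant.det (Z\<^sup>T * Z)" unfolding Uu spectral_det[OF U] using u by (intro prod_pos) auto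
  show thesis
  proof (rule that[OF V _ detpos])
    show "Z\<^sup>T * (B\<^sup>T * B) * Z = V * mat_diag n l * V\<^sup>T" using gram VlV by simp
    fix d :: "nat \<Rightarrow> real" assume d: "\<And>i. i < n \<Longrightarrow> 0 < d i"
    have 1: "mat_trace (mp_inverse (B * B\<^sup>T) * (H * mat_diag n (\<lambda>i. l i * d i) * H\<^sup>T)) = mat_trace (Z\<^sup>T * Z * (V * mat_diag n d * V\<^sup>T))"
      unfolding prod swap[symmetric] by (rule mat_trace_commute) (use dims Vc in auto)
    have 2: "pos_eigenvalues (mp_inverse (B * B\<^sup>T) * (H * mat_diag n (\<lambda>i. l i * d i) * H\<^sup>T)) = pos_eigenvalues (Z\<^sup>T * Z * (V * mat_diag n d * V\<^sup>T))"
      unfolding prod swap[symmetric] by (rule pos_eigenvalues_mult_commute[of _ p n]) (use B Z Ki Vc in auto)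
    show "mat_trace (mp_inverse (B * B\<^sup>T) * (H * mat_diag n (\<lambda>i. l i * d i) * H\<^sup>T)) = mat_trace (Z\<^sup>T * Z * (V * mat_diag n d * V\<^sup>T)) \<and>
       prod_mset (pos_eigenvalues (mp_inverse (B * B\<^sup>T) * (H * mat_diag n (\<lambda>i. l i * d i) * H\<^sup>T)))
         = (\<Prod>i<n. d i) * Determinant.det (Z\<^sup>T * Z)"
    proof -
      have "prod_mset (pos_eigenvalues ((U * mat_diag n u * U\<^sup>T) * (V * mat_diag n d * V\<^sup>T))) = (\<Prod>i<n. u i) * (\<Prod>i<n. d i)"
        by (rule prod_pos_eigenvalues_pd_mult[OF U u V]) (use d in auto)
      then show ?thesis using 1 unfolding 2 unfolding Uu spectral_det[OF U] by simp
    qed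
  qed
qed

text \<open>Used for r < n. B = U J with U of orthonormal columns. \<open>H\<close> lies in the
  range of U, so \<open>V = U\<^sup>T * H\<close> is a full orthonormal set of eigenvectors of J Z
  Z^T J^T, and the pseudoinverse of B B^T is U J^-T J^-1 U^T.\<close>

lemma haff_bridge_tall:
  fixes B Z J :: "real mat"
  assumes B: "B \<in> carrier_mat p r" and Z: "Z \<in> carrier_mat r n"
    and J: "J \<in> carrier_mat r r" "J\<^sup>T * J = B\<^sup>T * B" and Ji: "Ji \<in> carrier_mat r r" "J * Ji = 1\<^sub>m r" "Ji * J = 1\<^sub>m r"
    and eig: "eigen_decomposition r (B * Z * (B * Z)\<^sup>T) H l"
  obtains V where "orthogonal_matrix r V" "J * (Z * Z\<^sup>T) * J\<^sup>T = V * mat_diag r l * V\<^sup>T"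
    "0 < Determinant.det (Z * Z\<^sup>T)"
    "\<And>d. (\<And>i. i < r \<Longrightarrow> 0 < d i) \<Longrightarrow>
       mat_trace (mp_inverse (B * B\<^sup>T) * (H * mat_diag r (\<lambda>i. l i * d i) * H\<^sup>T)) = mat_trace (Ji\<^sup>T * (Z * Z\<^sup>T) * J\<^sup>T * (V * mat_diag r d * V\<^sup>T)) \<and>
       prod_mset (pos_eigenvalues (mp_inverse (B * B\<^sup>T) * (H * mat_diag r (\<lambda>i. l i * d i) * H\<^sup>T)))
         = (\<Prod>i<r. d i) * Determinant.det (Z * Z\<^sup>T)"
proof -
  define X where "X = B * Z"
  have X: "X \<in> carrier_mat p n" using B Z by (simp add: X_def)
  have H: "H \<in> carrier_mat p r" and HH: "H\<^sup>T * H = 1\<^sub>m r" and S: "X * X\<^sup>T = H * mat_diag r l * H\<^sup>T"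
    and l: "\<And>i. i < r \<Longrightarrow> 0 < l i"
    using eig X by (auto simp: eigen_decomposition_def X_def)
  have JTi: "J\<^sup>T * Ji\<^sup>T = 1\<^sub>m r" "Ji\<^sup>T * J\<^sup>T = 1\<^sub>m r"
  proof -
    have "J\<^sup>T * Ji\<^sup>T = (Ji * J)\<^sup>T" "Ji\<^sup>T * J\<^sup>T = (J * Ji)\<^sup>T"
      using J(1) Ji(1) by (auto simp: mat_transpose_mult simp del: transpose_mult)
    then show "J\<^sup>T * Ji\<^sup>T = 1\<^sub>m r" "Ji\<^sup>T * J\<^sup>T = 1\<^sub>m r" unfolding Ji by auto
  qed
  define U where "U = B * Ji"
  have U: "U \<in> carrier_mat p r" using B Ji by (simp add: U_def)
  note dims = carrier_matD[OF H] carrier_matD[OF X] carrier_matD[OF B] carrier_matD[OF Z] carrier_matD[OF J(1)] carrier_matD[OF Ji(1)]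
    carrier_matD[OF U]
  have BB: "B\<^sup>T * (B * W) = J\<^sup>T * (J * W)" if "dim_row W = r" for W
    using arg_cong[OF J(2), of "\<lambda>M. M * W"] that by (simp add: mat_mult_assoc dims)
  have BU: "B = U * J" unfolding U_def using Ji by (simp add: mat_mult_assoc mat_one_mult dims)
  have UU: "U\<^sup>T * U = 1\<^sub>m r" unfolding U_def
    by (simp add: mat_mult_assoc mat_transpose_mult dims BB mat_mult_cancel[OF JTi(2)] Ji JTi)
  define Ki where "Ki = Ji * Ji\<^sup>T"
  have Ki: "Ki \<in> carrier_mat r r" "B\<^sup>T * B * Ki = 1\<^sub>m r" "Ki * (B\<^sup>T * B) = 1\<^sub>m r"
    unfolding Ki_def J(2)[symmetric] using Ji
    by (auto simp: mat_mult_assoc dims mat_mult_cancel[OF JTi(2)] mat_mult_cancel[OF Ji(2)] JTi)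
  have mp: "mp_inverse (B * B\<^sup>T) = U * (Ji\<^sup>T * (Ji * U\<^sup>T))"
    unfolding mp_inverse_gram[OF B Ki] unfolding Ki_def BU
    by (simp add: mat_mult_assoc mat_transpose_mult dims mat_mult_cancel[OF Ji(2)] mat_mult_cancel[OF JTi(2)])
  define Y where "Y = J * Z"
  have Y: "Y \<in> carrier_mat r n" using J Z by (simp add: Y_def)
  have XUY: "X = U * Y" unfolding X_def Y_def BU by (simp add: mat_mult_assoc dims)
  \<comment> \<open>Writes \<open>H\<close> as X times a matrix, which puts its columns into the
    range of X and hence into that of \<open>U\<close>.\<close>
  have HSl: "H = X * (X\<^sup>T * (H * mat_diag r (\<lambda>i. 1 / l i)))"
  proof -
    have "X * (X\<^sup>T * (H * mat_diag r (\<lambda>i. 1 / l i))) = (X * X\<^sup>T) * (H * mat_diag r (\<lambda>i. 1 / l i))"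
      by (simp add: mat_mult_assoc dims)
    also have "\<dots> = H * (mat_diag r l * mat_diag r (\<lambda>i. 1 / l i))"
      unfolding S by (simp add: mat_mult_assoc mat_mult_cancel[OF HH] dims del: mat_diag_diag)
    also have "mat_diag r l * mat_diag r (\<lambda>i. 1 / l i) = 1\<^sub>m r"
      using l by (simp, subst mat_diag_one[symmetric], intro mat_diag_cong) (auto simp: less_imp_neq[symmetric])
    finally show ?thesis using H by simp
  qed
  define V where "V = U\<^sup>T * H"
  have Vc: "V \<in> carrier_mat r r" using U H by (simp add: V_def)
  have UV: "U * V = H"
  proof -
    have "U * V = U * (U\<^sup>T * (X * (X\<^sup>T * (H * mat_diag r (\<lambda>i. 1 / l i)))))" unfolding V_def using HSl by simp
    also have "\<dots> = X * (X\<^sup>T * (H * mat_diag r (\<lambda>i. 1 / l i)))"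
      using Y by (subst (1 3) XUY) (simp add: mat_mult_assoc dims mat_mult_cancel[OF UU])
    finally show ?thesis using HSl by simp
  qed
  have "V\<^sup>T * V = 1\<^sub>m r"
  proof -
    have "V\<^sup>T * V = H\<^sup>T * (U * V)" unfolding V_def by (simp add: mat_mult_assoc mat_transpose_mult dims)
    then show ?thesis unfolding UV using HH by simp
  qed
  then have V: "orthogonal_matrix r V" by (rule orthogonal_matrixI[OF Vc])
  have YY: "Y * Y\<^sup>T = V * mat_diag r l * V\<^sup>T"
  proof -
    have "V * mat_diag r l * V\<^sup>T = U\<^sup>T * (X * X\<^sup>T) * U"
      unfolding S V_def by (simp add: mat_mult_assoc mat_transpose_mult dims)
    also have "\<dots> = Y * Y\<^sup>T" unfolding XUY using Y UU
      by (simp add: mat_mult_assoc mat_transpose_mult dims mat_mult_cancel[OF UU] mat_one_mult)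
    finally show ?thesis by simp
  qed
  have gram: "J * (Z * Z\<^sup>T) * J\<^sup>T = Y * Y\<^sup>T" unfolding Y_def
    by (simp add: mat_mult_assoc mat_transpose_mult dims)
  have prod: "mp_inverse (B * B\<^sup>T) * (H * mat_diag r (\<lambda>i. l i * d i) * H\<^sup>T)
     = (U * (Ji\<^sup>T * (Ji * (V * mat_diag r (\<lambda>i. l i * d i) * V\<^sup>T)))) * U\<^sup>T" for d
    unfolding mp UV[symmetric] using Vc
    by (simp add: mat_mult_assoc mat_transpose_mult dims mat_mult_cancel[OF UU])
  have swap: "U\<^sup>T * (U * (Ji\<^sup>T * (Ji * (V * mat_diag r (\<lambda>i. l i * d i) * V\<^sup>T))))
     = (Ji\<^sup>T * Ji) * (V * mat_diag r (\<lambda>i. l i * d i) * V\<^sup>T)" for d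
    using Vc by (simp add: mat_mult_assoc dims mat_mult_cancel[OF UU])
  have VV: "V\<^sup>T * V = 1\<^sub>m r" using V by (simp add: orthogonal_matrix_def)
  \<comment> \<open>A factor V l V^T = J Z Z^T J^T is split off, whose leading J cancels against
    \<open>Ji\<close>. The result contains a similarity transform of Z Z^T, so that for d = 1 the
    trace is that of Z Z^T.\<close>
  have fact: "(Ji\<^sup>T * Ji) * (V * mat_diag r (\<lambda>i. l i * d i) * V\<^sup>T) = Ji\<^sup>T * (Z * Z\<^sup>T) * J\<^sup>T * (V * mat_diag r d * V\<^sup>T)" for d
  proof -
    have "V * mat_diag r (\<lambda>i. l i * d i) * V\<^sup>T = (V * mat_diag r l * V\<^sup>T) * (V * mat_diag r d * V\<^sup>T)"
      unfolding mat_diag_diag[symmetric] using Vc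
      by (simp add: mat_mult_assoc mat_mult_cancel[OF VV] del: mat_diag_diag)
    also have "\<dots> = J * (Z * (Z\<^sup>T * (J\<^sup>T * (V * mat_diag r d * V\<^sup>T))))"
      unfolding YY[symmetric] Y_def using Vc by (simp add: mat_mult_assoc mat_transpose_mult dims)
    finally show ?thesis using Vc
      by (simp add: mat_mult_assoc dims mat_mult_cancel[OF Ji(3)])
  qed
  have YTc: "Y\<^sup>T \<in> carrier_mat n r" using Y by simp
  have JiTJi: "Ji\<^sup>T * Ji \<in> carrier_mat r r" using Ji by simp
  obtain W w where W: "orthogonal_matrix r W" and Ww: "Ji\<^sup>T * Ji = W * mat_diag r w * W\<^sup>T"
    and w0: "\<And>i. i < r \<Longrightarrow> 0 \<le> w i"
    using gram_spectral_decomposition[OF Ji(1)] by blast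
  have detJ: "Determinant.det J * Determinant.det Ji = 1" using det_mult[OF J(1) Ji(1)] Ji by simp
  have w: "0 < w i" if "i < r" for i
  proof (rule spectral_pos_of_det[OF W w0 _ that])
    show "Determinant.det (W * mat_diag r w * W\<^sup>T) \<noteq> 0"
      unfolding Ww[symmetric] det_gram_square[OF Ji(1)] using detJ by auto
  qed
  have detZ: "(\<Prod>i<r. w i) * (\<Prod>i<r. l i) = Determinant.det (Z * Z\<^sup>T)"
  proof -
    have ZZ: "Z * Z\<^sup>T \<in> carrier_mat r r" using Z by simp
    have "(\<Prod>i<r. l i) = (Determinant.det J)\<^sup>2 * Determinant.det (Z * Z\<^sup>T)"
      unfolding spectral_det[OF V, symmetric] YY[symmetric] gram[symmetric]
      using J(1) ZZ by (simp add: det_mult[of _ r] det_transpose power2_eq_square)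
    moreover have "(\<Prod>i<r. w i) = (Determinant.det Ji)\<^sup>2"
      unfolding spectral_det[OF W, symmetric] Ww[symmetric] det_gram_square[OF Ji(1)] ..
    ultimately show ?thesis using detJ
      by (simp add: mult.assoc[symmetric] power_mult_distrib[symmetric] mult.commute[of "Determinant.det Ji"])
  qed
  have detpos: "0 < Determinant.det (Z * Z\<^sup>T)" unfolding detZ[symmetric] using w l by (intro mult_pos_pos prod_pos) auto
  show thesis
  proof (rule that[OF V _ detpos])
    show "J * (Z * Z\<^sup>T) * J\<^sup>T = V * mat_diag r l * V\<^sup>T" using gram YY by simp
    fix d :: "nat \<Rightarrow> real" assume d: "\<And>i. i < r \<Longrightarrow> 0 < d i"
    let ?D = "\<lambda>i. l i * d i"
    have ld: "0 < l i * d i" if "i < r" for i using l d that by simp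
    have 1: "mat_trace (mp_inverse (B * B\<^sup>T) * (H * mat_diag r ?D * H\<^sup>T)) = mat_trace (Ji\<^sup>T * (Z * Z\<^sup>T) * J\<^sup>T * (V * mat_diag r d * V\<^sup>T))"
      unfolding prod fact[symmetric] swap[symmetric] by (rule mat_trace_commute) (use dims Vc in auto)
    have 2: "pos_eigenvalues (mp_inverse (B * B\<^sup>T) * (H * mat_diag r ?D * H\<^sup>T)) = pos_eigenvalues ((Ji\<^sup>T * Ji) * (V * mat_diag r ?D * V\<^sup>T))"
      unfolding prod swap[symmetric] by (rule pos_eigenvalues_mult_commute[of _ p r]) (use U Ji Vc in auto)
    show "mat_trace (mp_inverse (B * B\<^sup>T) * (H * mat_diag r ?D * H\<^sup>T)) = mat_trace (Ji\<^sup>T * (Z * Z\<^sup>T) * J\<^sup>T * (V * mat_diag r d * V\<^sup>T)) \<and>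
       prod_mset (pos_eigenvalues (mp_inverse (B * B\<^sup>T) * (H * mat_diag r ?D * H\<^sup>T)))
         = (\<Prod>i<r. d i) * Determinant.det (Z * Z\<^sup>T)"
    proof -
      have "prod_mset (pos_eigenvalues ((W * mat_diag r w * W\<^sup>T) * (V * mat_diag r ?D * V\<^sup>T))) = (\<Prod>i<r. w i) * (\<Prod>i<r. ?D i)"
        by (rule prod_pos_eigenvalues_pd_mult[OF W w V]) (use ld in auto)
      then show ?thesis using 1 unfolding 2 unfolding Ww
        by (simp add: prod.distrib detZ[symmetric])
    qed
  qed
qed

section \<open>Stein identity for Gaussian vectors\<close>

definition gauss :: "real measure" where
  "gauss = density lborel (\<lambda>x. ennreal (std_normal_density x))"

lemma sets_gauss [simp, measurable_cong]: "sets gauss = sets borel"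
  by (simp add: gauss_def)

lemma space_gauss [simp]: "space gauss = UNIV"
  by (simp add: gauss_def)

lemma prob_space_gauss: "prob_space gauss"
  unfolding gauss_def by (rule prob_space_normal_density) simp

interpretation gauss: prob_space gauss
  by (rule prob_space_gauss)

interpretation gauss_prod: product_sigma_finite "\<lambda>_. gauss"
  by (rule product_sigma_finite.intro) (rule gauss.sigma_finite_measure)

abbreviation gauss_vector :: "'i set \<Rightarrow> ('i \<Rightarrow> real) measure" where
  "gauss_vector I \<equiv> PiM I (\<lambda>_. gauss)"

lemma prob_space_gauss_vector: "prob_space (gauss_vector I)"
  by (rule prob_space_PiM) (rule prob_space_gauss)

lemma integrable_gauss_iff:
  fixes f :: "real \<Rightarrow> real"
  assumes "f \<in> borel_measurable borel"
  shows "integrable gauss f \<longleftrightarrow> integrable lborel (\<lambda>x. std_normal_density x * f x)"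
  unfolding gauss_def using assms by (subst integrable_density) auto

lemma integral_gauss:
  fixes f :: "real \<Rightarrow> real"
  assumes "f \<in> borel_measurable borel"
  shows "(\<integral>x. f x \<partial>gauss) = (\<integral>x. std_normal_density x * f x \<partial>lborel)"
  unfolding gauss_def using assms by (subst integral_density) auto

lemma one_plus_abs_power_le: "(1 + \<bar>x::real\<bar>) ^ k \<le> 2 ^ k * (1 + \<bar>x\<bar> ^ k)"
proof (cases "\<bar>x\<bar> \<le> 1")
  case True
  then have "(1 + \<bar>x\<bar>) ^ k \<le> 2 ^ k" by (intro power_mono) auto
  also have "\<dots> \<le> 2 ^ k * (1 + \<bar>x\<bar> ^ k)" by simp
  finally show ?thesis .
next
  case False
  then have "(1 + \<bar>x\<bar>) ^ k \<le> (2 * \<bar>x\<bar>) ^ k" by (intro power_mono) auto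
  also have "\<dots> \<le> 2 ^ k * (1 + \<bar>x\<bar> ^ k)" by (simp add: power_mult_distrib)
  finally show ?thesis .
qed

lemma integrable_gauss_power: "integrable gauss (\<lambda>x. (1 + \<bar>x\<bar>) ^ k)"
proof -
  have "integrable lborel (\<lambda>x. 2 ^ k * (std_normal_density x * \<bar>x\<bar> ^ 0 + std_normal_density x * \<bar>x\<bar> ^ k))"
    by (intro Bochner_Integration.integrable_mult_right Bochner_Integration.integrable_add integrable_std_normal_moment_abs)
  then have "integrable lborel (\<lambda>x. std_normal_density x * (1 + \<bar>x\<bar>) ^ k)"
  proof (rule Bochner_Integration.integrable_bound)
    show "AE x in lborel. norm (std_normal_density x * (1 + \<bar>x\<bar>) ^ k)
        \<le> norm (2 ^ k * (std_normal_density x * \<bar>x\<bar> ^ 0 + std_normal_density x * \<bar>x\<bar> ^ k))"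
    proof (rule AE_I2)
      fix x :: real
      have "std_normal_density x * (1 + \<bar>x\<bar>) ^ k \<le> std_normal_density x * (2 ^ k * (1 + \<bar>x\<bar> ^ k))"
        by (intro mult_left_mono one_plus_abs_power_le) auto
      then show "norm (std_normal_density x * (1 + \<bar>x\<bar>) ^ k)
        \<le> norm (2 ^ k * (std_normal_density x * \<bar>x\<bar> ^ 0 + std_normal_density x * \<bar>x\<bar> ^ k))"
        by (simp add: abs_mult algebra_simps)
    qed
  qed auto
  then show ?thesis by (subst integrable_gauss_iff) auto
qed

lemma std_normal_density_power_tendsto_0:
  "((\<lambda>x. (1 + x) ^ k * std_normal_density x) \<longlongrightarrow> 0) at_top"
proof -
  have 1: "((\<lambda>x. (1 + x) ^ k / exp (1 + x)) \<longlongrightarrow> (0::real)) at_top"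
  proof -
    have "filterlim (\<lambda>x::real. 1 + x) at_top at_top"
      by (rule filterlim_tendsto_add_at_top[OF tendsto_const filterlim_ident])
    from filterlim_compose[OF tendsto_power_div_exp_0[of k] this] show ?thesis by simp
  qed
  have "((\<lambda>x::real. exp 2 * ((1 + x) ^ k / exp (1 + x))) \<longlongrightarrow> exp 2 * (0::real)) at_top"
    by (rule tendsto_mult_left[OF 1])
  then have lim: "((\<lambda>x. exp 2 * ((1 + x) ^ k / exp (1 + x))) \<longlongrightarrow> (0::real)) at_top" by simp
  show ?thesis
  proof (rule tendsto_sandwich[OF _ _ tendsto_const lim])
    show "\<forall>\<^sub>F x in at_top. 0 \<le> (1 + x) ^ k * std_normal_density x"
      using eventually_ge_at_top[of 0] by eventually_elim simp
    show "\<forall>\<^sub>F x in at_top. (1 + x) ^ k * std_normal_density x \<le> exp 2 * ((1 + x) ^ k / exp (1 + x))"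
      using eventually_ge_at_top[of 0]
    proof eventually_elim
      case (elim x)
      have "1 \<le> sqrt (2 * pi)" using pi_gt3 by simp
      then have "std_normal_density x \<le> 1 * exp (- x\<^sup>2 / 2)"
        unfolding std_normal_density_def by (intro mult_right_mono) (auto simp: divide_le_eq)
      \<comment> \<open>A tangent bound at 1 compares the density with exp (- (1 + x)). The factor
        exp 2 absorbs the slack, and the shift matches the base 1 + x of the power.\<close>
      also have "- x\<^sup>2 / 2 \<le> 2 - (1 + x)" using zero_le_power2[of "x - 1"]
        by (simp add: power2_diff)
      then have "1 * exp (- x\<^sup>2 / 2) \<le> exp 2 / exp (1 + x)" by (simp add: exp_diff[symmetric])
      finally have "(1 + x) ^ k * std_normal_density x \<le> (1 + x) ^ k * (exp 2 / exp (1 + x))"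
        using elim by (intro mult_left_mono) auto
      then show ?case by (simp add: mult_ac)
    qed
  qed
qed

text \<open>Integration by parts: \<open>F\<close>, the density times g, has derivative
  \<open>F'\<close>, the density times g' - x g. Its integral over [-n, n] is a difference of
  boundary values, which vanish in the limit because the density beats polynomial growth; dominated
  convergence passes to the whole line.\<close>

lemma stein_identity_real:
  fixes g g' :: "real \<Rightarrow> real"
  assumes deriv: "\<And>x. (g has_real_derivative g' x) (at x)"
    and meas: "g' \<in> borel_measurable borel"
    and bound: "\<And>x. \<bar>g x\<bar> \<le> c * (1 + \<bar>x\<bar>) ^ k" "\<And>x. \<bar>g' x\<bar> \<le> c * (1 + \<bar>x\<bar>) ^ k"
  shows "(\<integral>x. x * g x \<partial>gauss) = (\<integral>x. g' x \<partial>gauss)"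
proof -
  have g_meas: "g \<in> borel_measurable borel"
    using deriv by (intro borel_measurable_continuous_onI continuous_at_imp_continuous_on)
      (auto intro: DERIV_isCont)
  have c: "0 \<le> c" using bound(1)[of 0] abs_ge_zero[of "g 0"] by simp
  have int1: "integrable gauss (\<lambda>x. x * g x)"
  proof (rule Bochner_Integration.integrable_bound[OF integrable_mult_right[OF integrable_gauss_power[of "Suc k"], of c]])
    show "AE x in gauss. norm (x * g x) \<le> norm (c * (1 + \<bar>x\<bar>) ^ Suc k)"
    proof (rule AE_I2)
      fix x :: real
      have "\<bar>x\<bar> * \<bar>g x\<bar> \<le> (1 + \<bar>x\<bar>) * (c * (1 + \<bar>x\<bar>) ^ k)"
        using bound(1)[of x] by (intro mult_mono) auto
      then show "norm (x * g x) \<le> norm (c * (1 + \<bar>x\<bar>) ^ Suc k)" using c by (simp add: abs_mult mult_ac)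
    qed
  qed (use g_meas in auto)
  have int2: "integrable gauss g'"
    by (rule Bochner_Integration.integrable_bound[OF integrable_mult_right[OF integrable_gauss_power[of k], of c]])
      (use meas bound(2) c in \<open>auto simp: abs_mult\<close>)
  define F where "F x = std_normal_density x * g x" for x
  define F' where "F' x = std_normal_density x * (g' x - x * g x)" for x
  have dF: "(F has_real_derivative F' x) (at x)" for x
  proof -
    have "(std_normal_density has_real_derivative (- x * std_normal_density x)) (at x)"
    proof -
      have "((\<lambda>x. a * exp (- x\<^sup>2 / 2)) has_real_derivative (- x * (a * exp (- x\<^sup>2 / 2)))) (at x)" for a
        by (auto intro!: derivative_eq_intros simp: power2_eq_square)
      then show ?thesis unfolding std_normal_density_def .
    qed
    then show ?thesis unfolding F_def F'_def
      by (auto intro!: derivative_eq_intros deriv simp: algebra_simps)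
  qed
  have intF': "integrable lborel F'"
    unfolding F'_def using Bochner_Integration.integrable_diff[OF int2 int1] meas g_meas
    by (subst (asm) integrable_gauss_iff) auto
  have ftc: "(\<integral>x. indicator {- real n..real n} x * F' x \<partial>lborel) = F (real n) - F (- real n)" for n
  proof -
    have "set_integrable lborel {- real n..real n} F'"
      using integrable_mult_indicator[OF _ intF', of "{- real n..real n}"] by (simp add: set_integrable_def)
    then have "(LINT x : {- real n..real n} | lborel. F' x) = integral {- real n..real n} F'"
      by (rule set_borel_integral_eq_integral)
    also have "(F' has_integral (F (real n) - F (- real n))) {- real n..real n}"
      by (rule fundamental_theorem_of_calculus)
        (auto simp: has_real_derivative_iff_has_vector_derivative[symmetric] intro: DERIV_subset[OF dF])
    then have "integral {- real n..real n} F' = F (real n) - F (- real n)" by (rule integral_unique)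
    finally show ?thesis by (simp add: set_lebesgue_integral_def)
  qed
  have lim1: "(\<lambda>n. \<integral>x. indicator {- real n..real n} x * F' x \<partial>lborel) \<longlonglongrightarrow> (\<integral>x. F' x \<partial>lborel)"
  proof (rule integral_dominated_convergence[where w = "\<lambda>x. \<bar>F' x\<bar>"])
    show "AE x in lborel. (\<lambda>n. indicator {- real n..real n} x * F' x) \<longlonglongrightarrow> F' x"
    proof (rule AE_I2)
      fix x :: real
      obtain N :: nat where N: "\<bar>x\<bar> \<le> real N" using real_arch_simple by blast
      have "\<forall>\<^sub>F n in sequentially. indicator {- real n..real n} x * F' x = F' x"
        using eventually_ge_at_top[of N] by eventually_elim (use N in \<open>auto simp: indicator_def\<close>)
      then show "(\<lambda>n. indicator {- real n..real n} x * F' x) \<longlonglongrightarrow> F' x"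
        by (rule tendsto_eventually)
    qed
  qed (use intF' in \<open>auto simp: indicator_def\<close>)
  have Fbound: "\<bar>F y\<bar> \<le> c * ((1 + \<bar>y\<bar>) ^ k * std_normal_density \<bar>y\<bar>)" for y
  proof -
    have "\<bar>F y\<bar> = std_normal_density y * \<bar>g y\<bar>" by (simp add: F_def abs_mult)
    also have "\<dots> \<le> std_normal_density y * (c * (1 + \<bar>y\<bar>) ^ k)" by (intro mult_left_mono bound) auto
    finally show ?thesis by (simp add: std_normal_density_def mult_ac)
  qed
  have Flim: "(\<lambda>n. c * ((1 + real n) ^ k * std_normal_density (real n))) \<longlonglongrightarrow> 0"
    using tendsto_mult_right_zero[OF filterlim_compose[OF std_normal_density_power_tendsto_0[of k] filterlim_real_sequentially], of c] .
  have "(\<lambda>n. F (real n)) \<longlonglongrightarrow> 0" "(\<lambda>n. F (- real n)) \<longlonglongrightarrow> 0"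
    by (rule Lim_null_comparison[OF _ Flim], use Fbound[of "real _"] Fbound[of "- real _"] in auto)+
  then have "(\<lambda>n. F (real n) - F (- real n)) \<longlonglongrightarrow> 0 - 0" by (intro tendsto_diff)
  then have "(\<integral>x. F' x \<partial>lborel) = 0" using lim1 unfolding ftc by (simp add: LIMSEQ_unique)
  moreover have "(\<integral>x. F' x \<partial>lborel) = (\<integral>x. g' x - x * g x \<partial>gauss)"
    unfolding F'_def using meas g_meas by (subst integral_gauss) auto
  ultimately show ?thesis using int1 int2 by simp
qed

text \<open>Polynomial growth, measured by a product over the coordinates instead of a norm. The
  product factors, so integrability reduces to one-dimensional Gaussian moments, and freezing all
  coordinates but one leaves a constant times a power of 1 + |y|.\<close>

definition tame :: "'i set \<Rightarrow> (('i \<Rightarrow> real) \<Rightarrow> real) \<Rightarrow> bool" where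
  "tame I g \<longleftrightarrow> g \<in> borel_measurable (gauss_vector I) \<and>
     (\<exists>c k. 0 \<le> c \<and> (\<forall>x\<in>space (gauss_vector I). \<bar>g x\<bar> \<le> c * (\<Prod>i\<in>I. 1 + \<bar>x i\<bar>) ^ k))"

lemma tame_weight_ge_1: "1 \<le> (\<Prod>i\<in>I. 1 + \<bar>x i :: real\<bar>)"
  by (rule prod_ge_1) auto

lemma tame_measurable: "tame I g \<Longrightarrow> g \<in> borel_measurable (gauss_vector I)"
  by (simp add: tame_def)

lemma tameI:
  assumes "g \<in> borel_measurable (gauss_vector I)" "0 \<le> c"
    "\<And>x. x \<in> space (gauss_vector I) \<Longrightarrow> \<bar>g x\<bar> \<le> c * (\<Prod>i\<in>I. 1 + \<bar>x i\<bar>) ^ k"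
  shows "tame I g"
  using assms unfolding tame_def by blast

lemma tame_const: "tame I (\<lambda>_. a)"
  by (rule tameI[where c = "\<bar>a\<bar>" and k = 0]) auto

lemma tame_component:
  assumes "finite I" "i \<in> I"
  shows "tame I (\<lambda>x. x i)"
proof (rule tameI[where c = 1 and k = 1])
  fix x :: "'a \<Rightarrow> real"
  have "1 + \<bar>x i\<bar> \<le> (\<Prod>j\<in>I. 1 + \<bar>x j\<bar>)"
  proof -
    have "(\<Prod>j\<in>I. 1 + \<bar>x j\<bar>) = (1 + \<bar>x i\<bar>) * (\<Prod>j\<in>I - {i}. 1 + \<bar>x j\<bar>)"
      using assms by (rule prod.remove)
    moreover have "(1 + \<bar>x i\<bar>) * 1 \<le> (1 + \<bar>x i\<bar>) * (\<Prod>j\<in>I - {i}. 1 + \<bar>x j\<bar>)"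
      by (intro mult_left_mono tame_weight_ge_1) auto
    ultimately show ?thesis by simp
  qed
  then show "\<bar>x i\<bar> \<le> 1 * (\<Prod>j\<in>I. 1 + \<bar>x j\<bar>) ^ 1" by simp
qed (use assms in \<open>auto intro: measurable_component_singleton\<close>)

lemma tame_dominated:
  assumes "tame I g" "f \<in> borel_measurable (gauss_vector I)"
    "\<And>x. x \<in> space (gauss_vector I) \<Longrightarrow> \<bar>f x\<bar> \<le> \<bar>g x\<bar>"
  shows "tame I f"
  using assms unfolding tame_def by (meson order_trans)

lemma tame_add:
  assumes "tame I f" "tame I g"
  shows "tame I (\<lambda>x. f x + g x)"
proof -
  obtain c k d l where *: "0 \<le> c" "\<And>x. x \<in> space (gauss_vector I) \<Longrightarrow> \<bar>f x\<bar> \<le> c * (\<Prod>i\<in>I. 1 + \<bar>x i\<bar>) ^ k"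
    "0 \<le> d" "\<And>x. x \<in> space (gauss_vector I) \<Longrightarrow> \<bar>g x\<bar> \<le> d * (\<Prod>i\<in>I. 1 + \<bar>x i\<bar>) ^ l"
    using assms unfolding tame_def by blast
  show ?thesis
  proof (rule tameI[where c = "c + d" and k = "k + l"])
    fix x :: "'a \<Rightarrow> real" assume x: "x \<in> space (gauss_vector I)"
    let ?w = "\<Prod>i\<in>I. 1 + \<bar>x i\<bar>"
    have w: "1 \<le> ?w" by (rule tame_weight_ge_1)
    have "\<bar>f x + g x\<bar> \<le> c * ?w ^ k + d * ?w ^ l" using *(2)[OF x] *(4)[OF x] by linarith
    also have "\<dots> \<le> c * ?w ^ (k + l) + d * ?w ^ (k + l)"
      using * w by (intro add_mono mult_left_mono power_increasing) auto
    finally show "\<bar>f x + g x\<bar> \<le> (c + d) * ?w ^ (k + l)" by (simp add: algebra_simps)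
  qed (use * assms in \<open>auto simp: tame_def\<close>)
qed

lemma tame_mult:
  assumes "tame I f" "tame I g"
  shows "tame I (\<lambda>x. f x * g x)"
proof -
  obtain c k d l where *: "0 \<le> c" "\<And>x. x \<in> space (gauss_vector I) \<Longrightarrow> \<bar>f x\<bar> \<le> c * (\<Prod>i\<in>I. 1 + \<bar>x i\<bar>) ^ k"
    "0 \<le> d" "\<And>x. x \<in> space (gauss_vector I) \<Longrightarrow> \<bar>g x\<bar> \<le> d * (\<Prod>i\<in>I. 1 + \<bar>x i\<bar>) ^ l"
    using assms unfolding tame_def by blast
  show ?thesis
  proof (rule tameI[where c = "c * d" and k = "k + l"])
    fix x :: "'a \<Rightarrow> real" assume x: "x \<in> space (gauss_vector I)"
    let ?w = "\<Prod>i\<in>I. 1 + \<bar>x i\<bar>"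
    have w: "1 \<le> ?w" by (rule tame_weight_ge_1)
    have "\<bar>f x\<bar> * \<bar>g x\<bar> \<le> (c * ?w ^ k) * (d * ?w ^ l)"
      using *(1) w by (intro mult_mono *(2)[OF x] *(4)[OF x]) auto
    then show "\<bar>f x * g x\<bar> \<le> (c * d) * ?w ^ (k + l)" by (simp add: abs_mult power_add mult_ac)
  qed (use * assms in \<open>auto simp: tame_def\<close>)
qed

lemma tame_minus: "tame I f \<Longrightarrow> tame I (\<lambda>x. - f x)"
  using tame_mult[OF tame_const[of I "-1"]] by simp

lemma tame_sum: "(\<And>j. j \<in> J \<Longrightarrow> tame I (f j)) \<Longrightarrow> tame I (\<lambda>x. \<Sum>j\<in>J. f j x)"
  by (induction J rule: infinite_finite_induct) (auto intro: tame_const tame_add)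

lemma tame_integrable:
  assumes I: "finite I" and g: "tame I g"
  shows "integrable (gauss_vector I) g"
proof -
  obtain c k where *: "0 \<le> c" "\<And>x. x \<in> space (gauss_vector I) \<Longrightarrow> \<bar>g x\<bar> \<le> c * (\<Prod>i\<in>I. 1 + \<bar>x i\<bar>) ^ k"
    using g unfolding tame_def by blast
  have "integrable (gauss_vector I) (\<lambda>x. c * (\<Prod>i\<in>I. (1 + \<bar>x i\<bar>) ^ k))"
    by (intro integrable_mult_right gauss_prod.product_integrable_prod[OF I] integrable_gauss_power)
  then show ?thesis
    by (rule Bochner_Integration.integrable_bound)
      (use * g in \<open>auto simp: tame_def prod_power_distrib abs_mult abs_prod intro!: AE_I2\<close>)
qed

lemma stein_identity:
  assumes I: "finite I" and i: "i \<in> I"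
    and deriv: "\<And>x t. x \<in> space (gauss_vector I) \<Longrightarrow> ((\<lambda>s. g (x(i := s))) has_real_derivative g' (x(i := t))) (at t)"
    and tame: "tame I g" "tame I g'"
  shows "(\<integral>x. x i * g x \<partial>gauss_vector I) = (\<integral>x. g' x \<partial>gauss_vector I)"
proof -
  define J where "J = I - {i}"
  have J: "finite J" "i \<notin> J" and IJ: "I = insert i J" using I i by (auto simp: J_def)
  obtain c k where ck: "0 \<le> c" "\<And>x. x \<in> space (gauss_vector I) \<Longrightarrow> \<bar>g x\<bar> \<le> c * (\<Prod>i\<in>I. 1 + \<bar>x i\<bar>) ^ k"
    using tame(1) unfolding tame_def by blast
  obtain d l where dl: "0 \<le> d" "\<And>x. x \<in> space (gauss_vector I) \<Longrightarrow> \<bar>g' x\<bar> \<le> d * (\<Prod>i\<in>I. 1 + \<bar>x i\<bar>) ^ l"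
    using tame(2) unfolding tame_def by blast
  have "integrable (gauss_vector I) (\<lambda>x. x i * g x)"
    by (intro tame_integrable[OF I] tame_mult tame_component I i tame)
  then have "(\<integral>x. x i * g x \<partial>gauss_vector I) = (\<integral>x. \<integral>y. (x(i := y)) i * g (x(i := y)) \<partial>gauss \<partial>gauss_vector J)"
    unfolding IJ by (rule gauss_prod.product_integral_insert[OF J])
  also have "\<dots> = (\<integral>x. \<integral>y. g' (x(i := y)) \<partial>gauss \<partial>gauss_vector J)"
  proof (rule Bochner_Integration.integral_cong[OF refl])
    fix x assume x: "x \<in> space (gauss_vector J)"
    then have upd: "(\<lambda>y. x(i := y)) \<in> measurable gauss (gauss_vector I)"
      unfolding IJ using J(2) by (rule measurable_component_update)
    then have xi: "x(i := y) \<in> space (gauss_vector I)" for y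
      by (rule measurable_space) simp
    let ?W = "\<Prod>j\<in>J. 1 + \<bar>x j\<bar>"
    have W: "1 \<le> ?W" by (rule tame_weight_ge_1)
    have prod: "(\<Prod>j\<in>I. 1 + \<bar>(x(i := y)) j\<bar>) = (1 + \<bar>y\<bar>) * ?W" for y
    proof -
      have "(\<Prod>j\<in>J. 1 + \<bar>(x(i := y)) j\<bar>) = ?W" using J by (intro prod.cong) auto
      then show ?thesis unfolding IJ using J by (subst prod.insert) auto
    qed
    have "(\<integral>y. y * g (x(i := y)) \<partial>gauss) = (\<integral>y. g' (x(i := y)) \<partial>gauss)"
    \<comment> \<open>The one-dimensional identity asks for a common bound on the function and its
      derivative; the exponent \<open>k + l\<close> and the sum of the two constants serve
      both.\<close>
    proof (rule stein_identity_real[where k = "k + l" and c = "c * ?W ^ k + d * ?W ^ l"])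
      show "((\<lambda>s. g (x(i := s))) has_real_derivative g' (x(i := t))) (at t)" for t
        using deriv[OF xi[of 0], of t] by simp
      show "(\<lambda>y. g' (x(i := y))) \<in> borel_measurable borel"
        using measurable_compose[OF upd tame_measurable[OF tame(2)]]
        by (simp cong: measurable_cong_sets)
      fix y :: real
      have 1: "(1 + \<bar>y\<bar>) ^ k \<le> (1 + \<bar>y\<bar>) ^ (k + l)" "(1 + \<bar>y\<bar>) ^ l \<le> (1 + \<bar>y\<bar>) ^ (k + l)"
        by (simp_all add: power_increasing)
      have "\<bar>g (x(i := y))\<bar> \<le> (c * ?W ^ k) * (1 + \<bar>y\<bar>) ^ k"
        using ck(2)[OF xi[of y]] unfolding prod by (simp add: power_mult_distrib mult_ac)
      also have "\<dots> \<le> (c * ?W ^ k) * (1 + \<bar>y\<bar>) ^ (k + l)"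
        using ck(1) W 1 by (intro mult_left_mono) auto
      also have "\<dots> \<le> (c * ?W ^ k + d * ?W ^ l) * (1 + \<bar>y\<bar>) ^ (k + l)"
        using dl(1) W by (intro mult_right_mono) auto
      finally show "\<bar>g (x(i := y))\<bar> \<le> (c * ?W ^ k + d * ?W ^ l) * (1 + \<bar>y\<bar>) ^ (k + l)" .
      have "\<bar>g' (x(i := y))\<bar> \<le> (d * ?W ^ l) * (1 + \<bar>y\<bar>) ^ l"
        using dl(2)[OF xi[of y]] unfolding prod by (simp add: power_mult_distrib mult_ac)
      also have "\<dots> \<le> (d * ?W ^ l) * (1 + \<bar>y\<bar>) ^ (k + l)"
        using dl(1) W 1 by (intro mult_left_mono) auto
      also have "\<dots> \<le> (c * ?W ^ k + d * ?W ^ l) * (1 + \<bar>y\<bar>) ^ (k + l)"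
        using ck(1) W by (intro mult_right_mono) auto
      finally show "\<bar>g' (x(i := y))\<bar> \<le> (c * ?W ^ k + d * ?W ^ l) * (1 + \<bar>y\<bar>) ^ (k + l)" .
    qed
    then show "(\<integral>y. (x(i := y)) i * g (x(i := y)) \<partial>gauss) = (\<integral>y. g' (x(i := y)) \<partial>gauss)" by simp
  qed
  also have "\<dots> = (\<integral>x. g' x \<partial>gauss_vector I)"
    using gauss_prod.product_integral_insert[OF J, of g'] tame_integrable[OF I tame(2)] unfolding IJ by simp
  finally show ?thesis .
qed

section \<open>Law of the entries of the Gaussian matrix\<close>

lemma density_prod_gauss:
  assumes I: "finite I"
  shows "density (PiM I (\<lambda>_. lborel)) (\<lambda>y. \<Prod>i\<in>I. ennreal (std_normal_density (y i))) = gauss_vector I"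
proof (rule gauss_prod.PiM_eqI[OF I])
  interpret L: product_sigma_finite "\<lambda>_::'a. lborel :: real measure"
    by (rule product_sigma_finite.intro) (rule lborel.sigma_finite_measure_axioms)
  show "sets (density (PiM I (\<lambda>_. lborel)) (\<lambda>y. \<Prod>i\<in>I. ennreal (std_normal_density (y i)))) = sets (gauss_vector I)"
    by (simp, rule sets_PiM_cong) auto
  fix A assume A: "\<And>i. i \<in> I \<Longrightarrow> A i \<in> sets gauss"
  then have A': "\<And>i. i \<in> I \<Longrightarrow> A i \<in> sets borel" by simp
  have PA: "Pi\<^sub>E I A \<in> sets (PiM I (\<lambda>_. lborel))"
    using A' by (intro sets_PiM_I_finite I) auto
  have "emeasure (density (PiM I (\<lambda>_. lborel)) (\<lambda>y. \<Prod>i\<in>I. ennreal (std_normal_density (y i)))) (Pi\<^sub>E I A)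
      = (\<integral>\<^sup>+y. (\<Prod>i\<in>I. ennreal (std_normal_density (y i))) * indicator (Pi\<^sub>E I A) y \<partial>PiM I (\<lambda>_. lborel))"
    by (rule emeasure_density[OF _ PA]) measurable
  also have "\<dots> = (\<integral>\<^sup>+y. (\<Prod>i\<in>I. ennreal (std_normal_density (y i)) * indicator (A i) (y i)) \<partial>PiM I (\<lambda>_. lborel))"
  proof (rule nn_integral_cong)
    fix y assume y: "y \<in> space (PiM I (\<lambda>_. lborel :: real measure))"
    have "indicator (Pi\<^sub>E I A) y = (\<Prod>i\<in>I. indicator (A i) (y i) :: ennreal)"
    proof (cases "y \<in> Pi\<^sub>E I A")
      case True
      then have "(\<Prod>i\<in>I. indicator (A i) (y i) :: ennreal) = (\<Prod>i\<in>I. 1)"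
        by (intro prod.cong) (auto simp: PiE_iff)
      then show ?thesis using True by simp
    next
      case False
      then obtain i where "i \<in> I" "y i \<notin> A i" using y by (auto simp: space_PiM PiE_iff)
      then have "(\<Prod>i\<in>I. indicator (A i) (y i) :: ennreal) = 0" using I by (intro prod_zero bexI[of _ i]) auto
      then show ?thesis using False by simp
    qed
    then show "(\<Prod>i\<in>I. ennreal (std_normal_density (y i))) * indicator (Pi\<^sub>E I A) y
      = (\<Prod>i\<in>I. ennreal (std_normal_density (y i)) * indicator (A i) (y i))"
      by (simp add: prod.distrib)
  qed
  also have "\<dots> = (\<Prod>i\<in>I. \<integral>\<^sup>+y. ennreal (std_normal_density y) * indicator (A i) y \<partial>lborel)"
    using A' by (intro L.product_nn_integral_prod I) auto
  also have "\<dots> = (\<Prod>i\<in>I. emeasure gauss (A i))"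
    using A' unfolding gauss_def by (intro prod.cong refl emeasure_density[symmetric]) auto
  finally show "emeasure (density (PiM I (\<lambda>_. lborel)) (\<lambda>y. \<Prod>i\<in>I. ennreal (std_normal_density (y i)))) (Pi\<^sub>E I A)
     = (\<Prod>i\<in>I. emeasure gauss (A i))" .
qed

text \<open>The reindexing \<open>s\<close> is later the identity or the exchange of the two
  indices, so Z and its transpose are treated together. The law is identified on boxes, where
  independence of the columns and the product law within a column factor the probability.\<close>

lemma iid_std_normal_columns_entries:
  fixes Z :: "'w \<Rightarrow> real mat" and s :: "'i \<Rightarrow> nat \<times> nat"
  assumes M: "prob_space M" and Z: "iid_std_normal_columns M r n Z" and n: "1 \<le> n"
    and s: "bij_betw s I ({..<r} \<times> {..<n})" and I: "finite I"
  shows "(\<lambda>\<omega>. \<lambda>i\<in>I. Z \<omega> $$ s i) \<in> measurable M (gauss_vector I)" (is "?F \<in> _")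
    and "distr M (gauss_vector I) (\<lambda>\<omega>. \<lambda>i\<in>I. Z \<omega> $$ s i) = gauss_vector I"
proof -
  interpret prob_space M by fact
  note Z' = Z[unfolded iid_std_normal_columns_def std_normal_vector_def]
  have sI: "fst (s i) < r" "snd (s i) < n" if "i \<in> I" for i
    using bij_betwE[OF s] that by (auto simp: mem_Times_iff)
  have col: "mat_column r Z j \<in> measurable M (PiM {..<r} (\<lambda>_. lborel))" if "j < n" for j
    using Z' that by (auto dest: distributed_measurable)
  have entry: "(\<lambda>\<omega>. Z \<omega> $$ (i,j)) \<in> borel_measurable M" if "i < r" "j < n" for i j
  proof -
    have "(\<lambda>\<omega>. mat_column r Z j \<omega> i) \<in> measurable M lborel"
      using measurable_compose[OF col[OF that(2)] measurable_component_singleton[of i "{..<r}" "\<lambda>_. lborel"]] that by simp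
    then show ?thesis using that by (simp add: mat_column_def cong: measurable_cong_sets)
  qed
  show F: "?F \<in> measurable M (gauss_vector I)"
  proof (rule measurable_restrict)
    fix i assume "i \<in> I"
    from entry[OF sI[OF this]] show "(\<lambda>\<omega>. Z \<omega> $$ s i) \<in> measurable M gauss"
      by (simp cong: measurable_cong_sets)
  qed
  have colprob: "emeasure M (mat_column r Z j -` Pi\<^sub>E {..<r} A \<inter> space M) = (\<Prod>i<r. emeasure gauss (A i))"
    if j: "j < n" and A: "\<And>i. i < r \<Longrightarrow> A i \<in> sets borel" for j A
  proof -
    have PA: "Pi\<^sub>E {..<r} A \<in> sets (PiM {..<r} (\<lambda>_. lborel))"
      using A by (intro sets_PiM_I_finite) auto
    have "emeasure M (mat_column r Z j -` Pi\<^sub>E {..<r} A \<inter> space M)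
        = emeasure (distr M (PiM {..<r} (\<lambda>_. lborel)) (mat_column r Z j)) (Pi\<^sub>E {..<r} A)"
      by (rule emeasure_distr[OF col[OF j] PA, symmetric])
    also have "distr M (PiM {..<r} (\<lambda>_. lborel)) (mat_column r Z j) = gauss_vector {..<r}"
    proof -
      have "distributed M (PiM {..<r} (\<lambda>_. lborel)) (mat_column r Z j) (\<lambda>y. \<Prod>i<r. ennreal (std_normal_density (y i)))"
        using Z' j by blast
      from distributed_distr_eq_density[OF this] show ?thesis
        unfolding density_prod_gauss[OF finite_lessThan] .
    qed
    also have "emeasure (gauss_vector {..<r}) (Pi\<^sub>E {..<r} A) = (\<Prod>i<r. emeasure gauss (A i))"
      using A by (intro gauss_prod.emeasure_PiM) auto
    finally show ?thesis .
  qed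
  show "distr M (gauss_vector I) ?F = gauss_vector I"
  proof (rule gauss_prod.PiM_eqI[OF I])
    fix A assume A: "\<And>i. i \<in> I \<Longrightarrow> A i \<in> sets gauss"
    define t where "t = inv_into I s"
    have t: "t ij \<in> I" "s (t ij) = ij" if "fst ij < r" "snd ij < n" for ij
      using that s unfolding t_def
      by (auto simp: bij_betw_def intro!: inv_into_into f_inv_into_f simp: mem_Times_iff)
    have ts: "t (s i) = i" if "i \<in> I" for i
      using s that unfolding t_def by (simp add: bij_betw_def inv_into_f_f)
    have At: "A (t (i,j)) \<in> sets borel" if "i < r" "j < n" for i j
      using A t(1)[of "(i,j)"] that by simp
    have PA: "Pi\<^sub>E I A \<in> sets (gauss_vector I)" using A by (intro sets_PiM_I_finite I) auto
    have "emeasure (distr M (gauss_vector I) ?F) (Pi\<^sub>E I A) = emeasure M (?F -` Pi\<^sub>E I A \<inter> space M)"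
      by (rule emeasure_distr[OF F PA])
    also have "?F -` Pi\<^sub>E I A \<inter> space M = (\<Inter>j\<in>{..<n}. mat_column r Z j -` Pi\<^sub>E {..<r} (\<lambda>i. A (t (i,j))) \<inter> space M)"
      (is "_ = ?R")
    proof (rule Set.set_eqI, rule iffI)
      fix \<omega> assume "\<omega> \<in> ?F -` Pi\<^sub>E I A \<inter> space M"
      then have \<omega>: "\<omega> \<in> space M" "\<And>i. i \<in> I \<Longrightarrow> Z \<omega> $$ s i \<in> A i" by (auto simp: PiE_iff)
      have "Z \<omega> $$ (i,j) \<in> A (t (i,j))" if "i < r" "j < n" for i j
        using \<omega>(2)[OF t(1)[of "(i,j)"]] t(2)[of "(i,j)"] that by simp
      then show "\<omega> \<in> ?R" using \<omega>(1) by (auto simp: mat_column_def)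
    next
      fix \<omega> assume R: "\<omega> \<in> ?R"
      have R': "\<omega> \<in> mat_column r Z j -` Pi\<^sub>E {..<r} (\<lambda>i. A (t (i,j))) \<inter> space M" if "j < n" for j
        using R that by blast
      \<comment> \<open>At least one column is needed: membership in the sample space is read off
        column 0.\<close>
      have \<omega>: "\<omega> \<in> space M" using R'[of 0] n by simp
      have "Z \<omega> $$ (i,j) \<in> A (t (i,j))" if "i < r" "j < n" for i j
        using R'[OF that(2)] that(1) by (auto simp: mat_column_def PiE_iff)
      then have "Z \<omega> $$ s i \<in> A i" if "i \<in> I" for i
        using sI[OF that] ts[OF that] by (metis prod.collapse)
      then show "\<omega> \<in> ?F -` Pi\<^sub>E I A \<inter> space M" using \<omega> by (auto simp: PiE_iff)
    qed
    also have "emeasure M ?R = (\<Prod>j<n. emeasure M (mat_column r Z j -` Pi\<^sub>E {..<r} (\<lambda>i. A (t (i,j))) \<inter> space M))"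
    proof -
      have "prob ?R = (\<Prod>j<n. prob (mat_column r Z j -` Pi\<^sub>E {..<r} (\<lambda>i. A (t (i,j))) \<inter> space M))"
        by (rule indep_varsD_finite[where M' = "\<lambda>_. PiM {..<r} (\<lambda>_. lborel)"])
          (use Z' n At lessThan_empty_iff[of n] in \<open>auto intro!: sets_PiM_I_finite\<close>)
      then show ?thesis by (simp add: emeasure_eq_measure prod_ennreal)
    qed
    also have "\<dots> = (\<Prod>j<n. \<Prod>i<r. emeasure gauss (A (t (i,j))))"
      using At by (intro prod.cong refl colprob) auto
    also have "\<dots> = (\<Prod>i<r. \<Prod>j<n. emeasure gauss (A (t (i,j))))" by (rule prod.swap)
    also have "\<dots> = (\<Prod>ij\<in>{..<r} \<times> {..<n}. emeasure gauss (A (t ij)))"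
      by (subst prod.cartesian_product) (auto intro: prod.cong)
    also have "\<dots> = (\<Prod>i\<in>I. emeasure gauss (A (t (s i))))"
      by (rule prod.reindex_bij_betw[OF s, symmetric])
    also have "\<dots> = (\<Prod>i\<in>I. emeasure gauss (A i))" using ts by (intro prod.cong) auto
    finally show "emeasure (distr M (gauss_vector I) ?F) (Pi\<^sub>E I A) = (\<Prod>i\<in>I. emeasure gauss (A i))" .
  qed simp
qed

section \<open>Integrability of Gaussian log-determinants\<close>

text \<open>The value at \<open>0\<close> is set to \<open>\<infinity>\<close>, against the convention \<open>ln 0 = 0\<close>, so that
  finiteness of an integral also yields that the argument vanishes almost nowhere.\<close>

definition neg_ln :: "real \<Rightarrow> ennreal" where
  "neg_ln x = (if x = 0 then \<infinity> else ennreal (- ln \<bar>x\<bar>))"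

lemma neg_ln_measurable [measurable]: "neg_ln \<in> borel_measurable borel"
  unfolding neg_ln_def by measurable

lemma neg_ln_mult: "neg_ln (x * y) \<le> neg_ln x + neg_ln y"
proof (cases "x = 0 \<or> y = 0")
  case False
  then have "- ln \<bar>x * y\<bar> = - ln \<bar>x\<bar> + - ln \<bar>y\<bar>" by (simp add: abs_mult ln_mult)
  also have "ennreal \<dots> \<le> ennreal (- ln \<bar>x\<bar>) + ennreal (- ln \<bar>y\<bar>)"
  proof -
    have "ennreal (u + v) \<le> ennreal u + ennreal v" for u v :: real
    proof -
      have "ennreal (u + v) \<le> ennreal (max 0 u + max 0 v)" by (intro ennreal_leI) auto
      also have "\<dots> = ennreal (max 0 u) + ennreal (max 0 v)" by (rule ennreal_plus) auto
      also have "\<dots> = ennreal u + ennreal v" by (auto simp: max_def ennreal_neg)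
      finally show ?thesis .
    qed
    then show ?thesis .
  qed
  finally show ?thesis using False by (simp add: neg_ln_def)
qed (auto simp: neg_ln_def)

text \<open>Layer counting: if \<open>\<bar>x\<bar> \<le> exp (- N)\<close>, the indicators with
  index 0 to N all equal 1, so their sum is at least N + 1, which is at least - ln |x| for N the
  integer part of - ln |x|. At 0 all indicators are 1 and both sides are infinite.\<close>

lemma neg_ln_le_suminf: "neg_ln x \<le> (\<Sum>n. indicator {- exp (- real n)..exp (- real n)} x)"
proof -
  let ?i = "\<lambda>n. indicator {- exp (- real n)..exp (- real n)} x :: ennreal"
  have step: "of_nat N \<le> (\<Sum>n. ?i n)" if "\<bar>x\<bar> \<le> exp (- real N)" for N
  proof -
    have "?i n = 1" if "n < N" for n
    proof -
      have "\<bar>x\<bar> \<le> exp (- real n)" using \<open>\<bar>x\<bar> \<le> exp (- real N)\<close> that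
        by (meson exp_le_cancel_iff neg_le_iff_le of_nat_le_iff less_imp_le order_trans)
      then show ?thesis by (auto simp: indicator_def abs_le_iff)
    qed
    then have "of_nat N = (\<Sum>n<N. ?i n)" by simp
    also have "\<dots> \<le> (\<Sum>n. ?i n)" by (rule sum_le_suminf) auto
    finally show ?thesis .
  qed
  show ?thesis
  proof (cases "x = 0")
    case True
    then have "of_nat N \<le> (\<Sum>n. ?i n)" for N by (intro step) simp
    then have "(\<Sum>n. ?i n) = \<infinity>"
      by (metis ennreal_Ex_less_of_nat infinity_ennreal_def leD less_top)
    then show ?thesis by (simp add: neg_ln_def)
  next
    case False
    define N where "N = nat \<lfloor>- ln \<bar>x\<bar>\<rfloor>"
    show ?thesis
    proof (cases "- ln \<bar>x\<bar> \<le> 0")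
      case True
      then show ?thesis using False by (simp add: neg_ln_def ennreal_neg)
    next
      case pos: False
      have le: "- ln \<bar>x\<bar> \<le> real (Suc N)" and "real N \<le> - ln \<bar>x\<bar>" using pos unfolding N_def by linarith+
      then have "ln \<bar>x\<bar> \<le> - real N" by simp
      then have xN: "\<bar>x\<bar> \<le> exp (- real N)" using False by (metis exp_le_cancel_iff exp_ln zero_less_abs_iff)
      have "?i n = 1" if "n < Suc N" for n
      proof -
        have "\<bar>x\<bar> \<le> exp (- real n)" using xN that
          by (meson exp_le_cancel_iff neg_le_iff_le of_nat_le_iff less_Suc_eq_le order_trans)
        then show ?thesis by (auto simp: indicator_def abs_le_iff)
      qed
      then have "of_nat (Suc N) = (\<Sum>n<Suc N. ?i n)" by (simp del: sum.lessThan_Suc)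
      also have "\<dots> \<le> (\<Sum>n. ?i n)" by (rule sum_le_suminf) auto
      finally have "ennreal (real (Suc N)) \<le> (\<Sum>n. ?i n)" by (simp add: ennreal_of_nat_eq_real_of_nat)
      moreover have "neg_ln x \<le> ennreal (real (Suc N))" using le False by (simp add: neg_ln_def ennreal_leI del: of_nat_Suc)
      ultimately show ?thesis by (rule order_trans[rotated])
    qed
  qed
qed

definition neg_ln_const :: ennreal where
  "neg_ln_const = (\<integral>\<^sup>+x. neg_ln x \<partial>lborel)"

text \<open>The interval of layer n has length \<open>2 * exp (- n)\<close>, so the layers form a
  geometric series.\<close>

lemma neg_ln_const_finite: "neg_ln_const < \<infinity>"
proof -
  have "neg_ln_const \<le> (\<integral>\<^sup>+x. (\<Sum>n. indicator {- exp (- real n)..exp (- real n)} x) \<partial>lborel)"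
    unfolding neg_ln_const_def by (rule nn_integral_mono) (rule neg_ln_le_suminf)
  also have "\<dots> = (\<Sum>n. \<integral>\<^sup>+x. indicator {- exp (- real n)..exp (- real n)} x \<partial>lborel)"
    by (rule nn_integral_suminf) measurable
  also have "\<dots> = (\<Sum>n. ennreal (2 * exp (- 1) ^ n))"
    by (intro suminf_cong) (simp add: emeasure_lborel_Icc exp_of_nat_mult[symmetric])
  also have "\<dots> = ennreal (\<Sum>n. 2 * exp (- 1) ^ n)"
    by (rule suminf_ennreal2) (auto intro: summable_mult summable_geometric)
  also have "\<dots> < \<infinity>" by simp
  finally show ?thesis .
qed

text \<open>The normal density is at most 1, so the Gaussian integral is dominated by a Lebesgue
  integral, which is invariant under the shift. The bound is therefore uniform in \<open>b\<close>,
  and the slope enters only through \<open>neg_ln a\<close>; a zero slope makes the right-hand side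
  infinite.\<close>

lemma neg_ln_affine_integral: "(\<integral>\<^sup>+t. neg_ln (t * a + b) \<partial>gauss) \<le> neg_ln_const + neg_ln a"
proof (cases "a = 0")
  case True
  then show ?thesis by (simp add: neg_ln_def)
next
  case False
  have "(\<integral>\<^sup>+t. neg_ln (t * a + b) \<partial>gauss) \<le> (\<integral>\<^sup>+t. neg_ln (b / a + 1 * t) + neg_ln a \<partial>gauss)"
  proof (rule nn_integral_mono)
    fix t
    have "t * a + b = (b / a + 1 * t) * a" using False by (simp add: field_simps)
    then show "neg_ln (t * a + b) \<le> neg_ln (b / a + 1 * t) + neg_ln a" using neg_ln_mult by metis
  qed
  also have "\<dots> = (\<integral>\<^sup>+t. neg_ln (b / a + 1 * t) \<partial>gauss) + neg_ln a"
    by (subst nn_integral_add) (auto simp: gauss.emeasure_space_1[simplified])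
  also have "(\<integral>\<^sup>+t. neg_ln (b / a + 1 * t) \<partial>gauss) = (\<integral>\<^sup>+t. ennreal (std_normal_density t) * neg_ln (b / a + 1 * t) \<partial>lborel)"
    unfolding gauss_def by (subst nn_integral_density) auto
  also have "\<dots> \<le> (\<integral>\<^sup>+t. neg_ln (b / a + 1 * t) \<partial>lborel)"
  proof (rule nn_integral_mono)
    fix t :: real
    have "std_normal_density t \<le> 1 * 1"
      unfolding std_normal_density_def using pi_gt3 by (intro mult_mono) (auto simp: divide_le_eq)
    then have "ennreal (std_normal_density t) * neg_ln (b / a + 1 * t) \<le> 1 * neg_ln (b / a + 1 * t)"
      by (intro mult_right_mono) auto
    then show "ennreal (std_normal_density t) * neg_ln (b / a + 1 * t) \<le> neg_ln (b / a + 1 * t)" by simp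
  qed
  also have "\<dots> = neg_ln_const" unfolding neg_ln_const_def
    using nn_integral_real_affine[of neg_ln 1 "b / a"] by simp
  finally show ?thesis by simp
qed

section \<open>Measurability of determinants and Gaussian integrals of leading minors\<close>

definition mat_measurable :: "'a measure \<Rightarrow> nat \<Rightarrow> nat \<Rightarrow> ('a \<Rightarrow> real mat) \<Rightarrow> bool" where
  "mat_measurable M nr nc F \<longleftrightarrow> (\<forall>x\<in>space M. F x \<in> carrier_mat nr nc) \<and>
     (\<forall>i<nr. \<forall>j<nc. (\<lambda>x. F x $$ (i,j)) \<in> borel_measurable M)"

lemma measurable_det:
  assumes "mat_measurable M n n F"
  shows "(\<lambda>x. Determinant.det (F x)) \<in> borel_measurable M"
proof -
  have F: "F x \<in> carrier_mat n n" if "x \<in> space M" for x using assms that by (simp add: mat_measurable_def)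
  have "(\<lambda>x. \<Sum>p | p permutes {0..<n}. signof p * (\<Prod>i = 0..<n. F x $$ (i, p i))) \<in> borel_measurable M"
  proof (intro borel_measurable_sum borel_measurable_times borel_measurable_prod borel_measurable_const)
    fix p i assume "p \<in> {p. p permutes {0..<n}}" "i \<in> {0..<n}"
    then have "i < n" "p i < n" using permutes_in_image[of p "{0..<n}" i] by auto
    then show "(\<lambda>x. F x $$ (i, p i)) \<in> borel_measurable M" using assms by (simp add: mat_measurable_def)
  qed
  then show ?thesis
    by (rule measurable_cong[THEN iffD2, rotated]) (rule det_def'[OF F])
qed

lemma measurable_leading_det:
  assumes "{..<k} \<times> {..<k} \<subseteq> I"
  shows "(\<lambda>x. Determinant.det (Matrix.mat k k x)) \<in> borel_measurable (gauss_vector I)"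
proof (rule measurable_det[of _ k])
  have "(\<lambda>x. x (i,j)) \<in> borel_measurable (gauss_vector I)" if "i < k" "j < k" for i j
    using measurable_component_singleton[of "(i,j)" I "\<lambda>_. gauss"] that assms
    by (auto cong: measurable_cong_sets)
  then show "mat_measurable (gauss_vector I) k k (Matrix.mat k k)"
    by (simp add: mat_measurable_def)
qed

text \<open>Laplace expansion along the last column: the slope in the corner entry is the next
  smaller leading minor, and no cofactor involves that column.\<close>

lemma leading_det_affine:
  fixes x :: "nat \<times> nat \<Rightarrow> real"
  shows "\<exists>b. \<forall>t. Determinant.det (Matrix.mat (Suc k) (Suc k) (x((k,k) := t))) = t * Determinant.det (Matrix.mat k k x) + b"
proof (rule exI, rule allI)
  fix t
  let ?A = "\<lambda>t. Matrix.mat (Suc k) (Suc k) (x((k,k) := t))"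
  have cof: "cofactor (?A t) i k = cofactor (?A 0) i k" if "i < Suc k" for i
  proof -
    have "mat_delete (?A t) i k = mat_delete (?A 0) i k"
      unfolding mat_delete_def by (rule eq_matI) (use that in auto)
    then show ?thesis by (simp add: cofactor_def)
  qed
  have "mat_delete (?A 0) k k = Matrix.mat k k x"
    unfolding mat_delete_def by (rule eq_matI) auto
  then have cofk: "cofactor (?A 0) k k = Determinant.det (Matrix.mat k k x)"
    by (simp add: cofactor_def)
  have "Determinant.det (?A t) = (\<Sum>i<Suc k. ?A t $$ (i,k) * cofactor (?A t) i k)"
    by (rule laplace_expansion_column) auto
  also have "\<dots> = t * Determinant.det (Matrix.mat k k x) + (\<Sum>i<k. x (i,k) * cofactor (?A 0) i k)"
    using cof cofk by (simp add: mult.commute)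
  finally show "Determinant.det (?A t) = t * Determinant.det (Matrix.mat k k x) + (\<Sum>i<k. x (i,k) * cofactor (?A 0) i k)" .
qed

text \<open>Integrating out the corner entry of the leading block first reduces the minor of order k
  + 1 to that of order k, at the price of one \<open>neg_ln_const\<close>.\<close>

lemma nn_integral_neg_ln_leading_det:
  assumes I: "finite I" and k: "{..<k} \<times> {..<k} \<subseteq> I"
  shows "(\<integral>\<^sup>+x. neg_ln (Determinant.det (Matrix.mat k k x)) \<partial>gauss_vector I) \<le> of_nat k * neg_ln_const"
  using k
proof (induction k)
  case 0
  then show ?case by (simp add: neg_ln_def)
next
  case (Suc k)
  define J where "J = I - {(k,k)}"
  have IJ: "I = insert (k,k) J" and J: "finite J" "(k,k) \<notin> J" using Suc.prems I by (auto simp: J_def)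
  have sub: "{..<k} \<times> {..<k} \<subseteq> I" using Suc.prems by auto
  have meas: "(\<lambda>x. neg_ln (Determinant.det (Matrix.mat k k x))) \<in> borel_measurable (gauss_vector (insert (k,k) J))"
    "(\<lambda>x. neg_ln (Determinant.det (Matrix.mat (Suc k) (Suc k) x))) \<in> borel_measurable (gauss_vector (insert (k,k) J))"
    using measurable_compose[OF measurable_leading_det[OF sub] neg_ln_measurable]
      measurable_compose[OF measurable_leading_det[OF Suc.prems] neg_ln_measurable]
    unfolding IJ .
  have minor: "Matrix.mat k k (x((k,k) := t)) = Matrix.mat k k x" for x :: "nat \<times> nat \<Rightarrow> real" and t
    by (rule eq_matI) auto
  have "(\<integral>\<^sup>+x. neg_ln (Determinant.det (Matrix.mat (Suc k) (Suc k) x)) \<partial>gauss_vector I)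
      = (\<integral>\<^sup>+x. \<integral>\<^sup>+t. neg_ln (Determinant.det (Matrix.mat (Suc k) (Suc k) (x((k,k) := t)))) \<partial>gauss \<partial>gauss_vector J)"
    unfolding IJ by (rule gauss_prod.product_nn_integral_insert[OF J meas(2)])
  \<comment> \<open>The bound does not depend on \<open>t\<close>, but is kept as an integral over
    \<open>t\<close> so that the two integrals recombine to one over \<open>I\<close>, where the
    induction hypothesis is stated.\<close>
  also have "\<dots> \<le> (\<integral>\<^sup>+x. \<integral>\<^sup>+t. neg_ln_const + neg_ln (Determinant.det (Matrix.mat k k (x((k,k) := t)))) \<partial>gauss \<partial>gauss_vector J)"
  proof (rule nn_integral_mono)
    fix x :: "nat \<times> nat \<Rightarrow> real"
    obtain b where b: "\<And>t. Determinant.det (Matrix.mat (Suc k) (Suc k) (x((k,k) := t))) = t * Determinant.det (Matrix.mat k k x) + b"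
      using leading_det_affine[of k x] by (elim exE) simp
    show "(\<integral>\<^sup>+t. neg_ln (Determinant.det (Matrix.mat (Suc k) (Suc k) (x((k,k) := t)))) \<partial>gauss)
      \<le> (\<integral>\<^sup>+t. neg_ln_const + neg_ln (Determinant.det (Matrix.mat k k (x((k,k) := t)))) \<partial>gauss)"
      unfolding b minor using neg_ln_affine_integral by (simp add: gauss.emeasure_space_1[simplified])
  qed
  also have "\<dots> = (\<integral>\<^sup>+x. neg_ln_const + neg_ln (Determinant.det (Matrix.mat k k x)) \<partial>gauss_vector I)"
    unfolding IJ by (rule gauss_prod.product_nn_integral_insert[OF J, symmetric]) (intro borel_measurable_add borel_measurable_const meas)
  also have "\<dots> = neg_ln_const + (\<integral>\<^sup>+x. neg_ln (Determinant.det (Matrix.mat k k x)) \<partial>gauss_vector I)"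
    using meas(1) prob_space.emeasure_space_1[OF prob_space_gauss_vector[of I]]
    unfolding IJ by (subst nn_integral_add) auto
  also have "\<dots> \<le> neg_ln_const + of_nat k * neg_ln_const" by (intro add_left_mono Suc.IH[OF sub])
  finally show ?case by (simp add: distrib_right)
qed

lemma mat_trace_spectral:
  assumes "orthogonal_matrix n V"
  shows "mat_trace (V * mat_diag n l * V\<^sup>T) = (\<Sum>i<n. l i)"
proof -
  have V: "V \<in> carrier_mat n n" "V\<^sup>T * V = 1\<^sub>m n" using assms by (auto simp: orthogonal_matrix_def)
  have "mat_trace (V * mat_diag n l * V\<^sup>T) = mat_trace (V\<^sup>T * (V * mat_diag n l))"
    by (rule mat_trace_commute) (use V in auto)
  also have "V\<^sup>T * (V * mat_diag n l) = mat_diag n l"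
    using V by (simp add: mat_mult_cancel[OF V(2)])
  finally show ?thesis by simp
qed

text \<open>With the identity on top, Y^T Y is the identity plus the Gram matrix of the lower block
  \<open>R\<close>, so all its eigenvalues are at least 1.\<close>

lemma det_gram_ge_1:
  fixes Y :: "real mat"
  assumes Y: "Y \<in> carrier_mat m q" and qm: "q \<le> m" and top: "\<And>i j. i < q \<Longrightarrow> j < q \<Longrightarrow> Y $$ (i,j) = (if i = j then 1 else 0)"
  shows "1 \<le> Determinant.det (Y\<^sup>T * Y)"
proof -
  define R where "R = Matrix.mat m q (\<lambda>(i,j). if i < q then 0 else Y $$ (i,j))"
  have R: "R \<in> carrier_mat m q" by (simp add: R_def)
  obtain U u where U: "orthogonal_matrix q U" and eq: "R\<^sup>T * R = U * mat_diag q u * U\<^sup>T"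
    and u: "\<And>i. i < q \<Longrightarrow> 0 \<le> u i"
    using gram_spectral_decomposition[OF R] by blast
  have Uc: "U \<in> carrier_mat q q" "U * U\<^sup>T = 1\<^sub>m q" using U by (auto simp: orthogonal_matrix_def)
  have "Y\<^sup>T * Y = 1\<^sub>m q + R\<^sup>T * R"
  proof (rule eq_matI)
    fix i j assume "i < dim_row (1\<^sub>m q + R\<^sup>T * R)" "j < dim_col (1\<^sub>m q + R\<^sup>T * R)"
    then have ij: "i < q" "j < q" using R by auto
    have "(Y\<^sup>T * Y) $$ (i,j) = (\<Sum>k<m. Y $$ (k,i) * Y $$ (k,j))"
      using ij Y by (subst mat_mult_index) auto
    also have "\<dots> = (\<Sum>k<m. (if k = i then (if i = j then 1 else 0) else 0) + R $$ (k,i) * R $$ (k,j))"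
      using ij top by (intro sum.cong) (auto simp: R_def)
    also have "\<dots> = (if i = j then 1 else 0) + (\<Sum>k<m. R $$ (k,i) * R $$ (k,j))"
      using ij qm by (simp add: sum.distrib)
    also have "\<dots> = (1\<^sub>m q + R\<^sup>T * R) $$ (i,j)"
    proof -
      have "(R\<^sup>T * R) $$ (i,j) = (\<Sum>k<m. R $$ (k,i) * R $$ (k,j))"
        using ij R by (subst mat_mult_index) auto
      then show ?thesis using ij R by simp
    qed
    finally show "(Y\<^sup>T * Y) $$ (i,j) = (1\<^sub>m q + R\<^sup>T * R) $$ (i,j)" .
  qed (use Y R in auto)
  also have "\<dots> = U * mat_diag q (\<lambda>i. 1 + u i) * U\<^sup>T"
  proof -
    have "mat_diag q (\<lambda>i. 1 + u i) = 1\<^sub>m q + mat_diag q u" by (rule eq_matI) auto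
    then have "U * mat_diag q (\<lambda>i. 1 + u i) * U\<^sup>T = (U * 1\<^sub>m q + U * mat_diag q u) * U\<^sup>T"
      using Uc by (simp add: mult_add_distrib_mat[of _ q q _ q])
    also have "\<dots> = U * 1\<^sub>m q * U\<^sup>T + U * mat_diag q u * U\<^sup>T"
      using Uc by (intro add_mult_distrib_mat[of _ q q _ _ q]) auto
    finally show ?thesis using Uc eq by simp
  qed
  finally have "Determinant.det (Y\<^sup>T * Y) = (\<Prod>i<q. 1 + u i)" by (simp add: spectral_det[OF U])
  also have "1 \<le> \<dots>" using u by (intro prod_ge_1) auto
  finally show ?thesis .
qed

text \<open>Dividing by an invertible leading block \<open>W\<close> reduces to
  \<open>det_gram_ge_1\<close>; for singular \<open>W\<close> nonnegativity of the Gram determinant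
  is enough. The expansion of the Gram determinant into all squared minors is thereby
  avoided.\<close>

lemma det_gram_ge_leading:
  fixes x :: "nat \<times> nat \<Rightarrow> real"
  assumes qm: "q \<le> m"
  shows "(Determinant.det (Matrix.mat q q x))\<^sup>2 \<le> Determinant.det ((Matrix.mat m q x)\<^sup>T * Matrix.mat m q x)"
proof -
  define Z where "Z = Matrix.mat m q x"
  define W where "W = Matrix.mat q q x"
  have Z: "Z \<in> carrier_mat m q" and W: "W \<in> carrier_mat q q" by (auto simp: Z_def W_def)
  show ?thesis
  proof (cases "Determinant.det W = 0")
    case True
    obtain V l where V: "orthogonal_matrix q V" "Z\<^sup>T * Z = V * mat_diag q l * V\<^sup>T" "\<And>i. i < q \<Longrightarrow> 0 \<le> l i"
      using gram_spectral_decomposition[OF Z] by blast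
    have "0 \<le> Determinant.det (Z\<^sup>T * Z)" unfolding V(2) spectral_det[OF V(1)] using V(3) by (intro prod_nonneg) auto
    then show ?thesis using True by (simp add: Z_def[symmetric] W_def[symmetric])
  next
    case False
    then obtain Wi where Wi: "Wi \<in> carrier_mat q q" "W * Wi = 1\<^sub>m q" "Wi * W = 1\<^sub>m q"
      using det_nonzero_inverse[OF W] by blast
    have "(Z * Wi) $$ (i,j) = (W * Wi) $$ (i,j)" if "i < q" "j < q" for i j
      using that qm Wi(1) Z W by (subst (1 2) mat_mult_index) (auto simp: Z_def W_def)
    then have "1 \<le> Determinant.det ((Z * Wi)\<^sup>T * (Z * Wi))"
      using Z Wi qm by (intro det_gram_ge_1[of _ m q]) auto
    also have "(Z * Wi)\<^sup>T * (Z * Wi) = Wi\<^sup>T * (Z\<^sup>T * Z) * Wi"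
      using Z Wi by (simp add: mat_transpose_mult mat_mult_assoc)
    also have "Determinant.det \<dots> = (Determinant.det Wi)\<^sup>2 * Determinant.det (Z\<^sup>T * Z)"
    proof -
      have c: "Z\<^sup>T * Z \<in> carrier_mat q q" "Wi\<^sup>T \<in> carrier_mat q q" using Z Wi by auto
      show ?thesis using det_mult[OF mult_carrier_mat[OF c(2,1)] Wi(1)] det_mult[OF c(2,1)] det_transpose[OF Wi(1)]
        by (simp add: power2_eq_square)
    qed
    finally have "(Determinant.det W)\<^sup>2 * 1 \<le> (Determinant.det W)\<^sup>2 * ((Determinant.det Wi)\<^sup>2 * Determinant.det (Z\<^sup>T * Z))"
      by (intro mult_left_mono) auto
    also have "\<dots> = (Determinant.det W * Determinant.det Wi)\<^sup>2 * Determinant.det (Z\<^sup>T * Z)"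
      by (simp add: power_mult_distrib)
    also have "Determinant.det W * Determinant.det Wi = 1" using det_mult[OF W Wi(1)] Wi(2) by simp
    finally show ?thesis by (simp add: Z_def[symmetric] W_def[symmetric])
  qed
qed

text \<open>From above, ln x \<le> x on each eigenvalue gives the trace, which is a polynomial in
  the entries; from below, monotonicity of ln leaves only ln |d|.\<close>

lemma abs_ln_det_gram_le:
  fixes Y :: "real mat"
  assumes Y: "Y \<in> carrier_mat m q" and d: "d \<noteq> 0" "d\<^sup>2 \<le> Determinant.det (Y\<^sup>T * Y)"
  shows "\<bar>ln (Determinant.det (Y\<^sup>T * Y))\<bar> \<le> mat_trace (Y\<^sup>T * Y) + 2 * max 0 (- ln \<bar>d\<bar>)"
proof -
  obtain V l where V: "orthogonal_matrix q V" "Y\<^sup>T * Y = V * mat_diag q l * V\<^sup>T" "\<And>i. i < q \<Longrightarrow> 0 \<le> l i"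
    using gram_spectral_decomposition[OF Y] by blast
  have pos: "0 < Determinant.det (Y\<^sup>T * Y)" using d zero_less_power2[of d] by linarith
  have l: "0 < l i" if "i < q" for i
    by (rule spectral_pos_of_det[OF V(1,3) _ that]) (use pos V(2) in auto)
  then have ne: "l i \<noteq> 0" if "i < q" for i using that by (simp add: less_imp_neq[symmetric])
  have tr: "mat_trace (Y\<^sup>T * Y) = (\<Sum>i<q. l i)" unfolding V(2) by (rule mat_trace_spectral[OF V(1)])
  have "ln (Determinant.det (Y\<^sup>T * Y)) = (\<Sum>i<q. ln (l i))"
    unfolding V(2) spectral_det[OF V(1)] using l ne by (subst ln_prod) auto
  also have "\<dots> \<le> (\<Sum>i<q. l i)"
  proof (rule sum_mono)
    fix i assume "i \<in> {..<q}"
    then show "ln (l i) \<le> l i" using ln_le_minus_one[of "l i"] l[of i] by auto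
  qed
  finally have up: "ln (Determinant.det (Y\<^sup>T * Y)) \<le> mat_trace (Y\<^sup>T * Y)" using tr by simp
  have "ln (d\<^sup>2) \<le> ln (Determinant.det (Y\<^sup>T * Y))" using d pos by (subst ln_le_cancel_iff) auto
  moreover have "ln (d\<^sup>2) = 2 * ln \<bar>d\<bar>"
    using ln_realpow[of "\<bar>d\<bar>" 2] d by simp
  ultimately have "- ln (Determinant.det (Y\<^sup>T * Y)) \<le> 2 * max 0 (- ln \<bar>d\<bar>)" by (simp add: max_def)
  moreover have "0 \<le> mat_trace (Y\<^sup>T * Y)" unfolding tr using l by (intro sum_nonneg) (auto intro: less_imp_le)
  ultimately show ?thesis using up by (auto simp: abs_le_iff max_def split: if_splits)
qed

section \<open>Polynomial weights\<close>

lemma poly_eq_sum_le: "degree p \<le> N \<Longrightarrow> poly p x = (\<Sum>k\<le>N. coeff p k * x ^ k)"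
  for p :: "real poly"
  unfolding poly_altdef by (rule sum.mono_neutral_left) (auto simp: coeff_eq_0)

text \<open>In closed form \<open>v * (poly p u - poly p v) / (u - v)\<close>, with the value
  \<open>u * poly (pderiv p) u\<close> on the diagonal. The sum covers both cases and is what the
  product rule for powers of an inverse produces.\<close>

definition poly_pair :: "real poly \<Rightarrow> real \<Rightarrow> real \<Rightarrow> real" where
  "poly_pair p u v = (\<Sum>k\<le>degree p. coeff p k * (\<Sum>i<k. u ^ i * v ^ (k - i)))"

lemma poly_pair_diag_sum: "poly_pair p u u = (\<Sum>k\<le>degree p. coeff p k * (real k * u ^ k))"
  unfolding poly_pair_def
proof (intro sum.cong refl arg_cong2[where f = "(*)"])
  fix k
  have "(\<Sum>i<k. u ^ i * u ^ (k - i)) = (\<Sum>i<k. u ^ k)"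
    by (intro sum.cong) (auto simp flip: power_add)
  then show "(\<Sum>i<k. u ^ i * u ^ (k - i)) = real k * u ^ k" by simp
qed

lemma poly_pair_diag: "poly_pair p u u = u * poly (pderiv p) u"
proof (cases "degree p = 0")
  case True
  then have "pderiv p = 0" by (simp add: pderiv_eq_0_iff)
  then show ?thesis using True by (simp add: poly_pair_def)
next
  case False
  then obtain N where N: "degree p = Suc N" by (cases "degree p") auto
  have "poly_pair p u u = (\<Sum>k\<le>N. coeff p (Suc k) * (real (Suc k) * u ^ Suc k))"
    unfolding poly_pair_diag_sum N by (subst sum.atMost_Suc_shift) simp
  also have "\<dots> = u * (\<Sum>k\<le>N. coeff (pderiv p) k * u ^ k)"
    unfolding sum_distrib_left by (intro sum.cong) (auto simp: coeff_pderiv mult_ac)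
  also have "(\<Sum>k\<le>N. coeff (pderiv p) k * u ^ k) = poly (pderiv p) u"
    by (rule poly_eq_sum_le[symmetric]) (use N degree_pderiv_le[of p] in simp)
  finally show ?thesis .
qed

lemma poly_pair_diff: "(u - v) * poly_pair p u v = v * (poly p u - poly p v)"
proof -
  have pow: "(u - v) * (\<Sum>i<k. u ^ i * v ^ (k - i)) = v * (u ^ k - v ^ k)" for k
  proof -
    have "(\<Sum>i<k. u ^ i * v ^ (k - i)) = v * (\<Sum>i<k. v ^ (k - Suc i) * u ^ i)"
      unfolding sum_distrib_left
    proof (intro sum.cong refl)
      fix i assume "i \<in> {..<k}"
      then have "k - i = Suc (k - Suc i)" by auto
      then show "u ^ i * v ^ (k - i) = v * (v ^ (k - Suc i) * u ^ i)" by simp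
    qed
    then show ?thesis by (simp add: power_diff_sumr2[of u k v] mult_ac)
  qed
  have "(u - v) * poly_pair p u v = (\<Sum>k\<le>degree p. coeff p k * (v * (u ^ k - v ^ k)))"
    unfolding poly_pair_def sum_distrib_left pow[symmetric] by (intro sum.cong) (auto simp: sum_distrib_left mult_ac)
  also have "\<dots> = v * (poly p u - poly p v)"
    unfolding poly_altdef by (simp add: sum_distrib_left sum_subtractf[symmetric] algebra_simps)
  finally show ?thesis .
qed

text \<open>\<open>P\<close> stands for y powr (\<alpha> - 1) and \<open>phi\<close> for y powr
  \<alpha>. Monotonicity drives the pairwise inequality \<open>pair_sym_ge\<close>; the positive
  value at 0 gives the explicit lower bound \<open>T_ge\<close> on the normalising trace.\<close>

locale weight_poly =
  fixes P :: "real poly"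
  assumes pderiv_nonneg: "0 \<le> y \<Longrightarrow> 0 \<le> poly (pderiv P) y"
    and pos_at_0: "0 < poly P 0"
begin

definition phi :: "real poly" where "phi = pCons 0 P"

lemma P_mono: "0 \<le> u \<Longrightarrow> u \<le> v \<Longrightarrow> poly P u \<le> poly P v"
  by (rule DERIV_nonneg_imp_nondecreasing) (auto intro!: exI[of _ "poly (pderiv P) _"] poly_DERIV pderiv_nonneg)

lemma P_pos: "0 \<le> u \<Longrightarrow> 0 < poly P u"
  using P_mono[of 0 u] pos_at_0 by simp

lemma poly_phi: "poly phi y = y * poly P y"
  by (simp add: phi_def)

lemma phi_pos: "0 < y \<Longrightarrow> 0 < poly phi y"
  using P_pos[of y] by (simp add: poly_phi)

lemma phi_mono: "0 \<le> u \<Longrightarrow> u \<le> v \<Longrightarrow> poly phi u \<le> poly phi v"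
  unfolding poly_phi using P_pos[of u] by (intro mult_mono P_mono) auto

lemma pair_diag_ge: "0 < u \<Longrightarrow> poly phi u \<le> poly_pair phi u u"
proof -
  assume u: "0 < u"
  have "poly_pair phi u u = u * (poly P u + u * poly (pderiv P) u)"
    by (simp add: poly_pair_diag phi_def pderiv_pCons)
  then show ?thesis using u pderiv_nonneg[of u] by (simp add: poly_phi)
qed

lemma pair_nonneg:
  assumes "0 < u" "0 < v"
  shows "0 \<le> poly_pair phi u v"
proof (cases u v rule: linorder_cases)
  case equal
  then show ?thesis using pair_diag_ge[OF assms(1)] phi_pos[OF assms(1)] by simp
next
  case less
  have "(v - u) * poly_pair phi u v = v * (poly phi v - poly phi u)"
    using poly_pair_diff[of u v phi] by (simp add: algebra_simps)
  moreover have "0 \<le> v * (poly phi v - poly phi u)"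
    using phi_mono[of u v] assms less by (intro mult_nonneg_nonneg) auto
  ultimately have "0 \<le> (v - u) * poly_pair phi u v" by simp
  then show ?thesis using less by (simp add: zero_le_mult_iff)
next
  case greater
  have "0 \<le> (u - v) * poly_pair phi u v"
    unfolding poly_pair_diff using phi_mono[of v u] assms greater by (intro mult_nonneg_nonneg) auto
  then show ?thesis using greater by (simp add: zero_le_mult_iff)
qed

text \<open>The right-hand side is (u + v) (phi v - phi u) / (v - u). After multiplication by v - u
  it exceeds the left-hand side by 2 u v (P v - P u), which is nonnegative since \<open>P\<close>
  increases.\<close>

lemma pair_sym_ge_aux:
  assumes "0 < u" "u < v"
  shows "poly phi u + poly phi v \<le> poly_pair phi u v + poly_pair phi v u"
proof -
  have "(v - u) * (poly_pair phi u v + poly_pair phi v u) = (u + v) * (poly phi v - poly phi u)"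
    using poly_pair_diff[of u v phi] poly_pair_diff[of v u phi] by (simp add: algebra_simps)
  also have "\<dots> = (v - u) * (poly phi u + poly phi v) + 2 * u * v * (poly P v - poly P u)"
    unfolding poly_phi by (simp add: algebra_simps)
  finally have "(v - u) * (poly phi u + poly phi v) \<le> (v - u) * (poly_pair phi u v + poly_pair phi v u)"
    using P_mono[of u v] assms by simp
  then show ?thesis using assms by simp
qed

lemma pair_sym_ge:
  assumes "0 < u" "0 < v"
  shows "poly phi u + poly phi v \<le> poly_pair phi u v + poly_pair phi v u"
  using pair_sym_ge_aux[of u v] pair_sym_ge_aux[of v u] pair_diag_ge[of u] assms
  by (cases u v rule: linorder_cases) auto

text \<open>The left-hand side is the divergence of the shrinkage field in spectral coordinates:
  \<open>y a\<close> are the eigenvalues of the regularised inverse and \<open>\<theta> a = 1 - \<epsilon> * y a\<close>.\<close>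

lemma divergence_bound:
  fixes y \<theta> :: "nat \<Rightarrow> real"
  assumes q: "0 < q" and y: "\<And>a. a < q \<Longrightarrow> 0 < y a"
    and \<theta>: "0 \<le> \<theta>0" "\<And>a. a < q \<Longrightarrow> \<theta>0 \<le> \<theta> a"
  defines "T \<equiv> (\<Sum>a<q. poly phi (y a))"
  shows "(m * T - (\<Sum>a<q. \<theta> a * poly_pair phi (y a) (y a)) - (\<Sum>a<q. \<Sum>b<q. \<theta> a * poly_pair phi (y a) (y b))) / T
      + 2 * (\<Sum>a<q. poly phi (y a) * (\<theta> a * poly_pair phi (y a) (y a))) / T\<^sup>2 \<le> m - (real q - 1) * \<theta>0"
proof -
  define D where "D a = \<theta> a * poly_pair phi (y a) (y a)" for a
  have D: "0 \<le> D a" if "a < q" for a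
    unfolding D_def using \<theta>(1) \<theta>(2)[OF that] pair_nonneg[OF y[OF that] y[OF that]] by simp
  have T: "0 < T" unfolding T_def using q y phi_pos by (intro sum_pos) auto
  have phiT: "poly phi (y a) \<le> T" if "a < q" for a
    unfolding T_def by (rule member_le_sum) (use that y phi_pos in \<open>auto intro: less_imp_le\<close>)
  have off: "(real q - 1) * T * \<theta>0 + (\<Sum>a<q. D a) \<le> (\<Sum>a<q. \<Sum>b<q. \<theta> a * poly_pair phi (y a) (y b))"
  proof -
    let ?N = "\<lambda>a b. if a = b then 0 else poly_pair phi (y a) (y b)"
    have split: "(\<Sum>a<q. \<Sum>b<q. \<theta> a * poly_pair phi (y a) (y b)) = (\<Sum>a<q. D a) + (\<Sum>a<q. \<Sum>b<q. \<theta> a * ?N a b)"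
    proof -
      have "(\<Sum>b<q. \<theta> a * poly_pair phi (y a) (y b)) = D a + (\<Sum>b<q. \<theta> a * ?N a b)" if "a < q" for a
      proof -
        have "(\<Sum>b<q. \<theta> a * poly_pair phi (y a) (y b)) = (\<Sum>b<q. (if b = a then D a else 0) + \<theta> a * ?N a b)"
          by (intro sum.cong) (auto simp: D_def)
        then show ?thesis using that by (simp add: sum.distrib)
      qed
      then show ?thesis by (simp add: sum.distrib)
    qed
    \<comment> \<open>The weight \<open>\<theta> a\<close> is attached to one index of a pair only;
      lowering it to the constant \<open>\<theta>0\<close> makes symmetrisation in both indices
      possible.\<close>
    have "(\<Sum>a<q. \<Sum>b<q. \<theta>0 * ?N a b) \<le> (\<Sum>a<q. \<Sum>b<q. \<theta> a * ?N a b)"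
      using \<theta> pair_nonneg y by (intro sum_mono mult_right_mono) auto
    \<comment> \<open>Each index lies in q - 1 unordered pairs, and a pair contributes at least the
      sum of its two values of \<open>phi\<close>; hence (q - 1) T.\<close>
    moreover have "2 * (\<Sum>a<q. \<Sum>b<q. ?N a b) \<ge> 2 * (real q - 1) * T"
    proof -
      have "2 * (\<Sum>a<q. \<Sum>b<q. ?N a b) = (\<Sum>a<q. \<Sum>b<q. ?N a b) + (\<Sum>a<q. \<Sum>b<q. ?N b a)"
        by (subst (2) sum.swap) simp
      also have "\<dots> = (\<Sum>a<q. \<Sum>b<q. ?N a b + ?N b a)" by (simp add: sum.distrib)
      also have "\<dots> \<ge> (\<Sum>a<q. \<Sum>b<q. if a = b then 0 else poly phi (y a) + poly phi (y b))"
        using pair_sym_ge y by (intro sum_mono) auto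
      also have "(\<Sum>a<q. \<Sum>b<q. if a = b then 0 else poly phi (y a) + poly phi (y b))
          = (\<Sum>a<q. \<Sum>b<q. (poly phi (y a) + poly phi (y b)) - (if b = a then 2 * poly phi (y a) else 0))"
        by (intro sum.cong) auto
      also have "\<dots> = (\<Sum>a<q. real q * poly phi (y a) + T - 2 * poly phi (y a))"
        by (intro sum.cong) (auto simp: sum_subtractf sum.distrib T_def)
      also have "\<dots> = 2 * (real q - 1) * T"
        by (simp add: sum_subtractf sum.distrib T_def[symmetric] sum_distrib_left[symmetric] algebra_simps)
      finally show ?thesis by linarith
    qed
    then have "(real q - 1) * T \<le> (\<Sum>a<q. \<Sum>b<q. ?N a b)" unfolding mult.assoc by linarith
    then have "\<theta>0 * ((real q - 1) * T) \<le> (\<Sum>a<q. \<Sum>b<q. \<theta>0 * ?N a b)"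
      unfolding sum_distrib_left[symmetric] using \<theta>(1) by (rule mult_left_mono)
    ultimately have "\<theta>0 * ((real q - 1) * T) \<le> (\<Sum>a<q. \<Sum>b<q. \<theta> a * ?N a b)" by linarith
    then show ?thesis unfolding split by (simp add: mult_ac)
  qed
  \<comment> \<open>The derivative of the normaliser contributes a nonnegative term. Since no value
    of \<open>phi\<close> exceeds \<open>T\<close>, it is at most twice the sum of \<open>D\<close>
    divided by \<open>T\<close>. The single sum and the diagonal of the double sum in the first
    fraction compensate exactly this amount.\<close>
  have last: "(\<Sum>a<q. poly phi (y a) * D a) \<le> T * (\<Sum>a<q. D a)"
    unfolding sum_distrib_left using phiT D by (intro sum_mono mult_right_mono) auto
  have "2 * (\<Sum>a<q. poly phi (y a) * D a) / T\<^sup>2 \<le> 2 * (T * (\<Sum>a<q. D a)) / T\<^sup>2"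
    using last by (intro divide_right_mono) auto
  also have "\<dots> = 2 * (\<Sum>a<q. D a) / T" using T by (simp add: power2_eq_square)
  finally have 1: "2 * (\<Sum>a<q. poly phi (y a) * D a) / T\<^sup>2 \<le> 2 * (\<Sum>a<q. D a) / T" .
  have "(m * T - (\<Sum>a<q. D a) - (\<Sum>a<q. \<Sum>b<q. \<theta> a * poly_pair phi (y a) (y b))) / T
     \<le> (m * T - (\<Sum>a<q. D a) - ((real q - 1) * T * \<theta>0 + (\<Sum>a<q. D a))) / T"
    using T off by (intro divide_right_mono) auto
  also have "\<dots> = m - (real q - 1) * \<theta>0 - 2 * (\<Sum>a<q. D a) / T" using T by (simp add: field_simps)
  finally show ?thesis using 1 unfolding D_def by linarith
qed

end

section \<open>Polynomial approximation of power functions by admissible weights\<close>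

lemma poly_antiderivative: "\<exists>Q :: real poly. pderiv Q = p \<and> poly Q 0 = 0"
proof -
  let ?Q = "\<Sum>k\<le>degree p. monom (coeff p k / real (Suc k)) (Suc k)"
  have "pderiv ?Q = (\<Sum>k\<le>degree p. monom (coeff p k) k)"
    unfolding pderiv_sum by (intro sum.cong) (auto simp: pderiv_monom)
  also have "\<dots> = p" by (rule poly_as_sum_of_monoms)
  finally show ?thesis by (intro exI[of _ ?Q]) (auto simp: poly_sum poly_monom)
qed

lemma poly_weierstrass:
  fixes f :: "real \<Rightarrow> real"
  assumes "continuous_on {a..b} f" "0 < e"
  shows "\<exists>s :: real poly. \<forall>x\<in>{a..b}. \<bar>f x - poly s x\<bar> < e"
proof -
  obtain g where g: "real_polynomial_function g" "\<And>x. x \<in> {a..b} \<Longrightarrow> \<bar>f x - g x\<bar> < e"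
    using Stone_Weierstrass_real_polynomial_function[of "{a..b}" f e] assms by auto
  then obtain c n where "g = (\<lambda>x. \<Sum>i\<le>n. c i * x ^ i)"
    using real_polynomial_function_iff_sum by blast
  then have "poly (\<Sum>i\<le>n. monom (c i) i) x = g x" for x by (simp add: poly_sum poly_monom)
  then show ?thesis using g by (intro exI[of _ "\<Sum>i\<le>n. monom (c i) i"]) simp
qed

text \<open>A direct polynomial approximation of the power need not be monotone. Instead the square
  root of its derivative is approximated by a polynomial \<open>s\<close>, and \<open>P\<close> is a
  primitive of the square of \<open>s\<close> plus a small positive constant, so both conditions of
  \<open>weight_poly\<close> hold by construction. For \<beta> = 0 the constant 1 is exact.\<close>

lemma weight_poly_approx_powr:
  assumes \<beta>: "0 \<le> \<beta>" and K: "1 \<le> (K::real)"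
  shows "\<exists>P. weight_poly P \<and> (\<forall>y\<in>{1/K..K}. \<bar>poly P y - y powr \<beta>\<bar> \<le> 1 / K)"
proof (cases "\<beta> = 0")
  case True
  have "weight_poly [:1:]" by unfold_locales (auto simp: pderiv_pCons)
  moreover have "poly [:1:] y - y powr \<beta> = 0" if "y \<in> {1/K..K}" for y
  proof -
    have "0 < y" using that K by (auto intro: less_le_trans[of 0 "1/K"])
    then show ?thesis using True by simp
  qed
  ultimately show ?thesis using K by (intro exI[of _ "[:1:]"]) auto
next
  case False
  then have \<beta>0: "0 < \<beta>" using \<beta> by simp
  define t where "t = 1 / (4 * K * (1 + \<beta>))"
  \<comment> \<open>Small enough that the power and the primitive both change little between 0 and
    \<delta>: \<open>(1 + \<beta>) * \<delta> powr \<beta>\<close> is at most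
    \<open>1 / (4 * K)\<close>.\<close>
  define \<delta> where "\<delta> = min (1/K) (t powr (1 / \<beta>))"
  have t: "0 < t" using K \<beta> by (simp add: t_def)
  have \<delta>: "0 < \<delta>" "\<delta> \<le> 1/K" using t K by (auto simp: \<delta>_def)
  have \<delta>1: "\<delta> \<le> 1" using \<delta> K by (auto intro: order_trans)
  have "\<delta> powr \<beta> \<le> (t powr (1 / \<beta>)) powr \<beta>" using \<delta> \<beta> by (intro powr_mono2) (auto simp: \<delta>_def)
  also have "\<dots> = t" using \<beta>0 t by (simp add: powr_powr)
  finally have "(1 + \<beta>) * \<delta> powr \<beta> \<le> (1 + \<beta>) * t" using \<beta> by (intro mult_left_mono) auto
  also have "(1 + \<beta>) * t = 1 / (4 * K)"
  proof -
    have "1 + \<beta> \<noteq> 0" using \<beta> by simp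
    then show ?thesis by (simp add: t_def)
  qed
  finally have \<delta>\<beta>: "\<delta> powr \<beta> + \<beta> * \<delta> powr \<beta> \<le> 1 / (4 * K)" by (simp add: algebra_simps)
  \<comment> \<open>The derivative of the power, frozen below \<delta>: for \<beta> < 1 it blows up
    at 0 and could not be approximated uniformly.\<close>
  define h where "h y = \<beta> * (max y \<delta>) powr (\<beta> - 1)" for y
  have h0: "0 \<le> h y" for y using \<beta> by (simp add: h_def)
  have ch: "continuous_on {0..K} (\<lambda>y. sqrt (h y))"
    unfolding h_def using \<delta> by (intro continuous_intros) auto
  obtain G where G: "\<And>y. y \<in> {0..K} \<Longrightarrow> sqrt (h y) \<le> G"
  proof -
    have "bounded ((\<lambda>y. sqrt (h y)) ` {0..K})"
      by (intro compact_imp_bounded compact_continuous_image ch) simp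
    then obtain G where "\<forall>x\<in>(\<lambda>y. sqrt (h y)) ` {0..K}. norm x \<le> G" by (auto simp: bounded_iff)
    then show thesis using h0 by (intro that[of G]) auto
  qed
  have G0: "0 \<le> G" using G[of 0] K h0[of 0] by (auto intro: order_trans[OF real_sqrt_ge_zero])
  \<comment> \<open>\<open>G\<close> bounds the square root of \<open>h\<close>, so squaring
    multiplies the error by at most 2 G + 1. The factor K^2 leaves an error of 1 / (4 K) after
    integration over a length of at most K.\<close>
  define e where "e = 1 / (4 * K\<^sup>2 * (2 * G + 1))"
  have e: "0 < e" using K G0 by (simp add: e_def)
  have "1 \<le> K\<^sup>2" using K by (rule one_le_power)
  then have "1 * 1 \<le> (4 * K\<^sup>2) * (2 * G + 1)" using G0 by (intro mult_mono) auto
  then have e1: "e \<le> 1" by (simp add: e_def)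
  obtain s where s: "\<And>y. y \<in> {0..K} \<Longrightarrow> \<bar>sqrt (h y) - poly s y\<bar> < e"
    using poly_weierstrass[OF ch e] by blast
  have sq: "\<bar>(poly s y)\<^sup>2 - h y\<bar> \<le> 1 / (4 * K\<^sup>2)" if "y \<in> {0..K}" for y
  proof -
    have "(poly s y)\<^sup>2 - h y = (poly s y - sqrt (h y)) * (poly s y + sqrt (h y))"
      using h0[of y] by (simp add: algebra_simps power2_eq_square)
    then have "\<bar>(poly s y)\<^sup>2 - h y\<bar> = \<bar>poly s y - sqrt (h y)\<bar> * \<bar>poly s y + sqrt (h y)\<bar>" by (simp add: abs_mult)
    also have "\<dots> \<le> e * (2 * G + 1)"
    proof (rule mult_mono)
      have a: "\<bar>sqrt (h y) - poly s y\<bar> < e" "0 \<le> sqrt (h y)" "sqrt (h y) \<le> G" using s[OF that] h0[of y] G[OF that] by auto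
      then show "\<bar>poly s y - sqrt (h y)\<bar> \<le> e" by linarith
      show "\<bar>poly s y + sqrt (h y)\<bar> \<le> 2 * G + 1" using a e1 by linarith
    qed (use e in auto)
    also have "\<dots> = 1 / (4 * K\<^sup>2)" using G0 K by (simp add: e_def)
    finally show ?thesis .
  qed
  obtain Q where Q: "pderiv Q = s * s" "poly Q 0 = 0" using poly_antiderivative by blast
  define P where "P = [:1 / (4 * K):] + Q"
  have dP: "pderiv P = s * s" by (simp add: P_def pderiv_add pderiv_pCons Q)
  have "weight_poly P" by unfold_locales (use dP Q K in \<open>auto simp: P_def\<close>)
  moreover have "\<bar>poly P y - y powr \<beta>\<bar> \<le> 1 / K" if y: "y \<in> {1/K..K}" for y
  proof -
    have deriv: "(poly P has_real_derivative (poly s x)\<^sup>2) (at x)" for x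
      using poly_DERIV[of P x] by (simp add: dP power2_eq_square)
    obtain z where z: "0 < z" "z < \<delta>" "poly P \<delta> - poly P 0 = (\<delta> - 0) * (poly s z)\<^sup>2"
      using MVT2[OF \<delta>(1), of "poly P" "\<lambda>x. (poly s x)\<^sup>2"] deriv by blast
    have "(poly s z)\<^sup>2 \<le> h z + 1 / (4 * K\<^sup>2)" using sq[of z] z \<delta> K \<delta>1 by (auto simp: abs_le_iff)
    also have "h z = \<beta> * \<delta> powr (\<beta> - 1)" using z by (simp add: h_def max_def)
    finally have "\<delta> * (poly s z)\<^sup>2 \<le> \<delta> * (\<beta> * \<delta> powr (\<beta> - 1) + 1 / (4 * K\<^sup>2))"
      using \<delta> by (intro mult_left_mono) auto
    also have "\<dots> = \<beta> * \<delta> powr \<beta> + \<delta> / (4 * K\<^sup>2)"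
      using \<delta> by (simp add: powr_diff algebra_simps)
    also have "\<delta> / (4 * K\<^sup>2) \<le> 1 / (4 * K)"
    proof -
      have "\<delta> / (4 * K\<^sup>2) \<le> 1 / (4 * K\<^sup>2)" using \<delta>1 by (intro divide_right_mono) auto
      also have "\<dots> \<le> 1 / (4 * K)" using K by (intro divide_left_mono) (auto simp: power2_eq_square)
      finally show ?thesis .
    qed
    finally have P\<delta>: "poly P \<delta> \<le> 2 / (4 * K) + \<beta> * \<delta> powr \<beta>" using z(3) Q by (simp add: P_def)
    have P\<delta>0: "0 \<le> poly P \<delta>" using z(3) Q K \<delta> by (simp add: P_def)
    have "\<bar>(poly P y - y powr \<beta>) - (poly P \<delta> - \<delta> powr \<beta>)\<bar> \<le> 1 / (4 * K)"
    proof (cases "y = \<delta>")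
      case True
      then show ?thesis using K by simp
    next
      case False
      then have lt: "\<delta> < y" using y \<delta> by auto
      have d: "((\<lambda>x. poly P x - x powr \<beta>) has_real_derivative ((poly s x)\<^sup>2 - \<beta> * x powr (\<beta> - 1))) (at x)"
        if "\<delta> \<le> x" "x \<le> y" for x
        using that \<delta> by (intro DERIV_diff deriv has_real_derivative_powr) auto
      obtain x where x: "\<delta> < x" "x < y" "(poly P y - y powr \<beta>) - (poly P \<delta> - \<delta> powr \<beta>) = (y - \<delta>) * ((poly s x)\<^sup>2 - \<beta> * x powr (\<beta> - 1))"
        using MVT2[OF lt, of "\<lambda>x. poly P x - x powr \<beta>" "\<lambda>x. (poly s x)\<^sup>2 - \<beta> * x powr (\<beta> - 1)"] d by blast
      have "\<beta> * x powr (\<beta> - 1) = h x" using x by (simp add: h_def max_def)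
      then have "\<bar>(poly s x)\<^sup>2 - \<beta> * x powr (\<beta> - 1)\<bar> \<le> 1 / (4 * K\<^sup>2)" using sq[of x] x y \<delta> by simp
      then have "\<bar>(y - \<delta>) * ((poly s x)\<^sup>2 - \<beta> * x powr (\<beta> - 1))\<bar> \<le> K * (1 / (4 * K\<^sup>2))"
        unfolding abs_mult using y \<delta> lt K by (intro mult_mono) auto
      also have "\<dots> = 1 / (4 * K)" using K by (simp add: power2_eq_square)
      finally show ?thesis unfolding x(3) .
    qed
    moreover have "0 \<le> \<delta> powr \<beta>" "0 \<le> \<beta> * \<delta> powr \<beta>" using \<beta> by auto
    \<comment> \<open>Error budget in units of 1 / (4 K): one for the interval beyond \<delta>, two
      for the constant term and the approximation error below \<delta>, one for the power terms at
      \<delta>.\<close>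
    moreover have "1 / K = 4 * (1 / (4 * K))" "2 / (4 * K) = 2 * (1 / (4 * K))" using K by auto
    ultimately show ?thesis using P\<delta> P\<delta>0 \<delta>\<beta> K unfolding abs_le_iff by linarith
  qed
  ultimately show ?thesis by blast
qed

section \<open>Matrix calculus\<close>

definition mat_deriv :: "nat \<Rightarrow> nat \<Rightarrow> (real \<Rightarrow> real mat) \<Rightarrow> real mat \<Rightarrow> real \<Rightarrow> bool" where
  "mat_deriv nr nc F F' t \<longleftrightarrow> (\<forall>s. F s \<in> carrier_mat nr nc) \<and> F' \<in> carrier_mat nr nc \<and>
     (\<forall>i<nr. \<forall>j<nc. ((\<lambda>s. F s $$ (i,j)) has_real_derivative F' $$ (i,j)) (at t))"

lemma mat_deriv_const: "A \<in> carrier_mat nr nc \<Longrightarrow> mat_deriv nr nc (\<lambda>_. A) (0\<^sub>m nr nc) t"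
  by (auto simp: mat_deriv_def)

lemma mat_deriv_dims:
  assumes "mat_deriv nr nc F F' t"
  shows "dim_row (F s) = nr" "dim_col (F s) = nc" "dim_row F' = nr" "dim_col F' = nc"
  using assms by (auto simp: mat_deriv_def)

lemma mat_deriv_add:
  assumes F: "mat_deriv nr nc F F' t" and G: "mat_deriv nr nc G G' t"
  shows "mat_deriv nr nc (\<lambda>s. F s + G s) (F' + G') t"
proof -
  have c: "\<And>s. F s \<in> carrier_mat nr nc" "\<And>s. G s \<in> carrier_mat nr nc" "F' \<in> carrier_mat nr nc" "G' \<in> carrier_mat nr nc"
    using F G unfolding mat_deriv_def by blast+
  have "((\<lambda>s. (F s + G s) $$ (i,j)) has_real_derivative (F' + G') $$ (i,j)) (at t)"
    if ij: "i < nr" "j < nc" for i j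
  proof -
    have "((\<lambda>s. F s $$ (i,j) + G s $$ (i,j)) has_real_derivative F' $$ (i,j) + G' $$ (i,j)) (at t)"
      using F G ij unfolding mat_deriv_def by (intro DERIV_add) blast+
    moreover have "(F s + G s) $$ (i,j) = F s $$ (i,j) + G s $$ (i,j)" for s
      using carrier_matD[OF c(2)[of s]] ij by simp
    moreover have "(F' + G') $$ (i,j) = F' $$ (i,j) + G' $$ (i,j)"
      using carrier_matD[OF c(4)] ij by simp
    ultimately show ?thesis by simp
  qed
  then show ?thesis unfolding mat_deriv_def using add_carrier_mat[OF c(2)] add_carrier_mat[OF c(4)] by blast
qed

lemma mat_deriv_transpose:
  assumes F: "mat_deriv nr nc F F' t"
  shows "mat_deriv nc nr (\<lambda>s. (F s)\<^sup>T) F'\<^sup>T t"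
  using F mat_deriv_dims[OF F] by (auto simp: mat_deriv_def)

lemma mat_deriv_mult:
  assumes F: "mat_deriv nr n F F' t" and G: "mat_deriv n nc G G' t"
  shows "mat_deriv nr nc (\<lambda>s. F s * G s) (F' * G t + F t * G') t"
proof -
  have cF: "F s \<in> carrier_mat nr n" and cG: "G s \<in> carrier_mat n nc" for s
    using F G by (auto simp: mat_deriv_def)
  have c': "F' \<in> carrier_mat nr n" "G' \<in> carrier_mat n nc"
    using F G by (auto simp: mat_deriv_def)
  have "((\<lambda>s. (F s * G s) $$ (i,j)) has_real_derivative (F' * G t + F t * G') $$ (i,j)) (at t)"
    if ij: "i < nr" "j < nc" for i j
  proof -
    have "((\<lambda>s. \<Sum>k<n. F s $$ (i,k) * G s $$ (k,j)) has_real_derivative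
        (\<Sum>k<n. F' $$ (i,k) * G t $$ (k,j) + F t $$ (i,k) * G' $$ (k,j))) (at t)"
      using F G ij by (intro DERIV_sum) (auto simp: mat_deriv_def intro!: derivative_eq_intros)
    moreover have "(F s * G s) $$ (i,j) = (\<Sum>k<n. F s $$ (i,k) * G s $$ (k,j))" for s
      using cF[of s] cG[of s] ij by (subst mat_mult_index) auto
    moreover have "(F' * G t) $$ (i,j) = (\<Sum>k<n. F' $$ (i,k) * G t $$ (k,j))"
      using cF[of t] cG[of t] c' ij by (subst mat_mult_index) auto
    moreover have "(F t * G') $$ (i,j) = (\<Sum>k<n. F t $$ (i,k) * G' $$ (k,j))"
      using cF[of t] cG[of t] c' ij by (subst mat_mult_index) auto
    ultimately show ?thesis using cF[of t] cG[of t] c' ij by (simp add: sum.distrib)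
  qed
  then show ?thesis unfolding mat_deriv_def
    using mult_carrier_mat[OF cF cG] add_carrier_mat[OF mult_carrier_mat[OF cF c'(2)]] by blast
qed

lemma isCont_det:
  fixes F :: "real \<Rightarrow> real mat"
  assumes F: "\<And>s. F s \<in> carrier_mat n n" and cont: "\<And>i j. i < n \<Longrightarrow> j < n \<Longrightarrow> isCont (\<lambda>s. F s $$ (i,j)) t"
  shows "isCont (\<lambda>s. Determinant.det (F s)) t"
  unfolding det_def'[OF F]
proof (intro continuous_intros)
  fix p i assume "p \<in> {p. p permutes {0..<n}}" "i \<in> {0..<n}"
  then have "i < n" "p i < n" using permutes_in_image[of p "{0..<n}" i] by auto
  then show "isCont (\<lambda>s. F s $$ (i, p i)) t" by (rule cont)
qed

lemma isCont_adj_mat: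
  fixes F :: "real \<Rightarrow> real mat"
  assumes F: "\<And>s. F s \<in> carrier_mat n n" and cont: "\<And>i j. i < n \<Longrightarrow> j < n \<Longrightarrow> isCont (\<lambda>s. F s $$ (i,j)) t"
    and ij: "i < n" "j < n"
  shows "isCont (\<lambda>s. adj_mat (F s) $$ (i,j)) t"
proof -
  have dims: "dim_row (F s) = n" "dim_col (F s) = n" for s using F[of s] by auto
  have "isCont (\<lambda>s. (- 1) ^ (j + i) * Determinant.det (mat_delete (F s) j i)) t"
  proof (intro continuous_intros isCont_det[of _ "n - 1"])
    show "mat_delete (F s) j i \<in> carrier_mat (n - 1) (n - 1)" for s by (simp add: mat_delete_def dims)
    fix a b assume "a < n - 1" "b < n - 1"
    then show "isCont (\<lambda>s. mat_delete (F s) j i $$ (a,b)) t"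
      by (auto simp: mat_delete_def dims intro!: cont)
  qed
  then show ?thesis using ij by (simp add: adj_mat_def dims cofactor_def)
qed

text \<open>Cramer's formula makes the entries rational functions of those of \<open>A\<close>, so
  continuity and measurability reduce to determinants.\<close>

definition inv_mat :: "real mat \<Rightarrow> real mat" where
  "inv_mat A = (1 / Determinant.det A) \<cdot>\<^sub>m adj_mat A"

lemma inv_mat:
  assumes "A \<in> carrier_mat n n" "Determinant.det A \<noteq> 0"
  shows "inv_mat A \<in> carrier_mat n n" "A * inv_mat A = 1\<^sub>m n" "inv_mat A * A = 1\<^sub>m n"
proof -
  note adj = adj_mat[OF assms(1)]
  show "inv_mat A \<in> carrier_mat n n" using adj by (simp add: inv_mat_def)
  show "A * inv_mat A = 1\<^sub>m n" unfolding inv_mat_def using adj assms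
    by (subst mult_smult_distrib[of _ n n _ n]) auto
  show "inv_mat A * A = 1\<^sub>m n" unfolding inv_mat_def using adj assms
    by (subst mult_smult_assoc_mat[of _ n n _ n]) auto
qed

lemma inv_mat_unique:
  assumes A: "A \<in> carrier_mat n n" and det: "Determinant.det A \<noteq> 0" and B: "B \<in> carrier_mat n n" "B * A = 1\<^sub>m n"
  shows "inv_mat A = B"
proof -
  note Ai = inv_mat[OF A det]
  have "inv_mat A = (B * A) * inv_mat A" using Ai(1) B by simp
  also have "\<dots> = B * (A * inv_mat A)" by (rule mat_mult_assoc) (use A B Ai(1) in auto)
  also have "\<dots> = B" using Ai(2) B by simp
  finally show ?thesis .
qed

text \<open>The resolvent identity \<open>R t - R s = R s * (F s - F t) * R t\<close> turns the
  difference quotient of the inverse into that of \<open>F\<close>. The limit then needs only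
  continuity of the inverse, which Cramer's formula gives.\<close>

lemma mat_deriv_inverse:
  assumes F: "mat_deriv n n F F' t" and det: "\<And>s. Determinant.det (F s) \<noteq> 0"
  shows "mat_deriv n n (\<lambda>s. inv_mat (F s)) (- (inv_mat (F t) * F' * inv_mat (F t))) t"
proof -
  define R where "R s = inv_mat (F s)" for s
  have Fc: "\<And>s. F s \<in> carrier_mat n n" and F'c: "F' \<in> carrier_mat n n"
    and dF: "\<And>i j. i < n \<Longrightarrow> j < n \<Longrightarrow> ((\<lambda>s. F s $$ (i,j)) has_real_derivative F' $$ (i,j)) (at t)"
    using F by (auto simp: mat_deriv_def)
  note R = inv_mat[OF Fc det, folded R_def]
  have dims: "dim_row (F s) = n" "dim_col (F s) = n" "dim_row (R s) = n" "dim_col (R s) = n"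
    "dim_row F' = n" "dim_col F' = n" for s using Fc[of s] R(1)[of s] F'c by auto
  have cont: "isCont (\<lambda>s. R s $$ (i,j)) t" if "i < n" "j < n" for i j
  proof -
    have cF: "isCont (\<lambda>s. F s $$ (i,j)) t" if "i < n" "j < n" for i j using dF[OF that] by (rule DERIV_isCont)
    have "isCont (\<lambda>s. 1 / Determinant.det (F s) * adj_mat (F s) $$ (i,j)) t"
      using det that by (intro continuous_intros isCont_det[of _ n] isCont_adj_mat[of _ n] Fc cF) auto
    then show ?thesis using that by (simp add: R_def inv_mat_def adj_mat_def dims)
  qed
  have diff: "(R s $$ (i,j) - R t $$ (i,j)) / (s - t)
      = - (\<Sum>k<n. \<Sum>l<n. R s $$ (i,k) * ((F s $$ (k,l) - F t $$ (k,l)) / (s - t)) * R t $$ (l,j))"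
    if ij: "i < n" "j < n" for s i j
  proof -
    have "R t - R s = R s * (F s - F t) * R t"
    proof -
      have "R s * (F s - F t) * R t = (R s * F s - R s * F t) * R t"
        using R(1) Fc by (subst mult_minus_distrib_mat[of _ n n _ n]) auto
      also have "\<dots> = R s * F s * R t - R s * F t * R t"
        using R(1) Fc by (subst minus_mult_distrib_mat[of _ n n _ _ n]) (auto intro: mult_carrier_mat)
      also have "\<dots> = R t - R s" using R by (simp add: mat_mult_assoc dims mat_one_mult)
      finally show ?thesis by simp
    qed
    then have "(R t - R s) $$ (i,j) = (R s * ((F s - F t) * R t)) $$ (i,j)"
      by (simp add: mat_mult_assoc dims)
    also have "\<dots> = (\<Sum>k<n. R s $$ (i,k) * (\<Sum>l<n. (F s $$ (k,l) - F t $$ (k,l)) * R t $$ (l,j)))"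
      using ij by (subst mat_mult_index) (auto simp: dims mat_mult_index simp del: index_mult_mat(1) intro!: sum.cong)
    finally have "R t $$ (i,j) - R s $$ (i,j) = (\<Sum>k<n. \<Sum>l<n. R s $$ (i,k) * (F s $$ (k,l) - F t $$ (k,l)) * R t $$ (l,j))"
      using ij by (simp add: dims sum_distrib_left mult.assoc)
    then have "(R s $$ (i,j) - R t $$ (i,j)) / (s - t)
      = - ((\<Sum>k<n. \<Sum>l<n. R s $$ (i,k) * (F s $$ (k,l) - F t $$ (k,l)) * R t $$ (l,j)) / (s - t))"
      by (metis minus_diff_eq minus_divide_left)
    then show ?thesis by (simp add: sum_divide_distrib)
  qed
  have "((\<lambda>s. R s $$ (i,j)) has_real_derivative (- (R t * F' * R t)) $$ (i,j)) (at t)" if ij: "i < n" "j < n" for i j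
  proof -
    have "((\<lambda>s. - (\<Sum>k<n. \<Sum>l<n. R s $$ (i,k) * ((F s $$ (k,l) - F t $$ (k,l)) / (s - t)) * R t $$ (l,j)))
        \<longlongrightarrow> - (\<Sum>k<n. \<Sum>l<n. R t $$ (i,k) * F' $$ (k,l) * R t $$ (l,j))) (at t)"
      using cont ij dF by (intro tendsto_intros) (auto simp: isCont_def has_field_derivative_iff)
    moreover have "(- (R t * F' * R t)) $$ (i,j) = - (\<Sum>k<n. \<Sum>l<n. R t $$ (i,k) * F' $$ (k,l) * R t $$ (l,j))"
    proof -
      have "(R t * F' * R t) $$ (i,j) = (R t * (F' * R t)) $$ (i,j)" by (simp add: mat_mult_assoc dims)
      also have "\<dots> = (\<Sum>k<n. R t $$ (i,k) * (\<Sum>l<n. F' $$ (k,l) * R t $$ (l,j)))"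
        using ij by (subst mat_mult_index) (auto simp: dims mat_mult_index simp del: index_mult_mat(1) intro!: sum.cong)
      finally show ?thesis using ij by (simp add: dims sum_distrib_left mult.assoc)
    qed
    ultimately show ?thesis unfolding has_field_derivative_iff diff[OF ij] by simp
  qed
  then show ?thesis using R(1) F'c unfolding R_def by (auto simp: mat_deriv_def intro!: mult_carrier_mat)
qed

text \<open>Product rule: replacing one of the k factors R by - R A' R leaves l + 1 factors in front
  of A' and k - l behind it, so the exponents add up to k + 1.\<close>

lemma pow_mat_deriv_inverse:
  assumes R: "mat_deriv n n R (- (R t * A' * R t)) t" and A': "A' \<in> carrier_mat n n" and ij: "i < n" "j < n"
  shows "((\<lambda>s. (R s ^\<^sub>m k) $$ (i,j)) has_real_derivative
     - (\<Sum>l<k. (R t ^\<^sub>m Suc l * A' * R t ^\<^sub>m (k - l)) $$ (i,j))) (at t)"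
  using ij
proof (induction k arbitrary: i j)
  case 0
  have "dim_row (R s) = n" for s using R by (auto simp: mat_deriv_def)
  then show ?case using 0 by simp
next
  case (Suc k)
  have Rc: "R s \<in> carrier_mat n n" for s using R by (auto simp: mat_deriv_def)
  have Rk: "R s ^\<^sub>m l \<in> carrier_mat n n" for s l using Rc by (rule pow_carrier_mat)
  have dims: "dim_row (R s) = n" "dim_col (R s) = n" "dim_row (R s ^\<^sub>m l) = n" "dim_col (R s ^\<^sub>m l) = n"
    "dim_row A' = n" "dim_col A' = n" for s l using Rc[of s] Rk[of s l] A' by auto
  have dR: "((\<lambda>s. R s $$ (b,j)) has_real_derivative - (R t * A' * R t) $$ (b,j)) (at t)" if "b < n" for b
    using R that Suc.prems unfolding mat_deriv_def by (auto simp: dims)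
  have "((\<lambda>s. \<Sum>b<n. (R s ^\<^sub>m k) $$ (i,b) * R s $$ (b,j)) has_real_derivative
     (\<Sum>b<n. - (\<Sum>l<k. (R t ^\<^sub>m Suc l * A' * R t ^\<^sub>m (k - l)) $$ (i,b)) * R t $$ (b,j)
        + (R t ^\<^sub>m k) $$ (i,b) * (- (R t * A' * R t) $$ (b,j)))) (at t)"
    using Suc dR by (intro DERIV_sum) (auto intro!: derivative_eq_intros)
  moreover have "(\<Sum>b<n. (R s ^\<^sub>m k) $$ (i,b) * R s $$ (b,j)) = (R s ^\<^sub>m Suc k) $$ (i,j)" for s
    using Suc.prems by (simp add: mat_mult_index dims del: index_mult_mat(1))
  moreover have "(\<Sum>b<n. - (\<Sum>l<k. (R t ^\<^sub>m Suc l * A' * R t ^\<^sub>m (k - l)) $$ (i,b)) * R t $$ (b,j)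
        + (R t ^\<^sub>m k) $$ (i,b) * (- (R t * A' * R t) $$ (b,j)))
     = - (\<Sum>l<Suc k. (R t ^\<^sub>m Suc l * A' * R t ^\<^sub>m (Suc k - l)) $$ (i,j))"
  proof -
    have 1: "(\<Sum>b<n. (R t ^\<^sub>m Suc l * A' * R t ^\<^sub>m (k - l)) $$ (i,b) * R t $$ (b,j))
       = (R t ^\<^sub>m Suc l * A' * R t ^\<^sub>m (Suc k - l)) $$ (i,j)" if "l < k" for l
    proof -
      have "R t ^\<^sub>m Suc l * A' * R t ^\<^sub>m (Suc k - l) = (R t ^\<^sub>m Suc l * A' * R t ^\<^sub>m (k - l)) * R t"
        using that by (simp add: Suc_diff_le mat_mult_assoc dims)
      then show ?thesis using Suc.prems
        by (simp only:) (subst mat_mult_index, auto simp: dims)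
    qed
    have 2: "(\<Sum>b<n. (R t ^\<^sub>m k) $$ (i,b) * (R t * A' * R t) $$ (b,j)) = (R t ^\<^sub>m Suc k * A' * R t ^\<^sub>m (Suc k - k)) $$ (i,j)"
    proof -
      have "R t ^\<^sub>m Suc k * A' * R t ^\<^sub>m (Suc k - k) = R t ^\<^sub>m k * (R t * A' * R t)"
        by (simp add: mat_mult_assoc dims mat_one_mult)
      then show ?thesis using Suc.prems
        by (simp only:) (subst mat_mult_index, auto simp: dims)
    qed
    have "(\<Sum>b<n. (\<Sum>l<k. (R t ^\<^sub>m Suc l * A' * R t ^\<^sub>m (k - l)) $$ (i,b)) * R t $$ (b,j))
      = (\<Sum>l<k. \<Sum>b<n. (R t ^\<^sub>m Suc l * A' * R t ^\<^sub>m (k - l)) $$ (i,b) * R t $$ (b,j))"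
      unfolding sum_distrib_right by (rule sum.swap)
    also have "\<dots> = (\<Sum>l<k. (R t ^\<^sub>m Suc l * A' * R t ^\<^sub>m (Suc k - l)) $$ (i,j))"
      by (intro sum.cong) (auto simp only: 1 lessThan_iff)
    finally show ?thesis using 2 by (simp only: sum.distrib sum.lessThan_Suc sum_negf mult_minus_left mult_minus_right minus_add_distrib)
  qed
  ultimately show ?case by (simp only:)
qed

definition unit_mat :: "nat \<Rightarrow> nat \<Rightarrow> nat \<Rightarrow> nat \<Rightarrow> real mat" where
  "unit_mat m q a c = Matrix.mat m q (\<lambda>ij. if ij = (a,c) then 1 else 0)"

lemma unit_mat_carrier [simp]: "unit_mat m q a c \<in> carrier_mat m q"
  "dim_row (unit_mat m q a c) = m" "dim_col (unit_mat m q a c) = q"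
  by (auto simp: unit_mat_def)

lemma unit_mat_sandwich:
  assumes "P \<in> carrier_mat nr m" "Q \<in> carrier_mat q nc" "a < m" "c < q" "i < nr" "j < nc"
  shows "(P * unit_mat m q a c * Q) $$ (i,j) = P $$ (i,a) * Q $$ (c,j)"
proof -
  have "(P * unit_mat m q a c) $$ (i,k) = (if k = c then P $$ (i,a) else 0)" if "k < q" for k
  proof -
    have "(P * unit_mat m q a c) $$ (i,k) = (\<Sum>b<m. P $$ (i,b) * unit_mat m q a c $$ (b,k))"
      using assms that by (subst mat_mult_index) auto
    also have "\<dots> = (\<Sum>b<m. if b = a then (if k = c then P $$ (i,a) else 0) else 0)"
      using that by (intro sum.cong) (auto simp: unit_mat_def)
    finally show ?thesis using assms by simp
  qed
  note col = this
  have "(P * unit_mat m q a c * Q) $$ (i,j) = (\<Sum>k<q. (P * unit_mat m q a c) $$ (i,k) * Q $$ (k,j))"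
    using assms by (subst mat_mult_index) auto
  also have "\<dots> = (\<Sum>k<q. if k = c then P $$ (i,a) * Q $$ (c,j) else 0)"
    by (intro sum.cong) (auto simp del: index_mult_mat(1) simp: col)
  finally show ?thesis using assms by simp
qed

lemma unit_mat_transpose: "(unit_mat m q a c)\<^sup>T = unit_mat q m c a"
  by (rule eq_matI) (auto simp: unit_mat_def)

lemma mat_trace_transpose_mult:
  assumes "P \<in> carrier_mat m q" "Q \<in> carrier_mat m q"
  shows "(\<Sum>a<m. \<Sum>j<q. P $$ (a,j) * Q $$ (a,j)) = mat_trace (P\<^sup>T * Q)"
  using assms by (subst mat_trace_mult) (auto intro: sum.swap)

definition mat_tame :: "'i set \<Rightarrow> nat \<Rightarrow> nat \<Rightarrow> (('i \<Rightarrow> real) \<Rightarrow> real mat) \<Rightarrow> bool" where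
  "mat_tame I nr nc F \<longleftrightarrow> (\<forall>x. F x \<in> carrier_mat nr nc) \<and> (\<forall>i<nr. \<forall>j<nc. tame I (\<lambda>x. F x $$ (i,j)))"

lemma mat_tame_const: "A \<in> carrier_mat nr nc \<Longrightarrow> mat_tame I nr nc (\<lambda>_. A)"
  by (auto simp: mat_tame_def tame_const)

lemma mat_tame_add: "mat_tame I nr nc F \<Longrightarrow> mat_tame I nr nc G \<Longrightarrow> mat_tame I nr nc (\<lambda>x. F x + G x)"
  unfolding mat_tame_def
proof safe
  fix i j assume "\<forall>x. F x \<in> carrier_mat nr nc" "\<forall>x. G x \<in> carrier_mat nr nc" "i < nr" "j < nc"
  then have "(F x + G x) $$ (i,j) = F x $$ (i,j) + G x $$ (i,j)" for x by (metis carrier_matD index_add_mat(1))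
  moreover assume "\<forall>i<nr. \<forall>j<nc. tame I (\<lambda>x. F x $$ (i,j))" "\<forall>i<nr. \<forall>j<nc. tame I (\<lambda>x. G x $$ (i,j))"
  ultimately show "tame I (\<lambda>x. (F x + G x) $$ (i,j))" using \<open>i < nr\<close> \<open>j < nc\<close> by (simp add: tame_add)
qed auto

lemma mat_tame_transpose: "mat_tame I nr nc F \<Longrightarrow> mat_tame I nc nr (\<lambda>x. (F x)\<^sup>T)"
proof -
  assume F: "mat_tame I nr nc F"
  then have "(F x)\<^sup>T $$ (i,j) = F x $$ (j,i)" if "i < nc" "j < nr" for i j x
    using that by (simp add: mat_tame_def) (metis carrier_matD index_transpose_mat(1))
  then show ?thesis using F by (simp add: mat_tame_def)
qed

lemma mat_tame_mult:
  assumes F: "mat_tame I nr n F" and G: "mat_tame I n nc G"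
  shows "mat_tame I nr nc (\<lambda>x. F x * G x)"
proof -
  have c: "F x \<in> carrier_mat nr n" "G x \<in> carrier_mat n nc" for x using F G by (auto simp: mat_tame_def)
  have "tame I (\<lambda>x. (F x * G x) $$ (i,j))" if "i < nr" "j < nc" for i j
  proof -
    have "tame I (\<lambda>x. \<Sum>k<n. F x $$ (i,k) * G x $$ (k,j))"
      using F G that by (intro tame_sum tame_mult) (auto simp: mat_tame_def)
    moreover have "(F x * G x) $$ (i,j) = (\<Sum>k<n. F x $$ (i,k) * G x $$ (k,j))" for x
      using c[of x] that by (subst mat_mult_index) auto
    ultimately show ?thesis by simp
  qed
  then show ?thesis using mult_carrier_mat[OF c] by (simp add: mat_tame_def)
qed

lemma mat_tame_pow:
  assumes F: "mat_tame I n n F"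
  shows "mat_tame I n n (\<lambda>x. F x ^\<^sub>m k)"
proof (induction k)
  case 0
  have "dim_row (F x) = n" for x using F by (auto simp: mat_tame_def)
  then show ?case by (simp add: mat_tame_const)
next
  case (Suc k)
  then show ?case by (simp add: mat_tame_mult[OF _ F])
qed

lemma mat_tame_index: "mat_tame I nr nc F \<Longrightarrow> i < nr \<Longrightarrow> j < nc \<Longrightarrow> tame I (\<lambda>x. F x $$ (i,j))"
  by (simp add: mat_tame_def)

lemma mat_tame_trace:
  assumes "mat_tame I n n F"
  shows "tame I (\<lambda>x. mat_trace (F x))"
proof -
  have "dim_row (F x) = n" for x using assms by (auto simp: mat_tame_def)
  then show ?thesis unfolding mat_trace_def using assms by (auto intro!: tame_sum simp: mat_tame_def)
qed

lemma mat_deriv_mult_const_left: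
  assumes A: "A \<in> carrier_mat nr n" and F: "mat_deriv n nc F F' t"
  shows "mat_deriv nr nc (\<lambda>s. A * F s) (A * F') t"
proof -
  have c: "F t \<in> carrier_mat n nc" "F' \<in> carrier_mat n nc" using F unfolding mat_deriv_def by blast+
  have "0\<^sub>m nr n * F t + A * F' = A * F'" using A c by simp
  then show ?thesis using mat_deriv_mult[OF mat_deriv_const[OF A] F] by (simp only:)
qed

lemma mat_deriv_mult_const_right:
  assumes A: "A \<in> carrier_mat n nc" and F: "mat_deriv nr n F F' t"
  shows "mat_deriv nr nc (\<lambda>s. F s * A) (F' * A) t"
proof -
  have c: "F t \<in> carrier_mat nr n" "F' \<in> carrier_mat nr n" using F unfolding mat_deriv_def by blast+
  have "F' * A + F t * 0\<^sub>m n nc = F' * A" using A c by simp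
  then show ?thesis using mat_deriv_mult[OF F mat_deriv_const[OF A]] by (simp only:)
qed

lemma mat_deriv_add_const:
  assumes A: "A \<in> carrier_mat nr nc" and F: "mat_deriv nr nc F F' t"
  shows "mat_deriv nr nc (\<lambda>s. F s + A) F' t"
proof -
  have c: "F' \<in> carrier_mat nr nc" using F unfolding mat_deriv_def by blast
  have "F' + 0\<^sub>m nr nc = F'" using c by simp
  then show ?thesis using mat_deriv_add[OF F mat_deriv_const[OF A]] by (simp only:)
qed

lemma spectral_index:
  fixes V :: "real mat"
  assumes V: "V \<in> carrier_mat n n" and ij: "i < n" "j < n"
  shows "(V * mat_diag n d * V\<^sup>T) $$ (i,j) = (\<Sum>a<n. V $$ (i,a) * V $$ (j,a) * d a)"
proof -
  have "(V * mat_diag n d * V\<^sup>T) $$ (i,j) = (\<Sum>a<n. (V * mat_diag n d) $$ (i,a) * V $$ (j,a))"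
    using V ij by (subst mat_mult_index) auto
  also have "\<dots> = (\<Sum>a<n. V $$ (i,a) * V $$ (j,a) * d a)"
    by (intro sum.cong) (auto simp: mat_diag_mult_right[OF V] ij mult_ac)
  finally show ?thesis .
qed

lemma spectral_mult:
  assumes V: "orthogonal_matrix n V"
  shows "(V * mat_diag n a * V\<^sup>T) * (V * mat_diag n b * V\<^sup>T) = V * mat_diag n (\<lambda>i. a i * b i) * V\<^sup>T"
proof -
  have Vc: "V \<in> carrier_mat n n" "V\<^sup>T * V = 1\<^sub>m n" using V by (auto simp: orthogonal_matrix_def)
  show ?thesis unfolding mat_diag_diag[symmetric] using Vc(1)
    by (simp add: mat_mult_assoc mat_mult_cancel[OF Vc(2)] del: mat_diag_diag)
qed

lemma spectral_one:
  assumes V: "orthogonal_matrix n V"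
  shows "V * mat_diag n (\<lambda>_. 1) * V\<^sup>T = 1\<^sub>m n"
proof -
  have Vc: "V \<in> carrier_mat n n" "V * V\<^sup>T = 1\<^sub>m n" using V by (auto simp: orthogonal_matrix_def)
  then show ?thesis by (simp add: mat_one_mult)
qed

lemma spectral_pow:
  assumes V: "orthogonal_matrix n V"
  shows "(V * mat_diag n a * V\<^sup>T) ^\<^sub>m k = V * mat_diag n (\<lambda>i. a i ^ k) * V\<^sup>T"
proof (induction k)
  case 0
  have "dim_row V = n" using V by (auto simp: orthogonal_matrix_def)
  then show ?case using spectral_one[OF V] by (simp del: mat_diag_one)
next
  case (Suc k)
  then show ?case by (simp add: spectral_mult[OF V] mult.commute)
qed

lemma orthogonal_matrix_entry_le:
  assumes V: "orthogonal_matrix n V" and ij: "i < n" "j < n"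
  shows "\<bar>V $$ (i,j)\<bar> \<le> 1"
proof -
  have Vc: "V \<in> carrier_mat n n" "V * V\<^sup>T = 1\<^sub>m n" using V by (auto simp: orthogonal_matrix_def)
  have "(V $$ (i,j))\<^sup>2 \<le> (\<Sum>k<n. (V $$ (i,k))\<^sup>2)" by (rule member_le_sum) (use ij in auto)
  also have "\<dots> = (V * V\<^sup>T) $$ (i,i)" using Vc(1) ij by (subst mat_mult_index) (auto simp: power2_eq_square)
  also have "\<dots> = 1" using Vc(2) ij by simp
  finally show ?thesis by (simp add: abs_square_le_1)
qed

lemma spectral_entry_le:
  assumes V: "orthogonal_matrix n V" and ij: "i < n" "j < n" and d: "\<And>a. a < n \<Longrightarrow> \<bar>d a\<bar> \<le> B"
  shows "\<bar>(V * mat_diag n d * V\<^sup>T) $$ (i,j)\<bar> \<le> real n * B"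
proof -
  have Vc: "V \<in> carrier_mat n n" using V by (auto simp: orthogonal_matrix_def)
  have "\<bar>(V * mat_diag n d * V\<^sup>T) $$ (i,j)\<bar> \<le> (\<Sum>a<n. \<bar>V $$ (i,a) * V $$ (j,a) * d a\<bar>)"
    unfolding spectral_index[OF Vc ij] by (rule sum_abs)
  also have "\<dots> \<le> (\<Sum>a<n. B)"
  proof (rule sum_mono)
    fix a assume "a \<in> {..<n}"
    then have "\<bar>V $$ (i,a)\<bar> * \<bar>V $$ (j,a)\<bar> * \<bar>d a\<bar> \<le> 1 * 1 * B"
      using ij d by (intro mult_mono orthogonal_matrix_entry_le[OF V]) auto
    then show "\<bar>V $$ (i,a) * V $$ (j,a) * d a\<bar> \<le> B" by (simp add: abs_mult)
  qed
  finally show ?thesis by simp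
qed

lemma spectral_symmetric:
  fixes V :: "real mat"
  assumes V: "V \<in> carrier_mat n n"
  shows "(V * mat_diag n d * V\<^sup>T)\<^sup>T = V * mat_diag n d * V\<^sup>T"
  using carrier_matD[OF V] by (simp add: mat_transpose_mult mat_mult_assoc)

lemma inv_mat_measurable:
  assumes F: "mat_measurable M n n F" and ij: "i < n" "j < n"
  shows "(\<lambda>x. inv_mat (F x) $$ (i,j)) \<in> borel_measurable M"
proof -
  have c: "F x \<in> carrier_mat n n" if "x \<in> space M" for x using F that by (simp add: mat_measurable_def)
  have "mat_measurable M (n - 1) (n - 1) (\<lambda>x. mat_delete (F x) j i)"
    unfolding mat_measurable_def
  proof (intro conjI ballI allI impI)
    fix x assume "x \<in> space M"
    from carrier_matD[OF c[OF this]] show "mat_delete (F x) j i \<in> carrier_mat (n - 1) (n - 1)" by (simp add: mat_delete_def)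
  next
    fix a b assume ab: "a < n - 1" "b < n - 1"
    have "(\<lambda>x. F x $$ (if a < j then a else Suc a, if b < i then b else Suc b)) \<in> borel_measurable M"
      using F ab by (auto simp: mat_measurable_def)
    then show "(\<lambda>x. mat_delete (F x) j i $$ (a,b)) \<in> borel_measurable M"
    proof (rule measurable_cong[THEN iffD2, rotated])
      fix x assume "x \<in> space M"
      from carrier_matD[OF c[OF this]]
      show "mat_delete (F x) j i $$ (a,b) = F x $$ (if a < j then a else Suc a, if b < i then b else Suc b)"
        using ab by (simp add: mat_delete_def)
    qed
  qed
  from measurable_det[OF this] measurable_det[OF F]
  have "(\<lambda>x. (1 / Determinant.det (F x)) * ((- 1) ^ (j + i) * Determinant.det (mat_delete (F x) j i))) \<in> borel_measurable M"
    by measurable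
  then show ?thesis
  proof (rule measurable_cong[THEN iffD2, rotated])
    fix x assume "x \<in> space M"
    from carrier_matD[OF c[OF this]]
    show "inv_mat (F x) $$ (i,j) = (1 / Determinant.det (F x)) * ((- 1) ^ (j + i) * Determinant.det (mat_delete (F x) j i))"
      using ij by (simp add: inv_mat_def adj_mat_def cofactor_def)
  qed
qed

lemma mat_tame_measurable: "mat_tame I nr nc F \<Longrightarrow> mat_measurable (gauss_vector I) nr nc F"
  unfolding mat_tame_def mat_measurable_def using tame_measurable by blast

lemma mat_mult_sum_middle:
  fixes U M W :: "real mat"
  assumes U: "U \<in> carrier_mat nr n" and W: "W \<in> carrier_mat n nc" and M: "M \<in> carrier_mat n n"
    and Ms: "\<And>s. s \<in> S \<Longrightarrow> Ms s \<in> carrier_mat n n"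
    and eq: "\<And>i j. i < n \<Longrightarrow> j < n \<Longrightarrow> M $$ (i,j) = (\<Sum>s\<in>S. w s * Ms s $$ (i,j))"
    and ij: "i < nr" "j < nc"
  shows "(U * M * W) $$ (i,j) = (\<Sum>s\<in>S. w s * (U * Ms s * W) $$ (i,j))"
proof -
  have expand: "(U * X * W) $$ (i,j) = (\<Sum>b<n. \<Sum>a<n. U $$ (i,a) * X $$ (a,b) * W $$ (b,j))"
    if X: "X \<in> carrier_mat n n" for X
  proof -
    have "(U * X * W) $$ (i,j) = (\<Sum>b<n. (U * X) $$ (i,b) * W $$ (b,j))"
      using U X W ij by (subst mat_mult_index) auto
    also have "\<dots> = (\<Sum>b<n. (\<Sum>a<n. U $$ (i,a) * X $$ (a,b)) * W $$ (b,j))"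
      using U X W ij by (intro sum.cong refl arg_cong2[where f = "(*)"], subst mat_mult_index) auto
    finally show ?thesis by (simp add: sum_distrib_right)
  qed
  have "(U * M * W) $$ (i,j) = (\<Sum>b<n. \<Sum>a<n. \<Sum>s\<in>S. w s * (U $$ (i,a) * Ms s $$ (a,b) * W $$ (b,j)))"
    unfolding expand[OF M]
    by (intro sum.cong refl) (simp add: eq sum_distrib_left sum_distrib_right mult_ac)
  also have "\<dots> = (\<Sum>b<n. \<Sum>s\<in>S. \<Sum>a<n. w s * (U $$ (i,a) * Ms s $$ (a,b) * W $$ (b,j)))"
    by (intro sum.cong refl) (rule sum.swap)
  also have "\<dots> = (\<Sum>s\<in>S. \<Sum>b<n. \<Sum>a<n. w s * (U $$ (i,a) * Ms s $$ (a,b) * W $$ (b,j)))"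
    by (rule sum.swap)
  also have "\<dots> = (\<Sum>s\<in>S. w s * (U * Ms s * W) $$ (i,j))"
    using expand[OF Ms] by (intro sum.cong refl) (simp add: sum_distrib_left)
  finally show ?thesis .
qed

section \<open>Divergence of the shrinkage field\<close>

text \<open>Both orderings of \<open>n\<close> and \<open>r\<close> are covered by an \<open>m \<times> q\<close> Gaussian matrix, \<open>Z\<close> or its transpose:
  \<open>(K, C, D) = (B\<^sup>T * B, 1, 1)\<close> if \<open>n \<le> r\<close>, and \<open>(K, C, D) = (1, L\<^sup>T, L\<^sup>-\<^sup>T)\<close> with \<open>L\<^sup>T * L = B\<^sup>T * B\<close>
  if \<open>r < n\<close>. Then \<open>Gam\<close> has the positive eigenvalues of \<open>S\<close>.\<close>

locale haff_field = weight_poly P for P +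
  fixes m q :: nat and K J C D :: "real mat" and eps :: real
  assumes q: "0 < q" and J: "J \<in> carrier_mat m m" and K_gram: "K = J\<^sup>T * J"
    and C: "C \<in> carrier_mat q q" and D: "D \<in> carrier_mat q q" and CD: "C * D = 1\<^sub>m q" and DC: "D * C = 1\<^sub>m q"
    and eps: "0 < eps"
begin

definition "Z x = Matrix.mat m q x"
definition "Gam x = C\<^sup>T * ((Z x)\<^sup>T * (K * (Z x * C)))"
definition "A x = Gam x + eps \<cdot>\<^sub>m 1\<^sub>m q"
definition "R x = inv_mat (A x)"
definition "phiR x = Matrix.mat q q (\<lambda>ij. \<Sum>k\<le>degree phi. coeff phi k * (R x ^\<^sub>m k) $$ ij)"
definition "T x = mat_trace (phiR x)"
text \<open>\<open>N\<close> divided by \<open>T\<close> is the vector field to which Stein's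
  identity is applied. Its pairing with the Gaussian entries is the weighted trace of
  \<open>quad_eq_trace\<close>.\<close>

definition "N x = Z x * C * phiR x * D"
definition "dGam x E = C\<^sup>T * (E\<^sup>T * (K * (Z x * C)) + (Z x)\<^sup>T * (K * (E * C)))"
text \<open>A monomial of \<open>phi\<close> together with the position of the factor that the
  product rule differentiates in it.\<close>

definition "terms = (SIGMA k:{..degree phi}. {..<k})"
definition "dphi x E = Matrix.mat q q (\<lambda>ij. \<Sum>(k,l)\<in>terms. - coeff phi k * (R x ^\<^sub>m Suc l * dGam x E * R x ^\<^sub>m (k - l)) $$ ij)"
definition "dN x E = E * C * phiR x * D + Z x * C * dphi x E * D"

abbreviation "E a j \<equiv> unit_mat m q a j"

lemma Z [simp]: "Z x \<in> carrier_mat m q" by (simp add: Z_def)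
lemma K: "K \<in> carrier_mat m m" using J by (simp add: K_gram)
lemma K_sym: "K\<^sup>T = K" using J by (simp add: K_gram mat_transpose_mult)

lemma Z_dims [simp]: "dim_row (Z x) = m" "dim_col (Z x) = q" by (simp_all add: Z_def)

lemma const_dims [simp]: "dim_row K = m" "dim_col K = m" "dim_row C = q" "dim_col C = q" "dim_row D = q" "dim_col D = q"
  "dim_row J = m" "dim_col J = m"
  using K C D J by auto

lemma Gam_dims [simp]: "dim_row (Gam x) = q" "dim_col (Gam x) = q" by (simp_all add: Gam_def)
lemma A_carrier: "A x \<in> carrier_mat q q" by (auto simp: A_def)
lemma phiR_carrier: "phiR x \<in> carrier_mat q q" by (simp add: phiR_def)
lemma phiR_dims [simp]: "dim_row (phiR x) = q" "dim_col (phiR x) = q" by (simp_all add: phiR_def)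

lemma Gam_gram: "Gam x = (J * Z x * C)\<^sup>T * (J * Z x * C)"
  unfolding Gam_def unfolding K_gram by (simp add: mat_transpose_mult mat_mult_assoc)

lemma spectral:
  obtains V l where "orthogonal_matrix q V" "Gam x = V * mat_diag q l * V\<^sup>T" "\<And>i. i < q \<Longrightarrow> 0 \<le> l i"
proof -
  have "J * Z x * C \<in> carrier_mat m q" by (auto intro!: carrier_matI)
  from gram_spectral_decomposition[OF this] show thesis
    using that unfolding Gam_gram by blast
qed

lemma spectral_R_aux:
  assumes V: "orthogonal_matrix q V" and G: "Gam x = V * mat_diag q l * V\<^sup>T" and l: "\<And>i. i < q \<Longrightarrow> 0 \<le> l i"
  shows "Determinant.det (A x) \<noteq> 0" "R x = V * mat_diag q (\<lambda>i. 1 / (l i + eps)) * V\<^sup>T"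
proof -
  have Vc: "V \<in> carrier_mat q q" "V * V\<^sup>T = 1\<^sub>m q" using V by (auto simp: orthogonal_matrix_def)
  have "A x = V * mat_diag q (\<lambda>i. l i + eps) * V\<^sup>T"
  proof (rule eq_matI)
    fix i j assume "i < dim_row (V * mat_diag q (\<lambda>i. l i + eps) * V\<^sup>T)" "j < dim_col (V * mat_diag q (\<lambda>i. l i + eps) * V\<^sup>T)"
    then have ij: "i < q" "j < q" using Vc by auto
    have "(\<Sum>a<q. V $$ (i,a) * V $$ (j,a) * eps) = eps * (1\<^sub>m q :: real mat) $$ (i,j)"
    proof -
      have "(\<Sum>a<q. V $$ (i,a) * V $$ (j,a)) = (V * V\<^sup>T) $$ (i,j)"
        using Vc(1) ij by (subst mat_mult_index) auto
      then show ?thesis using Vc(2) by (simp add: sum_distrib_right[symmetric])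
    qed
    then show "A x $$ (i,j) = (V * mat_diag q (\<lambda>i. l i + eps) * V\<^sup>T) $$ (i,j)"
      using ij Gam_dims[of x] unfolding A_def spectral_index[OF Vc(1) ij]
      by (simp add: G spectral_index[OF Vc(1) ij] sum.distrib distrib_left del: index_mult_mat(1))
  qed (use Vc A_carrier[of x] in auto)
  note A = this
  have pos: "0 < l i + eps" if "i < q" for i using l[OF that] eps by simp
  have "0 < (\<Prod>i<q. l i + eps)" using pos by (intro prod_pos) auto
  then show det: "Determinant.det (A x) \<noteq> 0" unfolding A spectral_det[OF V] by linarith
  have "mat_diag q (\<lambda>i. 1 / (l i + eps) * (l i + eps)) = mat_diag q (\<lambda>_. 1)"
    using pos by (intro mat_diag_cong) (auto simp: less_imp_neq[symmetric])
  then have "(V * mat_diag q (\<lambda>i. 1 / (l i + eps)) * V\<^sup>T) * A x = 1\<^sub>m q"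
    unfolding A spectral_mult[OF V] using spectral_one[OF V] by simp
  then show "R x = V * mat_diag q (\<lambda>i. 1 / (l i + eps)) * V\<^sup>T"
    unfolding R_def by (intro inv_mat_unique[OF A_carrier det]) (use Vc in auto)
qed

text \<open>A relation and not a function, since eigenvectors are not unique. Pointwise identities
  pick any eigenbasis, while the passage to the limit inserts the one supplied from outside, the
  same for every regularisation.\<close>

definition spec :: "(nat \<times> nat \<Rightarrow> real) \<Rightarrow> real mat \<Rightarrow> (nat \<Rightarrow> real) \<Rightarrow> (nat \<Rightarrow> real) \<Rightarrow> bool" where
  "spec x V l y \<longleftrightarrow> orthogonal_matrix q V \<and> Gam x = V * mat_diag q l * V\<^sup>T \<and> (\<forall>i<q. 0 \<le> l i) \<and> y = (\<lambda>i. 1 / (l i + eps))"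

lemma specD:
  assumes "spec x V l y"
  shows "orthogonal_matrix q V" "V \<in> carrier_mat q q" "Gam x = V * mat_diag q l * V\<^sup>T" "\<And>i. i < q \<Longrightarrow> 0 \<le> l i"
    "\<And>i. i < q \<Longrightarrow> 0 < y i" "\<And>i. y i = 1 / (l i + eps)" "R x = V * mat_diag q y * V\<^sup>T"
    "\<And>k. R x ^\<^sub>m k = V * mat_diag q (\<lambda>i. y i ^ k) * V\<^sup>T"
    "phiR x = V * mat_diag q (\<lambda>i. poly phi (y i)) * V\<^sup>T"
proof -
  have V: "orthogonal_matrix q V" and G: "Gam x = V * mat_diag q l * V\<^sup>T" and l: "\<And>i. i < q \<Longrightarrow> 0 \<le> l i"
    and y_def: "y = (\<lambda>i. 1 / (l i + eps))" using assms by (auto simp: spec_def)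
  have Vc: "V \<in> carrier_mat q q" using V by (auto simp: orthogonal_matrix_def)
  have R: "R x = V * mat_diag q y * V\<^sup>T"
    using spectral_R_aux(2)[OF V G l] by (simp add: y_def)
  have Rk: "R x ^\<^sub>m k = V * mat_diag q (\<lambda>i. y i ^ k) * V\<^sup>T" for k unfolding R by (rule spectral_pow[OF V])
  have "phiR x = V * mat_diag q (\<lambda>i. poly phi (y i)) * V\<^sup>T"
  proof (rule eq_matI)
    fix i j assume "i < dim_row (V * mat_diag q (\<lambda>i. poly phi (y i)) * V\<^sup>T)" "j < dim_col (V * mat_diag q (\<lambda>i. poly phi (y i)) * V\<^sup>T)"
    then have ij: "i < q" "j < q" using Vc by auto
    have "phiR x $$ (i,j) = (\<Sum>k\<le>degree phi. coeff phi k * (\<Sum>a<q. V $$ (i,a) * V $$ (j,a) * y a ^ k))"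
      using ij by (simp add: phiR_def Rk spectral_index[OF Vc ij] del: index_mult_mat(1))
    also have "\<dots> = (\<Sum>k\<le>degree phi. \<Sum>a<q. V $$ (i,a) * V $$ (j,a) * (coeff phi k * y a ^ k))"
      by (simp add: sum_distrib_left mult_ac)
    also have "\<dots> = (\<Sum>a<q. \<Sum>k\<le>degree phi. V $$ (i,a) * V $$ (j,a) * (coeff phi k * y a ^ k))"
      by (rule sum.swap)
    also have "\<dots> = (\<Sum>a<q. V $$ (i,a) * V $$ (j,a) * poly phi (y a))"
      by (simp add: sum_distrib_left poly_altdef)
    finally show "phiR x $$ (i,j) = (V * mat_diag q (\<lambda>i. poly phi (y i)) * V\<^sup>T) $$ (i,j)"
      by (simp add: spectral_index[OF Vc ij] del: index_mult_mat(1))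
  qed (use Vc in auto)
  then show "phiR x = V * mat_diag q (\<lambda>i. poly phi (y i)) * V\<^sup>T" .
  show "orthogonal_matrix q V" "V \<in> carrier_mat q q" "Gam x = V * mat_diag q l * V\<^sup>T" "R x = V * mat_diag q y * V\<^sup>T"
    by fact+
  show "0 \<le> l i" if "i < q" for i using l[OF that] .
  show "0 < y i" if "i < q" for i using l[OF that] eps by (simp add: y_def)
  show "y i = 1 / (l i + eps)" for i by (simp add: y_def)
  show "R x ^\<^sub>m k = V * mat_diag q (\<lambda>i. y i ^ k) * V\<^sup>T" for k by (rule Rk)
qed

lemma spec_exists: obtains V l y where "spec x V l y"
proof -
  obtain V l where "orthogonal_matrix q V" "Gam x = V * mat_diag q l * V\<^sup>T" "\<And>i. i < q \<Longrightarrow> 0 \<le> l i"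
    using spectral[of x] by blast
  then have "spec x V l (\<lambda>i. 1 / (l i + eps))" by (simp add: spec_def)
  then show thesis by (rule that)
qed

lemma A_det: "Determinant.det (A x) \<noteq> 0"
  using spectral[of x] spectral_R_aux(1)[of _ x] by metis

lemma R_carrier: "R x \<in> carrier_mat q q"
  unfolding R_def by (rule inv_mat(1)[OF A_carrier A_det])

lemma R_dims [simp]: "dim_row (R x) = q" "dim_col (R x) = q" "dim_row (R x ^\<^sub>m k) = q" "dim_col (R x ^\<^sub>m k) = q"
  using R_carrier[of x] pow_carrier_mat[OF R_carrier[of x], of k] by auto

lemma Rk_sym: "(R x ^\<^sub>m k)\<^sup>T = R x ^\<^sub>m k"
proof -
  obtain V l y where S: "spec x V l y" by (rule spec_exists[of x])
  show ?thesis unfolding specD(8)[OF S] by (rule spectral_symmetric[OF specD(2)[OF S]])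
qed

lemma phiR_sym: "(phiR x)\<^sup>T = phiR x"
proof -
  obtain V l y where S: "spec x V l y" by (rule spec_exists[of x])
  show ?thesis unfolding specD(9)[OF S] by (rule spectral_symmetric[OF specD(2)[OF S]])
qed

text \<open>One eigenvalue is enough: \<open>l 0\<close> is at most the trace of \<open>Gam\<close>,
  so \<open>y 0\<close> is at least 1 / (trace + eps), and phi (y 0) \<ge> y 0 * P 0. The reciprocal
  of \<open>T\<close> therefore grows at most like the trace, which keeps N / T of polynomial
  growth.\<close>

lemma T_pos: "0 < T x" and T_ge: "poly P 0 / (mat_trace (Gam x) + eps) \<le> T x" and tr_Gam_nonneg: "0 \<le> mat_trace (Gam x)"
proof -
  obtain V l y where S: "spec x V l y" by (rule spec_exists[of x])
  note V = specD(1-4)[OF S] and y = specD(5,6)[OF S] and phi = specD(9)[OF S]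
  have T: "T x = (\<Sum>i<q. poly phi (y i))" unfolding T_def phi by (rule mat_trace_spectral[OF V(1)])
  have G: "mat_trace (Gam x) = (\<Sum>i<q. l i)" unfolding V(3) by (rule mat_trace_spectral[OF V(1)])
  show "0 < T x" unfolding T using q y(1) phi_pos by (intro sum_pos) auto
  show "0 \<le> mat_trace (Gam x)" unfolding G using V(4) by (intro sum_nonneg) auto
  have "l 0 \<le> mat_trace (Gam x)" unfolding G using V(4) q by (intro member_le_sum) auto
  then have "poly P 0 / (mat_trace (Gam x) + eps) \<le> poly P 0 / (l 0 + eps)"
    using V(4)[OF q] eps pos_at_0 by (intro divide_left_mono) (auto intro!: mult_pos_pos)
  also have "\<dots> = y 0 * poly P 0" using y(2)[of 0] by simp
  also have "\<dots> \<le> y 0 * poly P (y 0)" using y(1)[OF q] P_mono[of 0 "y 0"] by (intro mult_left_mono) auto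
  also have "\<dots> = poly phi (y 0)" by (simp add: poly_phi)
  also have "\<dots> \<le> T x" unfolding T using q y(1) phi_pos by (intro member_le_sum) (auto intro: less_imp_le)
  finally show "poly P 0 / (mat_trace (Gam x) + eps) \<le> T x" .
qed

lemma dGam_carrier: "X \<in> carrier_mat m q \<Longrightarrow> dGam x X \<in> carrier_mat q q"
  by (auto simp: dGam_def intro!: carrier_matI)

lemma dphi_carrier [simp]: "dphi x X \<in> carrier_mat q q" "dim_row (dphi x X) = q" "dim_col (dphi x X) = q"
  by (simp_all add: dphi_def)

context
  fixes x :: "nat \<times> nat \<Rightarrow> real" and a j :: nat and t :: real
  assumes aj: "a < m" "j < q"
begin

lemma Z_deriv: "mat_deriv m q (\<lambda>s. Z (x((a,j) := s))) (E a j) t"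
  unfolding mat_deriv_def
proof (intro conjI allI impI)
  fix b c assume "b < m" "c < q"
  then show "((\<lambda>s. Z (x((a,j) := s)) $$ (b,c)) has_real_derivative E a j $$ (b,c)) (at t)"
    by (auto simp: Z_def unit_mat_def)
qed auto

lemma Gam_deriv: "mat_deriv q q (\<lambda>s. Gam (x((a,j) := s))) (dGam (x((a,j) := t)) (E a j)) t"
  unfolding Gam_def dGam_def
  by (intro mat_deriv_mult_const_left[OF transpose_carrier_mat[THEN iffD2, OF C]] mat_deriv_add mat_deriv_mult[where n = m] mat_deriv_transpose
      mat_deriv_mult_const_left[OF K] mat_deriv_mult_const_right[OF C] Z_deriv)

lemma R_deriv: "mat_deriv q q (\<lambda>s. R (x((a,j) := s)))
    (- (R (x((a,j) := t)) * dGam (x((a,j) := t)) (E a j) * R (x((a,j) := t)))) t"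
  unfolding R_def A_def
  by (rule mat_deriv_inverse[OF mat_deriv_add_const[OF _ Gam_deriv]]) (use A_det in \<open>auto simp: A_def\<close>)

lemma phiR_deriv: "mat_deriv q q (\<lambda>s. phiR (x((a,j) := s))) (dphi (x((a,j) := t)) (E a j)) t"
  unfolding mat_deriv_def
proof (intro conjI allI impI)
  fix b c assume bc: "b < q" "c < q"
  let ?x = "x((a,j) := t)"
  let ?M = "\<lambda>k l. (R ?x ^\<^sub>m Suc l * dGam ?x (E a j) * R ?x ^\<^sub>m (k - l)) $$ (b,c)"
  have "((\<lambda>s. \<Sum>k\<le>degree phi. coeff phi k * (R (x((a,j) := s)) ^\<^sub>m k) $$ (b,c)) has_real_derivative
      (\<Sum>k\<le>degree phi. coeff phi k * (- (\<Sum>l<k. ?M k l)))) (at t)"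
    by (intro DERIV_sum DERIV_cmult pow_mat_deriv_inverse[of q "\<lambda>s. R (x((a,j) := s))" t, OF R_deriv dGam_carrier bc]) simp
  moreover have "(\<Sum>k\<le>degree phi. coeff phi k * (- (\<Sum>l<k. ?M k l))) = (\<Sum>(k,l)\<in>terms. - coeff phi k * ?M k l)"
    unfolding terms_def by (subst sum.Sigma[symmetric]) (auto simp: sum_distrib_left sum_negf)
  ultimately show "((\<lambda>s. phiR (x((a,j) := s)) $$ (b,c)) has_real_derivative dphi ?x (E a j) $$ (b,c)) (at t)"
    using bc by (simp add: phiR_def dphi_def)
qed (auto simp: phiR_carrier)

lemma T_deriv: "((\<lambda>s. T (x((a,j) := s))) has_real_derivative mat_trace (dphi (x((a,j) := t)) (E a j))) (at t)"
  unfolding T_def mat_trace_def using phiR_deriv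
  by (auto simp: mat_deriv_def intro!: DERIV_sum)

lemma N_deriv: "mat_deriv m q (\<lambda>s. N (x((a,j) := s))) (dN (x((a,j) := t)) (E a j)) t"
  unfolding N_def dN_def
proof -
  let ?x = "x((a,j) := t)"
  have 1: "mat_deriv m q (\<lambda>s. Z (x((a,j) := s)) * C * phiR (x((a,j) := s)) * D)
      ((E a j * C * phiR ?x + Z ?x * C * dphi ?x (E a j)) * D) t"
    by (intro mat_deriv_mult_const_right[OF D] mat_deriv_mult[where n = q] mat_deriv_mult_const_right[OF C] Z_deriv phiR_deriv)
  have "(E a j * C * phiR ?x + Z ?x * C * dphi ?x (E a j)) * D = E a j * C * phiR ?x * D + Z ?x * C * dphi ?x (E a j) * D"
    by (rule add_mult_distrib_mat[of _ m q _ _ q]) (use D in \<open>auto intro!: carrier_matI\<close>)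
  with 1 show "mat_deriv m q (\<lambda>s. Z (x((a,j) := s)) * C * phiR (x((a,j) := s)) * D)
      (E a j * C * phiR ?x * D + Z ?x * C * dphi ?x (E a j) * D) t" by (simp only:)
qed

end

end

text \<open>The derivative of \<open>Gam\<close> has one term with the transposed direction and one
  with the direction itself. Summed over all coordinate directions, the first contracts to the trace
  of a product and the second splits into a product of two traces; the latter is the source of the
  double sum over eigenvalues.\<close>

lemma (in haff_field) dGam_sandwich_trace:
  assumes U: "U \<in> carrier_mat q q" and W: "W \<in> carrier_mat q q" and U_sym: "U\<^sup>T = U"
  shows "(\<Sum>a<m. \<Sum>j<q. (Z x * C * (U * dGam x (E a j) * W) * D) $$ (a,j))
     = mat_trace (U * Gam x * W) + mat_trace (U * Gam x) * mat_trace W"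
proof -
  note dims = carrier_matD[OF U] carrier_matD[OF W]
  define P1 where "P1 = Z x * C * U * C\<^sup>T"
  define Q1 where "Q1 = K * Z x * C * W * D"
  define P2 where "P2 = Z x * C * U * C\<^sup>T * (Z x)\<^sup>T * K"
  define Q2 where "Q2 = C * W * D"
  have c: "P1 \<in> carrier_mat m q" "Q1 \<in> carrier_mat m q" "P2 \<in> carrier_mat m m" "Q2 \<in> carrier_mat q q"
    by (auto simp: P1_def Q1_def P2_def Q2_def dims intro!: carrier_matI)
  have eq: "Z x * C * (U * dGam x X * W) * D = P1 * X\<^sup>T * Q1 + P2 * X * Q2" if X: "X \<in> carrier_mat m q" for X
  proof -
    note Xd = carrier_matD[OF X]
    have "dGam x X * (W * D) = C\<^sup>T * (X\<^sup>T * (K * (Z x * (C * (W * D))))) + C\<^sup>T * ((Z x)\<^sup>T * (K * (X * (C * (W * D)))))"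
      (is "_ = C\<^sup>T * ?a + C\<^sup>T * ?b")
    proof -
      have "dGam x X * (W * D) = C\<^sup>T * ((X\<^sup>T * (K * (Z x * C)) + (Z x)\<^sup>T * (K * (X * C))) * (W * D))"
        unfolding dGam_def by (rule mat_mult_assoc) (auto simp: Xd dims)
      also have "(X\<^sup>T * (K * (Z x * C)) + (Z x)\<^sup>T * (K * (X * C))) * (W * D) = X\<^sup>T * (K * (Z x * C)) * (W * D) + (Z x)\<^sup>T * (K * (X * C)) * (W * D)"
        by (rule add_mult_distrib_mat[of _ q q _ _ q]) (auto simp: Xd dims intro!: carrier_matI)
      also have "\<dots> = ?a + ?b" by (simp add: mat_mult_assoc Xd dims)
      also have "C\<^sup>T * (?a + ?b) = C\<^sup>T * ?a + C\<^sup>T * ?b"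
        by (rule mult_add_distrib_mat[of _ q q _ q]) (auto simp: Xd dims intro!: carrier_matI)
      finally show ?thesis .
    qed
    then have "Z x * C * (U * dGam x X * W) * D = (Z x * C * U) * (C\<^sup>T * (X\<^sup>T * (K * (Z x * (C * (W * D))))) + C\<^sup>T * ((Z x)\<^sup>T * (K * (X * (C * (W * D))))))"
      using carrier_matD[OF dGam_carrier[OF X, of x]] by (simp add: mat_mult_assoc dims Xd)
    also have "\<dots> = (Z x * C * U) * (C\<^sup>T * (X\<^sup>T * (K * (Z x * (C * (W * D)))))) + (Z x * C * U) * (C\<^sup>T * ((Z x)\<^sup>T * (K * (X * (C * (W * D))))))"
      by (rule mult_add_distrib_mat[of _ m q _ q]) (auto simp: Xd dims intro!: carrier_matI)
    also have "\<dots> = P1 * X\<^sup>T * Q1 + P2 * X * Q2"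
      unfolding P1_def Q1_def P2_def Q2_def by (simp add: mat_mult_assoc dims Xd)
    finally show ?thesis .
  qed
  have entry: "(Z x * C * (U * dGam x (E a j) * W) * D) $$ (a,j) = P1 $$ (a,j) * Q1 $$ (a,j) + P2 $$ (a,a) * Q2 $$ (j,j)"
    if "a < m" "j < q" for a j
  proof -
    have "(P1 * (E a j)\<^sup>T * Q1) $$ (a,j) = P1 $$ (a,j) * Q1 $$ (a,j)"
      unfolding unit_mat_transpose by (rule unit_mat_sandwich[OF c(1,2)]) (use that in auto)
    moreover have "(P2 * E a j * Q2) $$ (a,j) = P2 $$ (a,a) * Q2 $$ (j,j)"
      by (rule unit_mat_sandwich[OF c(3,4)]) (use that in auto)
    ultimately show ?thesis unfolding eq[OF unit_mat_carrier(1)] using c that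
      by (simp add: unit_mat_transpose del: index_mult_mat(1))
  qed
  have "(\<Sum>a<m. \<Sum>j<q. (Z x * C * (U * dGam x (E a j) * W) * D) $$ (a,j))
     = (\<Sum>a<m. \<Sum>j<q. P1 $$ (a,j) * Q1 $$ (a,j)) + (\<Sum>a<m. \<Sum>j<q. P2 $$ (a,a) * Q2 $$ (j,j))"
    using entry by (simp add: sum.distrib del: index_mult_mat(1))
  also have "(\<Sum>a<m. \<Sum>j<q. P1 $$ (a,j) * Q1 $$ (a,j)) = mat_trace (P1\<^sup>T * Q1)"
    by (rule mat_trace_transpose_mult[OF c(1,2)])
  also have "P1\<^sup>T * Q1 = C * ((U * Gam x * W) * D)"
    unfolding P1_def Q1_def Gam_def by (simp add: mat_transpose_mult mat_mult_assoc dims U_sym)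
  also have "mat_trace \<dots> = mat_trace ((U * Gam x * W) * D * C)"
    by (rule mat_trace_commute) (auto simp: dims)
  also have "(U * Gam x * W) * D * C = U * Gam x * W"
    by (simp add: mat_mult_assoc dims DC mat_one_mult)
  also have "(\<Sum>a<m. \<Sum>j<q. P2 $$ (a,a) * Q2 $$ (j,j)) = mat_trace P2 * mat_trace Q2"
    unfolding mat_trace_def using carrier_matD[OF c(3)] carrier_matD[OF c(4)]
    by (simp add: sum_product)
  also have "mat_trace P2 = mat_trace (U * Gam x)"
  proof -
    have "P2 = (Z x * C) * (U * C\<^sup>T * (Z x)\<^sup>T * K)" unfolding P2_def by (simp add: mat_mult_assoc dims)
    then have "mat_trace P2 = mat_trace ((U * C\<^sup>T * (Z x)\<^sup>T * K) * (Z x * C))"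
      by (simp only:) (rule mat_trace_commute, auto simp: dims)
    also have "(U * C\<^sup>T * (Z x)\<^sup>T * K) * (Z x * C) = U * Gam x"
      unfolding Gam_def by (simp add: mat_mult_assoc dims)
    finally show ?thesis .
  qed
  also have "mat_trace Q2 = mat_trace W"
  proof -
    have "mat_trace (C * (W * D)) = mat_trace (W * D * C)"
      by (rule mat_trace_commute) (auto simp: dims)
    then show ?thesis unfolding Q2_def by (simp add: mat_mult_assoc dims DC mat_one_mult)
  qed
  finally show ?thesis .
qed

text \<open>Since K and W are symmetric, transposition and cyclicity give the two terms of the
  derivative of \<open>Gam\<close> the same trace; hence the factor 2.\<close>

lemma (in haff_field) dGam_trace:
  assumes W: "W \<in> carrier_mat q q" and W_sym: "W\<^sup>T = W" and aj: "a < m" "j < q"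
  shows "mat_trace (dGam x (E a j) * W) = 2 * (K * Z x * C * W * C\<^sup>T) $$ (a,j)"
proof -
  note dims = carrier_matD[OF W]
  define M where "M = K * Z x * C * W * C\<^sup>T"
  have M: "M \<in> carrier_mat m q" by (auto simp: M_def dims intro!: carrier_matI)
  define F1 where "F1 = C\<^sup>T * ((E a j)\<^sup>T * (K * (Z x * (C * W))))"
  define F2 where "F2 = C\<^sup>T * ((Z x)\<^sup>T * (K * (E a j * (C * W))))"
  have F: "F1 \<in> carrier_mat q q" "F2 \<in> carrier_mat q q" by (auto simp: F1_def F2_def dims intro!: carrier_matI)
  have eq: "dGam x (E a j) * W = F1 + F2"
  proof -
    have "dGam x (E a j) * W = C\<^sup>T * (((E a j)\<^sup>T * (K * (Z x * C)) + (Z x)\<^sup>T * (K * (E a j * C))) * W)"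
      unfolding dGam_def by (rule mat_mult_assoc) (auto simp: dims)
    also have "((E a j)\<^sup>T * (K * (Z x * C)) + (Z x)\<^sup>T * (K * (E a j * C))) * W = (E a j)\<^sup>T * (K * (Z x * C)) * W + (Z x)\<^sup>T * (K * (E a j * C)) * W"
      by (rule add_mult_distrib_mat[of _ q q _ _ q]) (auto simp: dims intro!: carrier_matI)
    also have "C\<^sup>T * \<dots> = C\<^sup>T * ((E a j)\<^sup>T * (K * (Z x * C)) * W) + C\<^sup>T * ((Z x)\<^sup>T * (K * (E a j * C)) * W)"
      by (rule mult_add_distrib_mat[of _ q q _ q]) (auto simp: dims intro!: carrier_matI)
    finally show ?thesis unfolding F1_def F2_def by (simp add: mat_mult_assoc dims)
  qed
  have "mat_trace F1 = mat_trace ((E a j)\<^sup>T * M)"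
  proof -
    have "mat_trace F1 = mat_trace (((E a j)\<^sup>T * (K * (Z x * (C * W)))) * C\<^sup>T)"
      unfolding F1_def by (rule mat_trace_commute) (auto simp: dims)
    then show ?thesis unfolding M_def by (simp add: mat_mult_assoc dims)
  qed
  also have "\<dots> = (\<Sum>b<m. \<Sum>c<q. E a j $$ (b,c) * M $$ (b,c))"
    by (rule mat_trace_transpose_mult[OF unit_mat_carrier(1) M, symmetric])
  also have "\<dots> = (\<Sum>b<m. if b = a then M $$ (a,j) else 0)"
  proof (intro sum.cong refl)
    fix b assume "b \<in> {..<m}"
    then have "(\<Sum>c<q. E a j $$ (b,c) * M $$ (b,c)) = (\<Sum>c<q. if c = j then (if b = a then M $$ (a,j) else 0) else 0)"
      by (intro sum.cong) (auto simp: unit_mat_def)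
    then show "(\<Sum>c<q. E a j $$ (b,c) * M $$ (b,c)) = (if b = a then M $$ (a,j) else 0)" using aj by simp
  qed
  also have "\<dots> = M $$ (a,j)" using aj by simp
  finally have t1: "mat_trace F1 = M $$ (a,j)" .
  have t2: "mat_trace F2 = mat_trace F1"
  proof -
    have "F2\<^sup>T = (W * C\<^sup>T) * ((E a j)\<^sup>T * (K * (Z x * C)))"
      unfolding F2_def by (simp add: mat_transpose_mult mat_mult_assoc dims K_sym W_sym)
    then have "mat_trace F2 = mat_trace ((W * C\<^sup>T) * ((E a j)\<^sup>T * (K * (Z x * C))))"
      using mat_trace_transpose[of F2] F by simp
    also have "\<dots> = mat_trace (W * (C\<^sup>T * ((E a j)\<^sup>T * (K * (Z x * C)))))" by (simp add: mat_mult_assoc dims)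
    also have "\<dots> = mat_trace (C\<^sup>T * ((E a j)\<^sup>T * (K * (Z x * C))) * W)"
      by (rule mat_trace_commute) (auto simp: dims)
    also have "\<dots> = mat_trace F1" unfolding F1_def by (simp add: mat_mult_assoc dims)
    finally show ?thesis .
  qed
  show ?thesis unfolding eq using mat_trace_add[of F1 F2] F t1 t2 by (simp add: M_def)
qed

context haff_field
begin

definition "divergence x = (\<Sum>a<m. \<Sum>j<q. dN x (E a j) $$ (a,j) / T x - N x $$ (a,j) * mat_trace (dphi x (E a j)) / (T x)\<^sup>2)"

text \<open>Under the trace the k terms of the product rule for the k-th power agree by cyclicity,
  which yields the factor k; the 2 is that of \<open>dGam_trace\<close>.\<close>

lemma mat_trace_dphi:
  assumes aj: "a < m" "j < q"
  shows "mat_trace (dphi x (E a j)) = - 2 * (\<Sum>k\<le>degree phi. coeff phi k * real k * (K * Z x * C * R x ^\<^sub>m Suc k * C\<^sup>T) $$ (a,j))"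
proof -
  let ?G = "dGam x (E a j)"
  have G: "dim_row ?G = q" "dim_col ?G = q" using dGam_carrier[OF unit_mat_carrier(1), of x a j] by auto
  have tr: "mat_trace (R x ^\<^sub>m Suc l * ?G * R x ^\<^sub>m (k - l)) = 2 * (K * Z x * C * R x ^\<^sub>m Suc k * C\<^sup>T) $$ (a,j)"
    if "l < k" for k l
  proof -
    have "mat_trace (R x ^\<^sub>m Suc l * ?G * R x ^\<^sub>m (k - l)) = mat_trace (?G * R x ^\<^sub>m (k - l) * R x ^\<^sub>m Suc l)"
      using mat_trace_commute[of "R x ^\<^sub>m Suc l" "?G * R x ^\<^sub>m (k - l)"] by (simp add: mat_mult_assoc G del: pow_mat.simps)
    also have "?G * R x ^\<^sub>m (k - l) * R x ^\<^sub>m Suc l = ?G * R x ^\<^sub>m Suc k"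
    proof -
      obtain V ll y where S: "spec x V ll y" by (rule spec_exists[of x])
      have "R x ^\<^sub>m (k - l) * R x ^\<^sub>m Suc l = R x ^\<^sub>m Suc k"
        unfolding specD(8)[OF S] spectral_mult[OF specD(1)[OF S]] power_add[symmetric] using that by simp
      then show ?thesis by (simp add: mat_mult_assoc G del: pow_mat.simps)
    qed
    also have "mat_trace \<dots> = 2 * (K * Z x * C * R x ^\<^sub>m Suc k * C\<^sup>T) $$ (a,j)"
      by (rule dGam_trace[OF pow_carrier_mat[OF R_carrier] Rk_sym aj])
    finally show ?thesis .
  qed
  have "mat_trace (dphi x (E a j)) = (\<Sum>i<q. \<Sum>(k,l)\<in>terms. - coeff phi k * (R x ^\<^sub>m Suc l * ?G * R x ^\<^sub>m (k - l)) $$ (i,i))"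
    unfolding mat_trace_def dphi_def by (simp del: index_mult_mat(1) pow_mat.simps)
  also have "\<dots> = (\<Sum>(k,l)\<in>terms. - coeff phi k * mat_trace (R x ^\<^sub>m Suc l * ?G * R x ^\<^sub>m (k - l)))"
    unfolding mat_trace_def by (subst sum.swap) (simp add: sum_distrib_left case_prod_unfold G del: index_mult_mat(1) pow_mat.simps)
  also have "\<dots> = (\<Sum>(k,l)\<in>terms. - coeff phi k * (2 * (K * Z x * C * R x ^\<^sub>m Suc k * C\<^sup>T) $$ (a,j)))"
    using tr by (intro sum.cong) (auto simp: terms_def simp del: index_mult_mat(1) pow_mat.simps)
  also have "\<dots> = (\<Sum>k\<le>degree phi. \<Sum>l<k. - coeff phi k * (2 * (K * Z x * C * R x ^\<^sub>m Suc k * C\<^sup>T) $$ (a,j)))"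
    unfolding terms_def by (subst sum.Sigma[symmetric]) auto
  finally show ?thesis by (simp add: sum_distrib_left mult_ac sum_negf del: index_mult_mat(1) pow_mat.simps)
qed

text \<open>In a common eigenbasis of \<open>Gam\<close> and \<open>R\<close> the sums of partial
  derivatives depend on eigenvalues only, and \<open>divergence_bound\<close> applies.
  \<open>S1\<close> comes from differentiating \<open>Z\<close>, \<open>S2\<close> from
  \<open>phiR\<close>, \<open>S3\<close> from the normaliser \<open>T\<close>.\<close>

lemma divergence_le: "divergence x \<le> real m - (real q - 1) * max 0 (1 - eps * mat_trace (R x))"
proof -
  obtain V l y where S: "spec x V l y" by (rule spec_exists[of x])
  note V = specD(1,2)[OF S] and G = specD(3)[OF S] and l = specD(4)[OF S] and y = specD(5)[OF S]
    and yl = specD(6)[OF S] and Rk = specD(8)[OF S] and ph = specD(9)[OF S]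
  \<comment> \<open>Eigenvalues of Gam R; the regularisation makes them 1 - eps * y a instead of
    1.\<close>
  define \<theta> where "\<theta> a = l a * y a" for a
  have \<theta>: "\<theta> a = 1 - eps * y a" if "a < q" for a
    using l[OF that] eps by (simp add: \<theta>_def yl field_simps)
  \<comment> \<open>A lower bound common to all \<theta> a, because every y a is at most the trace
    of \<open>R\<close>. Truncation at 0 keeps it nonnegative when eps times the trace exceeds
    1.\<close>
  define \<theta>0 where "\<theta>0 = max 0 (1 - eps * mat_trace (R x))"
  have trR: "mat_trace (R x) = (\<Sum>i<q. y i)" unfolding specD(7)[OF S] by (rule mat_trace_spectral[OF V(1)])
  have \<theta>0: "0 \<le> \<theta>0" "\<And>a. a < q \<Longrightarrow> \<theta>0 \<le> \<theta> a"
  proof -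
    fix a assume a: "a < q"
    have "y a \<le> (\<Sum>i<q. y i)" using a y by (intro member_le_sum) (auto intro: less_imp_le)
    then have "1 - eps * mat_trace (R x) \<le> \<theta> a" unfolding \<theta>[OF a] trR using eps by simp
    moreover have "0 \<le> \<theta> a" unfolding \<theta>_def using l[OF a] y[OF a] by simp
    ultimately show "\<theta>0 \<le> \<theta> a" by (simp add: \<theta>0_def)
  qed (simp add: \<theta>0_def)
  have T: "T x = (\<Sum>i<q. poly phi (y i))" unfolding T_def ph by (rule mat_trace_spectral[OF V(1)])
  have X: "C * phiR x * D \<in> carrier_mat q q" by (auto intro!: carrier_matI)
  have trX: "mat_trace (C * phiR x * D) = T x"
  proof -
    have "mat_trace (C * (phiR x * D)) = mat_trace (phiR x * D * C)" by (rule mat_trace_commute) auto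
    then show ?thesis by (simp add: T_def mat_mult_assoc DC mat_one_mult)
  qed
  have S1: "(\<Sum>a<m. \<Sum>j<q. (E a j * C * phiR x * D) $$ (a,j)) = real m * T x"
  proof -
    have "(E a j * C * phiR x * D) $$ (a,j) = (C * phiR x * D) $$ (j,j)" if "a < m" "j < q" for a j
    proof -
      have "E a j * C * phiR x * D = 1\<^sub>m m * E a j * (C * phiR x * D)" by (simp add: mat_mult_assoc mat_one_mult)
      then show ?thesis using unit_mat_sandwich[OF one_carrier_mat X that(1,2) that] that by (simp del: index_mult_mat(1))
    qed
    then have "(\<Sum>a<m. \<Sum>j<q. (E a j * C * phiR x * D) $$ (a,j)) = (\<Sum>a<m. mat_trace (C * phiR x * D))"
      unfolding mat_trace_def by (intro sum.cong) (auto simp del: index_mult_mat(1))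
    then show ?thesis by (simp add: trX)
  qed
  have S2: "(\<Sum>a<m. \<Sum>j<q. (Z x * C * dphi x (E a j) * D) $$ (a,j))
     = - (\<Sum>a<q. \<theta> a * poly_pair phi (y a) (y a)) - (\<Sum>a<q. \<Sum>b<q. \<theta> a * poly_pair phi (y a) (y b))"
  proof -
    \<comment> \<open>One product-rule term in spectral coordinates: the first summand leads to the
      diagonal of \<open>poly_pair\<close>, the second to its values at all pairs of
      eigenvalues.\<close>
    have tr: "mat_trace (R x ^\<^sub>m Suc i * Gam x * R x ^\<^sub>m (k - i)) + mat_trace (R x ^\<^sub>m Suc i * Gam x) * mat_trace (R x ^\<^sub>m (k - i))
        = (\<Sum>a<q. \<theta> a * y a ^ k) + (\<Sum>a<q. \<Sum>b<q. \<theta> a * (y a ^ i * y b ^ (k - i)))" if "i < k" for k i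
    proof -
      have "mat_trace (R x ^\<^sub>m Suc i * Gam x * R x ^\<^sub>m (k - i)) = (\<Sum>a<q. y a ^ Suc i * l a * y a ^ (k - i))"
        unfolding Rk G spectral_mult[OF V(1)] by (rule mat_trace_spectral[OF V(1)])
      also have "\<dots> = (\<Sum>a<q. \<theta> a * y a ^ k)"
      proof (intro sum.cong refl)
        fix a
        have "y a ^ i * y a ^ (k - i) = y a ^ k" using that by (simp flip: power_add)
        then show "y a ^ Suc i * l a * y a ^ (k - i) = \<theta> a * y a ^ k" by (simp add: \<theta>_def mult_ac)
      qed
      moreover have "mat_trace (R x ^\<^sub>m Suc i * Gam x) = (\<Sum>a<q. \<theta> a * y a ^ i)"
        unfolding Rk G spectral_mult[OF V(1)] mat_trace_spectral[OF V(1)] by (intro sum.cong) (auto simp: \<theta>_def mult_ac)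
      moreover have "mat_trace (R x ^\<^sub>m (k - i)) = (\<Sum>b<q. y b ^ (k - i))"
        unfolding Rk by (rule mat_trace_spectral[OF V(1)])
      ultimately show ?thesis by (simp add: sum_product mult.assoc del: pow_mat.simps)
    qed
    have entry: "(Z x * C * dphi x (E a j) * D) $$ (a,j)
       = (\<Sum>s\<in>terms. - coeff phi (fst s) * (Z x * C * (R x ^\<^sub>m Suc (snd s) * dGam x (E a j) * R x ^\<^sub>m (fst s - snd s)) * D) $$ (a,j))"
      if "a < m" "j < q" for a j
    proof (rule mat_mult_sum_middle[of _ m q _ q])
      show "R x ^\<^sub>m Suc (snd s) * dGam x (E a j) * R x ^\<^sub>m (fst s - snd s) \<in> carrier_mat q q" for s
        using carrier_matD[OF dGam_carrier[OF unit_mat_carrier(1), of x a j]]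
        by (auto intro!: carrier_matI simp del: pow_mat.simps)
      show "dphi x (E a j) $$ (b,c) = (\<Sum>s\<in>terms. - coeff phi (fst s) * (R x ^\<^sub>m Suc (snd s) * dGam x (E a j) * R x ^\<^sub>m (fst s - snd s)) $$ (b,c))"
        if "b < q" "c < q" for b c
        using that by (simp add: dphi_def case_prod_unfold del: index_mult_mat(1) pow_mat.simps)
    qed (use D that in \<open>auto intro!: carrier_matI\<close>)
    have "(\<Sum>a<m. \<Sum>j<q. (Z x * C * dphi x (E a j) * D) $$ (a,j))
       = (\<Sum>a<m. \<Sum>j<q. \<Sum>s\<in>terms. - coeff phi (fst s) * (Z x * C * (R x ^\<^sub>m Suc (snd s) * dGam x (E a j) * R x ^\<^sub>m (fst s - snd s)) * D) $$ (a,j))"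
      using entry by (intro sum.cong refl) (auto simp del: index_mult_mat(1) pow_mat.simps)
    also have "\<dots> = (\<Sum>s\<in>terms. \<Sum>a<m. \<Sum>j<q. - coeff phi (fst s) * (Z x * C * (R x ^\<^sub>m Suc (snd s) * dGam x (E a j) * R x ^\<^sub>m (fst s - snd s)) * D) $$ (a,j))"
      by (subst sum.swap[of _ terms], subst sum.swap[of _ terms "{..<m}"]) (rule refl)
    also have "\<dots> = (\<Sum>s\<in>terms. - coeff phi (fst s) * ((\<Sum>a<q. \<theta> a * y a ^ fst s) + (\<Sum>a<q. \<Sum>b<q. \<theta> a * (y a ^ snd s * y b ^ (fst s - snd s)))))"
    proof (intro sum.cong refl)
      fix s assume "s \<in> terms"
      then have s: "snd s < fst s" by (auto simp: terms_def)
      show "(\<Sum>a<m. \<Sum>j<q. - coeff phi (fst s) * (Z x * C * (R x ^\<^sub>m Suc (snd s) * dGam x (E a j) * R x ^\<^sub>m (fst s - snd s)) * D) $$ (a,j))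
        = - coeff phi (fst s) * ((\<Sum>a<q. \<theta> a * y a ^ fst s) + (\<Sum>a<q. \<Sum>b<q. \<theta> a * (y a ^ snd s * y b ^ (fst s - snd s))))"
        unfolding tr[OF s, symmetric]
          dGam_sandwich_trace[OF pow_carrier_mat[OF R_carrier] pow_carrier_mat[OF R_carrier] Rk_sym, symmetric]
          sum_distrib_left ..
    qed
    also have "\<dots> = (\<Sum>k\<le>degree phi. \<Sum>i<k. - coeff phi k * ((\<Sum>a<q. \<theta> a * y a ^ k) + (\<Sum>a<q. \<Sum>b<q. \<theta> a * (y a ^ i * y b ^ (k - i)))))"
      unfolding terms_def by (subst sum.Sigma) (auto simp: case_prod_unfold)
    also have "\<dots> = - (\<Sum>k\<le>degree phi. \<Sum>a<q. \<theta> a * (coeff phi k * (real k * y a ^ k)))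
        - (\<Sum>k\<le>degree phi. \<Sum>i<k. \<Sum>a<q. \<Sum>b<q. \<theta> a * (coeff phi k * (y a ^ i * y b ^ (k - i))))"
      by (simp add: sum.distrib sum_subtractf distrib_left sum_distrib_left sum_negf mult_ac)
    also have "(\<Sum>k\<le>degree phi. \<Sum>a<q. \<theta> a * (coeff phi k * (real k * y a ^ k))) = (\<Sum>a<q. \<theta> a * poly_pair phi (y a) (y a))"
      unfolding poly_pair_diag_sum sum_distrib_left by (rule sum.swap)
    also have "(\<Sum>k\<le>degree phi. \<Sum>i<k. \<Sum>a<q. \<Sum>b<q. \<theta> a * (coeff phi k * (y a ^ i * y b ^ (k - i)))) = (\<Sum>a<q. \<Sum>b<q. \<theta> a * poly_pair phi (y a) (y b))"
    proof -
      have "(\<Sum>k\<le>degree phi. \<Sum>i<k. \<Sum>a<q. \<Sum>b<q. \<theta> a * (coeff phi k * (y a ^ i * y b ^ (k - i))))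
        = (\<Sum>k\<le>degree phi. \<Sum>a<q. \<Sum>i<k. \<Sum>b<q. \<theta> a * (coeff phi k * (y a ^ i * y b ^ (k - i))))"
        by (rule sum.cong[OF refl], rule sum.swap)
      also have "\<dots> = (\<Sum>k\<le>degree phi. \<Sum>a<q. \<Sum>b<q. \<Sum>i<k. \<theta> a * (coeff phi k * (y a ^ i * y b ^ (k - i))))"
        by (rule sum.cong[OF refl], rule sum.cong[OF refl], rule sum.swap)
      also have "\<dots> = (\<Sum>a<q. \<Sum>k\<le>degree phi. \<Sum>b<q. \<Sum>i<k. \<theta> a * (coeff phi k * (y a ^ i * y b ^ (k - i))))"
        by (rule sum.swap)
      also have "\<dots> = (\<Sum>a<q. \<Sum>b<q. \<Sum>k\<le>degree phi. \<Sum>i<k. \<theta> a * (coeff phi k * (y a ^ i * y b ^ (k - i))))"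
        by (rule sum.cong[OF refl], rule sum.swap)
      finally show ?thesis by (simp add: poly_pair_def sum_distrib_left)
    qed
    finally show ?thesis .
  qed
  have S3: "(\<Sum>a<m. \<Sum>j<q. N x $$ (a,j) * mat_trace (dphi x (E a j)))
     = - 2 * (\<Sum>a<q. poly phi (y a) * (\<theta> a * poly_pair phi (y a) (y a)))"
  proof -
    define M where "M k = K * Z x * C * R x ^\<^sub>m Suc k * C\<^sup>T" for k
    have M: "M k \<in> carrier_mat m q" for k by (auto simp: M_def intro!: carrier_matI simp del: pow_mat.simps)
    have N: "N x \<in> carrier_mat m q" by (auto simp: N_def intro!: carrier_matI)
    have CTDT: "C\<^sup>T * D\<^sup>T = 1\<^sub>m q" using arg_cong[OF DC, of transpose_mat] by (simp add: mat_transpose_mult)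
    have NM: "(\<Sum>a<m. \<Sum>j<q. N x $$ (a,j) * M k $$ (a,j)) = (\<Sum>a<q. poly phi (y a) * l a * y a ^ Suc k)" for k
    proof -
      have "(\<Sum>a<m. \<Sum>j<q. N x $$ (a,j) * M k $$ (a,j)) = mat_trace ((N x)\<^sup>T * M k)"
        by (rule mat_trace_transpose_mult[OF N M])
      also have "(N x)\<^sup>T * M k = D\<^sup>T * (phiR x * Gam x * R x ^\<^sub>m Suc k * C\<^sup>T)"
        unfolding N_def M_def Gam_def by (simp add: mat_transpose_mult mat_mult_assoc phiR_sym del: pow_mat.simps)
      also have "mat_trace \<dots> = mat_trace (phiR x * Gam x * R x ^\<^sub>m Suc k * C\<^sup>T * D\<^sup>T)"
        by (rule mat_trace_commute) (auto simp del: pow_mat.simps)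
      also have "phiR x * Gam x * R x ^\<^sub>m Suc k * C\<^sup>T * D\<^sup>T = phiR x * Gam x * R x ^\<^sub>m Suc k"
        by (simp add: mat_mult_assoc CTDT mat_one_mult del: pow_mat.simps)
      also have "mat_trace \<dots> = (\<Sum>a<q. poly phi (y a) * l a * y a ^ Suc k)"
        unfolding Rk G ph spectral_mult[OF V(1)] by (rule mat_trace_spectral[OF V(1)])
      finally show ?thesis .
    qed
    have "(\<Sum>a<m. \<Sum>j<q. N x $$ (a,j) * mat_trace (dphi x (E a j)))
      = (\<Sum>a<m. \<Sum>j<q. \<Sum>k\<le>degree phi. (- 2 * coeff phi k * real k) * (N x $$ (a,j) * M k $$ (a,j)))"
      by (intro sum.cong refl)
        (simp add: mat_trace_dphi M_def[symmetric] sum_distrib_left mult_ac sum_negf del: index_mult_mat(1) pow_mat.simps)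
    also have "\<dots> = (\<Sum>k\<le>degree phi. \<Sum>a<m. \<Sum>j<q. (- 2 * coeff phi k * real k) * (N x $$ (a,j) * M k $$ (a,j)))"
      by (subst sum.swap[of _ "{..degree phi}"], subst sum.swap[of _ "{..degree phi}" "{..<m}"]) (rule refl)
    also have "\<dots> = (\<Sum>k\<le>degree phi. \<Sum>a<q. (- 2 * coeff phi k * real k) * (poly phi (y a) * l a * y a ^ Suc k))"
      unfolding sum_distrib_left[symmetric] NM ..
    also have "\<dots> = (\<Sum>a<q. \<Sum>k\<le>degree phi. (- 2 * coeff phi k * real k) * (poly phi (y a) * l a * y a ^ Suc k))"
      by (rule sum.swap)
    also have "\<dots> = - 2 * (\<Sum>a<q. poly phi (y a) * (\<theta> a * poly_pair phi (y a) (y a)))"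
      unfolding poly_pair_diag_sum sum_distrib_left by (intro sum.cong refl) (simp add: \<theta>_def mult_ac)
    finally show ?thesis .
  qed
  have dN: "dN x (E a j) $$ (a,j) = (E a j * C * phiR x * D) $$ (a,j) + (Z x * C * dphi x (E a j) * D) $$ (a,j)"
    if "a < m" "j < q" for a j
    using that by (simp add: dN_def del: index_mult_mat(1))
  have "divergence x = ((\<Sum>a<m. \<Sum>j<q. (E a j * C * phiR x * D) $$ (a,j)) + (\<Sum>a<m. \<Sum>j<q. (Z x * C * dphi x (E a j) * D) $$ (a,j))) / T x
     - (\<Sum>a<m. \<Sum>j<q. N x $$ (a,j) * mat_trace (dphi x (E a j))) / (T x)\<^sup>2"
    unfolding divergence_def using dN
    by (simp add: sum.distrib sum_subtractf sum_divide_distrib add_divide_distrib del: index_mult_mat(1))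
  also have "\<dots> = (real m * T x - (\<Sum>a<q. \<theta> a * poly_pair phi (y a) (y a)) - (\<Sum>a<q. \<Sum>b<q. \<theta> a * poly_pair phi (y a) (y b))) / T x
      + 2 * (\<Sum>a<q. poly phi (y a) * (\<theta> a * poly_pair phi (y a) (y a))) / (T x)\<^sup>2"
    unfolding S1 S2 S3 by simp
  also have "\<dots> \<le> real m - (real q - 1) * \<theta>0"
    unfolding T by (rule divergence_bound[OF q y \<theta>0])
  finally show ?thesis unfolding \<theta>0_def .
qed

section \<open>Polynomial growth of the field and the integrated divergence bound\<close>

abbreviation "I \<equiv> {..<m} \<times> {..<q}"

lemma mat_tame_Z: "mat_tame I m q Z"
  by (auto simp: mat_tame_def Z_def intro!: tame_component)

lemma mat_tame_ZC: "mat_tame I m q (\<lambda>x. Z x * C)"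
  by (rule mat_tame_mult[OF mat_tame_Z mat_tame_const[OF C]])

lemma mat_tame_CT: "mat_tame I q q (\<lambda>_. C\<^sup>T)"
  using C by (intro mat_tame_const) simp

lemma mat_tame_Gam: "mat_tame I q q Gam"
  unfolding Gam_def[abs_def]
  by (rule mat_tame_mult[OF mat_tame_CT mat_tame_mult[OF mat_tame_transpose[OF mat_tame_Z]
        mat_tame_mult[OF mat_tame_const[OF K] mat_tame_ZC]]])

text \<open>The eigenvalues of \<open>R\<close> are at most 1 / eps, so its entries are bounded.
  This is the purpose of eps: the inverse of \<open>Gam\<close> itself has no polynomial
  bound.\<close>

lemma mat_tame_R: "mat_tame I q q R"
proof -
  have A: "mat_tame I q q A"
    unfolding A_def[abs_def] by (rule mat_tame_add[OF mat_tame_Gam mat_tame_const]) auto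
  have "tame I (\<lambda>x. R x $$ (i,j))" if ij: "i < q" "j < q" for i j
  proof (rule tame_dominated[OF tame_const[of I "real q * (1 / eps)"]])
    show "(\<lambda>x. R x $$ (i,j)) \<in> borel_measurable (gauss_vector I)"
      unfolding R_def by (rule inv_mat_measurable[OF mat_tame_measurable[OF A] ij])
    fix x
    obtain V l y where S: "spec x V l y" by (rule spec_exists[of x])
    have "\<bar>R x $$ (i,j)\<bar> \<le> real q * (1 / eps)"
      unfolding specD(7)[OF S]
    proof (rule spectral_entry_le[OF specD(1)[OF S] ij])
      fix a assume a: "a < q"
      then show "\<bar>y a\<bar> \<le> 1 / eps"
        using specD(4,5)[OF S a] eps unfolding specD(6)[OF S] by (simp add: frac_le)
    qed
    then show "\<bar>R x $$ (i,j)\<bar> \<le> \<bar>real q * (1 / eps)\<bar>" by linarith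
  qed
  then show ?thesis using R_carrier by (simp add: mat_tame_def)
qed

lemma mat_tame_phiR: "mat_tame I q q phiR"
  unfolding mat_tame_def phiR_def
  by (auto intro!: tame_sum tame_mult tame_const mat_tame_index[OF mat_tame_pow[OF mat_tame_R]])

lemma T_measurable: "T \<in> borel_measurable (gauss_vector I)"
  using tame_measurable[OF mat_tame_trace[OF mat_tame_phiR]] by (simp add: T_def[abs_def])

lemma tame_inverse_T: "tame I (\<lambda>x. 1 / T x)"
proof (rule tame_dominated)
  show "tame I (\<lambda>x. (mat_trace (Gam x) + eps) * (1 / poly P 0))"
    by (intro tame_mult tame_add tame_const mat_tame_trace[OF mat_tame_Gam])
  show "(\<lambda>x. 1 / T x) \<in> borel_measurable (gauss_vector I)" using T_measurable by measurable
  fix x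
  have p: "0 < mat_trace (Gam x) + eps" using tr_Gam_nonneg[of x] eps by simp
  have "poly P 0 \<le> T x * (mat_trace (Gam x) + eps)" using T_ge[of x] p by (simp add: divide_le_eq)
  then have "1 / T x \<le> (mat_trace (Gam x) + eps) * (1 / poly P 0)"
    using T_pos[of x] pos_at_0 by (simp add: field_simps)
  then show "\<bar>1 / T x\<bar> \<le> \<bar>(mat_trace (Gam x) + eps) * (1 / poly P 0)\<bar>"
    using T_pos[of x] p pos_at_0 by simp
qed

lemma tame_divide_T: "tame I f \<Longrightarrow> tame I (\<lambda>x. f x / T x)"
  using tame_mult[OF _ tame_inverse_T] by simp

lemma mat_tame_N: "mat_tame I m q N"
  unfolding N_def[abs_def]
  by (rule mat_tame_mult[OF mat_tame_mult[OF mat_tame_ZC mat_tame_phiR] mat_tame_const[OF D]])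

lemma mat_tame_dGam: "mat_tame I q q (\<lambda>x. dGam x (E a j))"
proof -
  have "mat_tame I m q (\<lambda>_. E a j * C)" "mat_tame I q m (\<lambda>_. (E a j)\<^sup>T)"
    using C by (auto intro!: mat_tame_const carrier_matI)
  note e = this
  show ?thesis unfolding dGam_def
    by (rule mat_tame_mult[OF mat_tame_CT mat_tame_add[OF
          mat_tame_mult[OF e(2) mat_tame_mult[OF mat_tame_const[OF K] mat_tame_ZC]]
          mat_tame_mult[OF mat_tame_transpose[OF mat_tame_Z] mat_tame_mult[OF mat_tame_const[OF K] e(1)]]]])
qed

lemma mat_tame_dphi: "mat_tame I q q (\<lambda>x. dphi x (E a j))"
proof -
  have "mat_tame I q q (\<lambda>x. R x ^\<^sub>m Suc l * dGam x (E a j) * R x ^\<^sub>m k)" for k l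
    by (intro mat_tame_mult[where n = q] mat_tame_pow mat_tame_R mat_tame_dGam)
  note t = this
  have "tame I (\<lambda>x. dphi x (E a j) $$ (b,c))" if bc: "b < q" "c < q" for b c
  proof -
    have "tame I (\<lambda>x. \<Sum>s\<in>terms. - coeff phi (fst s) * (R x ^\<^sub>m Suc (snd s) * dGam x (E a j) * R x ^\<^sub>m (fst s - snd s)) $$ (b,c))"
      by (intro tame_sum tame_mult tame_const mat_tame_index[OF t bc])
    then show ?thesis using bc by (simp add: dphi_def case_prod_unfold del: index_mult_mat(1) pow_mat.simps)
  qed
  then show ?thesis by (simp add: mat_tame_def)
qed

lemma mat_tame_dN: "mat_tame I m q (\<lambda>x. dN x (E a j))"
proof -
  have "mat_tame I m q (\<lambda>_. E a j * C)" using C by (auto intro!: mat_tame_const carrier_matI)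
  from mat_tame_add[OF mat_tame_mult[OF mat_tame_mult[OF this mat_tame_phiR] mat_tame_const[OF D]]
      mat_tame_mult[OF mat_tame_mult[OF mat_tame_ZC mat_tame_dphi] mat_tame_const[OF D]]]
  show ?thesis unfolding dN_def .
qed

lemma stein_component:
  assumes aj: "a < m" "j < q"
  shows "tame I (\<lambda>x. dN x (E a j) $$ (a,j) / T x - N x $$ (a,j) * mat_trace (dphi x (E a j)) / (T x)\<^sup>2)"
    "(\<integral>x. x (a,j) * (N x $$ (a,j) / T x) \<partial>gauss_vector I)
      = (\<integral>x. dN x (E a j) $$ (a,j) / T x - N x $$ (a,j) * mat_trace (dphi x (E a j)) / (T x)\<^sup>2 \<partial>gauss_vector I)"
proof -
  have N: "tame I (\<lambda>x. N x $$ (a,j) / T x)"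
    by (intro tame_divide_T mat_tame_index[OF mat_tame_N] aj)
  have "tame I (\<lambda>x. dN x (E a j) $$ (a,j) / T x + - (N x $$ (a,j) / T x * (mat_trace (dphi x (E a j)) / T x)))"
    by (intro tame_add tame_minus tame_mult N tame_divide_T mat_tame_trace[OF mat_tame_dphi] mat_tame_index[OF mat_tame_dN] aj)
  then show dt: "tame I (\<lambda>x. dN x (E a j) $$ (a,j) / T x - N x $$ (a,j) * mat_trace (dphi x (E a j)) / (T x)\<^sup>2)"
    by (simp add: power2_eq_square)
  show "(\<integral>x. x (a,j) * (N x $$ (a,j) / T x) \<partial>gauss_vector I)
      = (\<integral>x. dN x (E a j) $$ (a,j) / T x - N x $$ (a,j) * mat_trace (dphi x (E a j)) / (T x)\<^sup>2 \<partial>gauss_vector I)"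
  proof (rule stein_identity[OF _ _ _ N dt])
    fix x :: "nat \<times> nat \<Rightarrow> real" and t :: real
    let ?x = "x((a,j) := t)"
    have "((\<lambda>s. N (x((a,j) := s)) $$ (a,j)) has_real_derivative dN ?x (E a j) $$ (a,j)) (at t)"
      using N_deriv[OF aj, of x t] aj by (simp add: mat_deriv_def)
    from DERIV_divide[OF this T_deriv[OF aj]] T_pos[of ?x]
    show "((\<lambda>s. N (x((a,j) := s)) $$ (a,j) / T (x((a,j) := s))) has_real_derivative
        dN ?x (E a j) $$ (a,j) / T ?x - N ?x $$ (a,j) * mat_trace (dphi ?x (E a j)) / (T ?x)\<^sup>2) (at t)"
      by (simp add: power2_eq_square diff_divide_distrib)
  qed (use aj in auto)
qed

definition "quad x = (\<Sum>a<m. \<Sum>j<q. x (a,j) * (N x $$ (a,j) / T x))"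

lemma tame_quad: "tame I quad"
  unfolding quad_def[abs_def]
  by (intro tame_sum tame_mult tame_component tame_divide_T mat_tame_index[OF mat_tame_N]) auto

lemma tame_shrink: "tame I (\<lambda>x. max 0 (1 - eps * mat_trace (R x)))"
proof (rule tame_dominated)
  show "tame I (\<lambda>x. 1 + - (eps * mat_trace (R x)))"
    by (intro tame_add tame_const tame_minus tame_mult mat_tame_trace[OF mat_tame_R])
  show "(\<lambda>x. max 0 (1 - eps * mat_trace (R x))) \<in> borel_measurable (gauss_vector I)"
    using tame_measurable[OF mat_tame_trace[OF mat_tame_R]] by measurable
qed auto

lemma haff_integral_le:
  "(\<integral>x. quad x \<partial>gauss_vector I) \<le> real m - (real q - 1) * (\<integral>x. max 0 (1 - eps * mat_trace (R x)) \<partial>gauss_vector I)"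
proof -
  interpret prob_space "gauss_vector I" by (rule prob_space_gauss_vector)
  have int1: "integrable (gauss_vector I) (\<lambda>x. x (a,j) * (N x $$ (a,j) / T x))" if "a < m" "j < q" for a j
    by (rule tame_integrable) (use that in \<open>auto intro!: tame_mult tame_component tame_divide_T mat_tame_index[OF mat_tame_N]\<close>)
  have int2: "integrable (gauss_vector I) (\<lambda>x. dN x (E a j) $$ (a,j) / T x - N x $$ (a,j) * mat_trace (dphi x (E a j)) / (T x)\<^sup>2)"
    if "a < m" "j < q" for a j
    by (rule tame_integrable[OF _ stein_component(1)[OF that]]) simp
  have int3: "integrable (gauss_vector I) (\<lambda>x. max 0 (1 - eps * mat_trace (R x)))"
    by (rule tame_integrable[OF _ tame_shrink]) simp
  have "(\<integral>x. quad x \<partial>gauss_vector I) = (\<Sum>a<m. \<Sum>j<q. \<integral>x. x (a,j) * (N x $$ (a,j) / T x) \<partial>gauss_vector I)"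
    unfolding quad_def using int1 by (subst Bochner_Integration.integral_sum | intro Bochner_Integration.integrable_sum sum.cong refl | auto)+
  also have "\<dots> = (\<Sum>a<m. \<Sum>j<q. \<integral>x. dN x (E a j) $$ (a,j) / T x - N x $$ (a,j) * mat_trace (dphi x (E a j)) / (T x)\<^sup>2 \<partial>gauss_vector I)"
    by (intro sum.cong refl stein_component(2)) auto
  also have "\<dots> = (\<integral>x. divergence x \<partial>gauss_vector I)"
    unfolding divergence_def using int2 by (subst Bochner_Integration.integral_sum | intro Bochner_Integration.integrable_sum sum.cong refl | auto)+
  also have "\<dots> \<le> (\<integral>x. real m - (real q - 1) * max 0 (1 - eps * mat_trace (R x)) \<partial>gauss_vector I)"
  proof (rule integral_mono)
    show "integrable (gauss_vector I) divergence"
      unfolding divergence_def[abs_def] using int2 by (intro Bochner_Integration.integrable_sum) auto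
    show "integrable (gauss_vector I) (\<lambda>x. real m - (real q - 1) * max 0 (1 - eps * mat_trace (R x)))"
      by (intro Bochner_Integration.integrable_diff integrable_const Bochner_Integration.integrable_mult_right int3)
  qed (rule divergence_le)
  also have "\<dots> = real m - (real q - 1) * (\<integral>x. max 0 (1 - eps * mat_trace (R x)) \<partial>gauss_vector I)"
    using int3 prob_space by (subst Bochner_Integration.integral_diff) auto
  finally show ?thesis .
qed

lemma quad_eq_trace: "quad x = mat_trace (D * ((Z x)\<^sup>T * Z x) * C * phiR x) / T x"
proof -
  have N: "N x \<in> carrier_mat m q" using mat_tame_N by (simp add: mat_tame_def)
  have "(\<Sum>a<m. \<Sum>j<q. Z x $$ (a,j) * N x $$ (a,j)) = mat_trace ((Z x)\<^sup>T * N x)"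
    by (rule mat_trace_transpose_mult[OF Z N])
  also have "(Z x)\<^sup>T * N x = ((Z x)\<^sup>T * Z x * C * phiR x) * D" unfolding N_def by (simp add: mat_mult_assoc)
  also have "mat_trace \<dots> = mat_trace (D * ((Z x)\<^sup>T * Z x * C * phiR x))" by (rule mat_trace_commute) auto
  also have "D * ((Z x)\<^sup>T * Z x * C * phiR x) = D * ((Z x)\<^sup>T * Z x) * C * phiR x" by (simp add: mat_mult_assoc)
  finally have "(\<Sum>a<m. \<Sum>j<q. Z x $$ (a,j) * N x $$ (a,j)) = mat_trace (D * ((Z x)\<^sup>T * Z x) * C * phiR x)" .
  moreover have "quad x = (\<Sum>a<m. \<Sum>j<q. Z x $$ (a,j) * N x $$ (a,j)) / T x"
    unfolding quad_def sum_divide_distrib by (intro sum.cong refl) (auto simp: Z_def)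
  ultimately show ?thesis by simp
qed

text \<open>The shrinkage weights sum to one, so the weighted trace is bounded uniformly in
  \<open>P\<close> and \<open>eps\<close>; this dominates the passage to the limit.\<close>

lemma quad_abs_le: "\<bar>quad x\<bar> \<le> real q * (\<Sum>i<q. \<Sum>k<q. \<bar>(D * ((Z x)\<^sup>T * Z x) * C) $$ (i,k)\<bar>)"
proof -
  obtain V l y where S: "spec x V l y" by (rule spec_exists[of x])
  define F where "F = D * ((Z x)\<^sup>T * Z x) * C"
  have F: "dim_row F = q" "dim_col F = q" by (auto simp: F_def)
  have T: "T x = (\<Sum>i<q. poly phi (y i))" unfolding T_def specD(9)[OF S] by (rule mat_trace_spectral[OF specD(1)[OF S]])
  have le: "\<bar>phiR x $$ (k,i)\<bar> \<le> real q * T x" if "k < q" "i < q" for k i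
    unfolding specD(9)[OF S]
  proof (rule spectral_entry_le[OF specD(1)[OF S] that])
    fix a assume a: "a < q"
    have "poly phi (y a) \<le> T x" unfolding T
      by (rule member_le_sum) (use a specD(5)[OF S] phi_pos in \<open>auto intro: less_imp_le\<close>)
    then show "\<bar>poly phi (y a)\<bar> \<le> T x" using phi_pos[OF specD(5)[OF S a]] by simp
  qed
  have "\<bar>mat_trace (F * phiR x)\<bar> \<le> (\<Sum>i<q. \<Sum>k<q. \<bar>F $$ (i,k) * phiR x $$ (k,i)\<bar>)"
    using F by (subst mat_trace_mult) (auto intro!: order_trans[OF sum_abs] sum_mono)
  also have "\<dots> \<le> (\<Sum>i<q. \<Sum>k<q. \<bar>F $$ (i,k)\<bar> * (real q * T x))"
    using le by (intro sum_mono) (auto simp: abs_mult intro!: mult_left_mono)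
  also have "\<dots> = real q * (\<Sum>i<q. \<Sum>k<q. \<bar>F $$ (i,k)\<bar>) * T x"
    by (simp add: sum_distrib_left sum_distrib_right mult_ac)
  finally show ?thesis unfolding quad_eq_trace F_def[symmetric] using T_pos[of x]
    by (simp add: divide_le_eq)
qed

end

section \<open>Risk comparison\<close>

text \<open>The left-hand side is the [1/1] Pade approximant of the logarithm at 0; the derivative
  of the difference is x^2 / ((1 + x) (2 + x)^2). Dividing it by b leaves 2 / (2 + b), which makes
  the final condition on b linear.\<close>

lemma ln_add_one_ge_pade:
  fixes b :: real
  assumes "0 \<le> b"
  shows "2 * b / (2 + b) \<le> ln (1 + b)"
proof -
  let ?f = "\<lambda>x::real. ln (1 + x) - 2 * x / (2 + x)"
  have "?f 0 \<le> ?f b"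
  proof (rule DERIV_nonneg_imp_nondecreasing[OF assms])
    fix x :: real assume x: "0 \<le> x" "x \<le> b"
    have "(?f has_real_derivative (1 / (1 + x) - 4 / (2 + x)\<^sup>2)) (at x)"
      using x by (auto intro!: derivative_eq_intros simp: power2_eq_square field_simps)
    moreover have "1 / (1 + x) - 4 / (2 + x)\<^sup>2 = x\<^sup>2 / ((1 + x) * (2 + x)\<^sup>2)"
    proof -
      have nz: "1 + x \<noteq> 0" "(2 + x)\<^sup>2 \<noteq> 0" using x by auto
      have "1 * (2 + x)\<^sup>2 - 4 * (1 + x) = x\<^sup>2" by (simp add: power2_eq_square algebra_simps)
      then show ?thesis using diff_frac_eq[OF nz, of 1 4] by simp
    qed
    ultimately show "\<exists>y. (?f has_real_derivative y) (at x) \<and> 0 \<le> y" using x by auto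
  qed
  then show ?thesis by simp
qed

lemma one_plus_sum_le_prod:
  fixes u :: "nat \<Rightarrow> real"
  assumes "\<And>i. i < n \<Longrightarrow> 0 \<le> u i"
  shows "1 + (\<Sum>i<n. u i) \<le> (\<Prod>i<n. 1 + u i)"
  using assms
proof (induction n)
  case (Suc n)
  have S: "0 \<le> (\<Sum>i<n. u i)" using Suc.prems by (intro sum_nonneg) auto
  have "1 + (\<Sum>i<Suc n. u i) \<le> (1 + (\<Sum>i<n. u i)) * (1 + u n)"
    using S Suc.prems[of n] by (simp add: algebra_simps)
  also have "\<dots> \<le> (\<Prod>i<n. 1 + u i) * (1 + u n)"
    using Suc by (intro mult_right_mono) auto
  finally show ?case by simp
qed simp

text \<open>Expanding the product of the factors 1 + b w and keeping only the linear terms leaves 1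
  + b. Equality occurs when a single weight carries everything.\<close>

lemma sum_ln_weights_ge:
  fixes w :: "nat \<Rightarrow> real"
  assumes w: "\<And>i. i < n \<Longrightarrow> 0 \<le> w i" "(\<Sum>i<n. w i) = 1" and b: "0 \<le> b"
  shows "ln (1 + b) \<le> (\<Sum>i<n. ln (1 + b * w i))"
proof -
  have pos: "0 < 1 + b * w i" if "i < n" for i using w(1)[OF that] b by (simp add: add_pos_nonneg)
  have "1 + b = 1 + (\<Sum>i<n. b * w i)" by (simp add: sum_distrib_left[symmetric] w(2))
  also have "\<dots> \<le> (\<Prod>i<n. 1 + b * w i)" using w b by (intro one_plus_sum_le_prod) auto
  finally have "ln (1 + b) \<le> ln (\<Prod>i<n. 1 + b * w i)" using b by simp
  also have "\<dots> = (\<Sum>i<n. ln (1 + b * w i))"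
    using pos by (intro ln_prod) (auto simp: less_imp_neq[symmetric])
  finally show ?thesis .
qed

lemma mat_trace_mult_spectral:
  fixes F V :: "real mat"
  assumes F: "F \<in> carrier_mat q q" and V: "V \<in> carrier_mat q q"
  shows "mat_trace (F * (V * mat_diag q d * V\<^sup>T)) = (\<Sum>i<q. d i * (V\<^sup>T * F * V) $$ (i,i))"
proof -
  note dims = carrier_matD[OF F] carrier_matD[OF V]
  have "mat_trace (F * (V * mat_diag q d * V\<^sup>T)) = mat_trace ((F * V * mat_diag q d) * V\<^sup>T)"
    by (simp add: mat_mult_assoc dims)
  also have "\<dots> = mat_trace (V\<^sup>T * (F * V * mat_diag q d))" by (rule mat_trace_commute) (auto simp: dims)
  also have "V\<^sup>T * (F * V * mat_diag q d) = (V\<^sup>T * F * V) * mat_diag q d" by (simp add: mat_mult_assoc dims)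
  also have "mat_trace \<dots> = (\<Sum>i<q. d i * (V\<^sup>T * F * V) $$ (i,i))"
  proof -
    have c: "V\<^sup>T * F * V \<in> carrier_mat q q" by (auto simp: dims intro!: carrier_matI)
    show ?thesis unfolding mat_trace_def mat_diag_mult_right[OF c] by (simp add: mult.commute del: index_mult_mat(1))
  qed
  finally show ?thesis .
qed

lemma spectral_add_one:
  assumes V: "orthogonal_matrix q V" and M: "M = V * mat_diag q d * V\<^sup>T"
  shows "Matrix.mat q q (\<lambda>(i,j). (if i = j then 1 else 0) + c * M $$ (i,j)) = V * mat_diag q (\<lambda>i. 1 + c * d i) * V\<^sup>T"
proof -
  have Vc: "V \<in> carrier_mat q q" "V * V\<^sup>T = 1\<^sub>m q" using V by (auto simp: orthogonal_matrix_def)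
  show ?thesis
  proof (rule eq_matI)
    fix i j assume "i < dim_row (V * mat_diag q (\<lambda>i. 1 + c * d i) * V\<^sup>T)" "j < dim_col (V * mat_diag q (\<lambda>i. 1 + c * d i) * V\<^sup>T)"
    then have ij: "i < q" "j < q" using Vc by auto
    have "(\<Sum>a<q. V $$ (i,a) * V $$ (j,a)) = (V * V\<^sup>T) $$ (i,j)"
      using Vc(1) ij by (subst mat_mult_index) auto
    then have "(\<Sum>a<q. V $$ (i,a) * V $$ (j,a)) = (if i = j then 1 else 0)" using Vc(2) ij by simp
    then show "Matrix.mat q q (\<lambda>(i,j). (if i = j then 1 else 0) + c * M $$ (i,j)) $$ (i,j) = (V * mat_diag q (\<lambda>i. 1 + c * d i) * V\<^sup>T) $$ (i,j)"
      using ij unfolding M spectral_index[OF Vc(1) ij]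
      by (simp add: spectral_index[OF Vc(1) ij] distrib_left sum.distrib sum_distrib_left mult_ac del: index_mult_mat(1))
  qed (use Vc in auto)
qed

text \<open>Convergence along moving arguments is needed, since the eigenvalues of the regularised
  inverse move while the polynomial changes. The windows [1 / (k + 1), k + 1] eventually contain a
  neighbourhood of any y > 0.\<close>

lemma weight_poly_sequence:
  assumes "1 \<le> \<alpha>"
  obtains P :: "nat \<Rightarrow> real poly" where "\<And>k. weight_poly (P k)"
    "\<And>u y. 0 < y \<Longrightarrow> u \<longlonglongrightarrow> y \<Longrightarrow> (\<lambda>k. poly (pCons 0 (P k)) (u k)) \<longlonglongrightarrow> y powr \<alpha>"
proof -
  have "\<forall>k::nat. \<exists>P. weight_poly P \<and> (\<forall>y\<in>{1/real (Suc k)..real (Suc k)}. \<bar>poly P y - y powr (\<alpha> - 1)\<bar> \<le> 1 / real (Suc k))"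
    using assms by (intro allI weight_poly_approx_powr) auto
  then obtain P where P: "\<And>k. weight_poly (P k)"
    "\<And>k y. y \<in> {1/real (Suc k)..real (Suc k)} \<Longrightarrow> \<bar>poly (P k) y - y powr (\<alpha> - 1)\<bar> \<le> 1 / real (Suc k)"
    by metis
  show thesis
  proof (rule that[OF P(1)])
    fix u :: "nat \<Rightarrow> real" and y :: real
    assume y: "0 < y" and u: "u \<longlonglongrightarrow> y"
    have inv0: "(\<lambda>k. 1 / real (Suc k)) \<longlonglongrightarrow> 0" using LIMSEQ_inverse_real_of_nat by (simp add: inverse_eq_divide)
    have "\<forall>\<^sub>F k in sequentially. 1 / real (Suc k) < y / 2" using y by (intro order_tendstoD(2)[OF inv0]) simp
    moreover have "\<forall>\<^sub>F k in sequentially. y / 2 < u k" "\<forall>\<^sub>F k in sequentially. u k < y + 1"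
      using order_tendstoD(1)[OF u, of "y / 2"] order_tendstoD(2)[OF u, of "y + 1"] y by auto
    moreover have "\<forall>\<^sub>F k in sequentially. y + 1 \<le> real (Suc k)"
    proof -
      obtain N :: nat where "y + 1 \<le> real N" using real_arch_simple by blast
      then show ?thesis by (intro eventually_sequentiallyI[of N]) simp
    qed
    ultimately have "\<forall>\<^sub>F k in sequentially. norm (poly (P k) (u k) - u k powr (\<alpha> - 1)) \<le> 1 / real (Suc k)"
    proof eventually_elim
      case (elim k)
      then show ?case using P(2)[of "u k" k] by auto
    qed
    then have "(\<lambda>k. poly (P k) (u k) - u k powr (\<alpha> - 1)) \<longlonglongrightarrow> 0" by (rule Lim_null_comparison[OF _ inv0])
    moreover have "(\<lambda>k. u k powr (\<alpha> - 1)) \<longlonglongrightarrow> y powr (\<alpha> - 1)" using y by (intro tendsto_intros u) auto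
    ultimately have "(\<lambda>k. (poly (P k) (u k) - u k powr (\<alpha> - 1)) + u k powr (\<alpha> - 1)) \<longlonglongrightarrow> 0 + y powr (\<alpha> - 1)"
      by (rule tendsto_add)
    then have "(\<lambda>k. poly (P k) (u k)) \<longlonglongrightarrow> y powr (\<alpha> - 1)" by simp
    from tendsto_mult[OF u this] have "(\<lambda>k. u k * poly (P k) (u k)) \<longlonglongrightarrow> y * y powr (\<alpha> - 1)" .
    moreover have "y * y powr (\<alpha> - 1) = y powr \<alpha>" using y by (simp add: powr_diff)
    ultimately show "(\<lambda>k. poly (pCons 0 (P k)) (u k)) \<longlonglongrightarrow> y powr \<alpha>" by simp
  qed
qed

text \<open>\<open>V\<close> and \<open>l\<close> are arbitrary functions of the sample point, so
  the weighted trace and the sum of logarithms may fail to be measurable. The witnesses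
  \<open>t\<close> and \<open>u\<close> are limits of functions of the Gaussian entries and agree
  with them almost surely.\<close>

theorem haff_weighted_trace_bound:
  fixes M :: "'w measure" and \<Phi> :: "'w \<Rightarrow> nat \<times> nat \<Rightarrow> real" and V :: "'w \<Rightarrow> real mat" and l :: "'w \<Rightarrow> nat \<Rightarrow> real"
  assumes M: "prob_space M" and \<Phi>: "\<Phi> \<in> measurable M (gauss_vector ({..<m} \<times> {..<q}))"
    and law: "distr M (gauss_vector ({..<m} \<times> {..<q})) \<Phi> = gauss_vector ({..<m} \<times> {..<q})"
    and q: "0 < q" and J: "J \<in> carrier_mat m m" and K: "K = J\<^sup>T * J"
    and CD: "C \<in> carrier_mat q q" "D \<in> carrier_mat q q" "C * D = 1\<^sub>m q" "D * C = 1\<^sub>m q"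
    and \<alpha>: "1 \<le> \<alpha>" and b: "0 \<le> b"
    and spec: "AE \<omega> in M. orthogonal_matrix q (V \<omega>) \<and> (\<forall>i<q. 0 < l \<omega> i) \<and>
        C\<^sup>T * ((Matrix.mat m q (\<Phi> \<omega>))\<^sup>T * (K * (Matrix.mat m q (\<Phi> \<omega>) * C))) = V \<omega> * mat_diag q (l \<omega>) * (V \<omega>)\<^sup>T"
  defines "w \<equiv> \<lambda>\<omega> i. l \<omega> i powr (- \<alpha>) / (\<Sum>j<q. l \<omega> j powr (- \<alpha>))"
  shows "\<exists>t u. integrable M t \<and> (\<integral>\<omega>. t \<omega> \<partial>M) \<le> real m - real q + 1 \<and> u \<in> borel_measurable M \<and>
    (AE \<omega> in M. t \<omega> = mat_trace (D * ((Matrix.mat m q (\<Phi> \<omega>))\<^sup>T * Matrix.mat m q (\<Phi> \<omega>)) * C * (V \<omega> * mat_diag q (w \<omega>) * (V \<omega>)\<^sup>T)) \<and>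
       u \<omega> = (\<Sum>i<q. ln (1 + b * w \<omega> i)))"
proof -
  interpret prob_space M by fact
  let ?I = "{..<m} \<times> {..<q}"
  obtain P where P: "\<And>k. weight_poly (P k)"
    and Plim: "\<And>u y. 0 < y \<Longrightarrow> u \<longlonglongrightarrow> y \<Longrightarrow> (\<lambda>k. poly (pCons 0 (P k)) (u k)) \<longlonglongrightarrow> y powr \<alpha>"
    using weight_poly_sequence[OF \<alpha>] by metis
  define eps where "eps k = 1 / real (Suc k)" for k
  have eps0: "eps \<longlonglongrightarrow> 0" using LIMSEQ_inverse_real_of_nat by (simp add: eps_def[abs_def] inverse_eq_divide)
  interpret H: haff_field "P k" m q K J C D "eps k" for k
    by (rule haff_field.intro[OF P], unfold_locales) (use q J K CD in \<open>auto simp: eps_def\<close>)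
  define F where "F x = D * ((Matrix.mat m q x)\<^sup>T * Matrix.mat m q x) * C" for x :: "nat \<times> nat \<Rightarrow> real"
  have F: "F x \<in> carrier_mat q q" for x using CD by (auto simp: F_def intro!: carrier_matI)
  have HZ: "H.Z = Matrix.mat m q" by (rule ext) (simp add: H.Z_def)
  \<comment> \<open>Its eigenvalues are 1 + b p / T with p those of \<open>phiR\<close>. The
    log-determinant is thus a measurable form of the approximating sum of logarithms, and no
    eigenvectors have to be chosen measurably.\<close>
  define A where "A k x = Matrix.mat q q (\<lambda>(i,j). (if i = j then 1 else 0) + b / H.T k x * H.phiR k x $$ (i,j))" for k x
  define tk where "tk k \<omega> = H.quad k (\<Phi> \<omega>)" for k \<omega>
  define sk where "sk k \<omega> = max 0 (1 - eps k * mat_trace (H.R k (\<Phi> \<omega>)))" for k \<omega>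
  define uk where "uk k \<omega> = ln (Determinant.det (A k (\<Phi> \<omega>)))" for k \<omega>
  \<comment> \<open>Dominates \<open>tk k\<close> for every k at once, since the bound
    \<open>quad_abs_le\<close> involves neither the polynomial nor eps.\<close>
  define bd where "bd x = real q * (\<Sum>i<q. \<Sum>j<q. \<bar>F x $$ (i,j)\<bar>)" for x
  have meas_tk: "tk k \<in> borel_measurable M" for k
    unfolding tk_def by (rule measurable_compose[OF \<Phi> tame_measurable[OF H.tame_quad]])
  have meas_sk: "sk k \<in> borel_measurable M" for k
    unfolding sk_def by (rule measurable_compose[OF \<Phi> tame_measurable[OF H.tame_shrink]])
  have meas_uk: "uk k \<in> borel_measurable M" for k
  proof -
    have "mat_measurable (gauss_vector ?I) q q (A k)"
      unfolding mat_measurable_def A_def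
    proof (intro conjI ballI allI impI)
      fix i j assume ij: "i < q" "j < q"
      have "(\<lambda>x. H.phiR k x $$ (i,j)) \<in> borel_measurable (gauss_vector ?I)"
        by (rule tame_measurable[OF mat_tame_index[OF H.mat_tame_phiR ij]])
      then have meas: "(\<lambda>x. (if i = j then 1 else 0) + b / H.T k x * H.phiR k x $$ (i,j)) \<in> borel_measurable (gauss_vector ?I)"
        by (intro borel_measurable_add borel_measurable_times borel_measurable_divide borel_measurable_const H.T_measurable)
      have eq: "Matrix.mat q q (\<lambda>(i,j). (if i = j then 1 else 0) + b / H.T k x * H.phiR k x $$ (i,j)) $$ (i,j)
        = (if i = j then 1 else 0) + b / H.T k x * H.phiR k x $$ (i,j)" for x
        by (subst index_mat(1)[OF ij]) (rule prod.case)
      show "(\<lambda>x. Matrix.mat q q (\<lambda>(i,j). (if i = j then 1 else 0) + b / H.T k x * H.phiR k x $$ (i,j)) $$ (i,j)) \<in> borel_measurable (gauss_vector ?I)"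
        unfolding eq by (rule meas)
    qed (rule mat_carrier)
    from measurable_compose[OF \<Phi> measurable_det[OF this]] show ?thesis unfolding uk_def by (rule borel_measurable_ln)
  qed
  have tame_bd: "tame ?I bd"
  proof -
    have Zt: "mat_tame ?I m q (Matrix.mat m q)" using H.mat_tame_Z unfolding HZ .
    have Ft: "mat_tame ?I q q F"
      unfolding F_def[abs_def]
      by (rule mat_tame_mult[OF mat_tame_mult[OF mat_tame_const[OF CD(2)] mat_tame_mult[OF mat_tame_transpose[OF Zt] Zt]] mat_tame_const[OF CD(1)]])
    have "tame ?I (\<lambda>x. \<bar>F x $$ (i,j)\<bar>)" if "i < q" "j < q" for i j
      using mat_tame_index[OF Ft that] by (rule tame_dominated) (use tame_measurable[OF mat_tame_index[OF Ft that]] in auto)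
    then show ?thesis unfolding bd_def[abs_def] by (intro tame_mult tame_const tame_sum) auto
  qed
  have int_bd: "integrable M (\<lambda>\<omega>. bd (\<Phi> \<omega>))"
  proof (rule integrable_distr[OF \<Phi>])
    show "integrable (distr M (gauss_vector ?I) \<Phi>) bd" unfolding law by (rule tame_integrable[OF _ tame_bd]) simp
  qed
  have tk_bd: "norm (tk k \<omega>) \<le> bd (\<Phi> \<omega>)" for k \<omega>
    using H.quad_abs_le[of k "\<Phi> \<omega>"] unfolding tk_def bd_def F_def HZ by simp
  have lim: "AE \<omega> in M. (\<lambda>k. tk k \<omega>) \<longlonglongrightarrow> mat_trace (F (\<Phi> \<omega>) * (V \<omega> * mat_diag q (w \<omega>) * (V \<omega>)\<^sup>T)) \<and>
      (\<lambda>k. uk k \<omega>) \<longlonglongrightarrow> (\<Sum>i<q. ln (1 + b * w \<omega> i)) \<and> (\<lambda>k. sk k \<omega>) \<longlonglongrightarrow> 1"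
    using spec
  proof eventually_elim
    case (elim \<omega>)
    let ?x = "\<Phi> \<omega>" and ?V = "V \<omega>" and ?l = "l \<omega>"
    have V: "orthogonal_matrix q ?V" and Vc: "?V \<in> carrier_mat q q" and l: "\<And>i. i < q \<Longrightarrow> 0 < ?l i"
      using elim by (auto simp: orthogonal_matrix_def)
    define y where "y k i = 1 / (?l i + eps k)" for k i
    \<comment> \<open>The given \<open>V\<close> and \<open>l\<close> serve for every k; only the
      eigenvalues of the regularised inverse change.\<close>
    have S: "H.spec k ?x ?V ?l (y k)" for k
      using elim unfolding H.spec_def H.Gam_def HZ by (auto simp: y_def less_imp_le)
    have ylim: "(\<lambda>k. y k i) \<longlonglongrightarrow> 1 / ?l i" if "i < q" for i
    proof -
      have "(\<lambda>k. 1 / (?l i + eps k)) \<longlonglongrightarrow> 1 / (?l i + 0)"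
        using l[OF that] by (intro tendsto_intros eps0) auto
      then show ?thesis by (simp add: y_def)
    qed
    define p where "p k i = poly (H.phi k) (y k i)" for k i
    have plim: "(\<lambda>k. p k i) \<longlonglongrightarrow> ?l i powr (- \<alpha>)" if "i < q" for i
    proof -
      have "(\<lambda>k. poly (pCons 0 (P k)) (y k i)) \<longlonglongrightarrow> (1 / ?l i) powr \<alpha>"
        using l[OF that] by (intro Plim ylim that) auto
      then show ?thesis using l[OF that] by (simp add: p_def H.phi_def powr_divide powr_minus_divide)
    qed
    have T: "H.T k ?x = (\<Sum>i<q. p k i)" for k
      unfolding H.T_def H.specD(9)[OF S] p_def by (rule mat_trace_spectral[OF V])
    have Tlim: "(\<lambda>k. H.T k ?x) \<longlonglongrightarrow> (\<Sum>i<q. ?l i powr (- \<alpha>))"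
      unfolding T by (intro tendsto_sum plim) simp
    have Tpos: "0 < (\<Sum>i<q. ?l i powr (- \<alpha>))" using l q by (intro sum_pos) (auto simp: less_imp_neq[symmetric])
    have wlim: "(\<lambda>k. p k i / H.T k ?x) \<longlonglongrightarrow> w \<omega> i" if "i < q" for i
      unfolding w_def using Tpos by (intro tendsto_divide plim that Tlim) auto
    have tk: "tk k \<omega> = (\<Sum>i<q. p k i / H.T k ?x * (?V\<^sup>T * F ?x * ?V) $$ (i,i))" for k
    proof -
      have "tk k \<omega> = mat_trace (F ?x * (?V * mat_diag q (p k) * ?V\<^sup>T)) / H.T k ?x"
        unfolding tk_def H.quad_eq_trace H.specD(9)[OF S] HZ F_def p_def ..
      also have "\<dots> = (\<Sum>i<q. p k i / H.T k ?x * (?V\<^sup>T * F ?x * ?V) $$ (i,i))"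
        unfolding mat_trace_mult_spectral[OF F Vc] by (simp add: sum_divide_distrib del: index_mult_mat(1))
      finally show ?thesis .
    qed
    have 1: "(\<lambda>k. tk k \<omega>) \<longlonglongrightarrow> mat_trace (F ?x * (?V * mat_diag q (w \<omega>) * ?V\<^sup>T))"
      unfolding tk mat_trace_mult_spectral[OF F Vc] by (intro tendsto_sum tendsto_mult tendsto_const wlim) simp
    have w0: "0 \<le> w \<omega> i" if "i < q" for i unfolding w_def using Tpos by simp
    have pk: "0 < p k i" if "i < q" for k i unfolding p_def using H.phi_pos H.specD(5)[OF S that] by blast
    have uk: "uk k \<omega> = (\<Sum>i<q. ln (1 + b * (p k i / H.T k ?x)))" for k
    proof -
      have "A k ?x = ?V * mat_diag q (\<lambda>i. 1 + b / H.T k ?x * p k i) * ?V\<^sup>T"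
        unfolding A_def p_def by (rule spectral_add_one[OF V H.specD(9)[OF S]])
      then have "uk k \<omega> = ln (\<Prod>i<q. 1 + b / H.T k ?x * p k i)" unfolding uk_def by (simp add: spectral_det[OF V])
      also have "\<dots> = (\<Sum>i<q. ln (1 + b / H.T k ?x * p k i))"
      proof -
        have "0 < 1 + b / H.T k ?x * p k i" if "i < q" for i
        proof -
          have "0 \<le> b / H.T k ?x * p k i" using b pk[OF that, of k] H.T_pos[of k ?x] by simp
          then show ?thesis by simp
        qed
        then show ?thesis by (intro ln_prod) (auto simp: less_imp_neq[symmetric])
      qed
      finally show ?thesis by simp
    qed
    have 2: "(\<lambda>k. uk k \<omega>) \<longlonglongrightarrow> (\<Sum>i<q. ln (1 + b * w \<omega> i))"
      unfolding uk
    proof (intro tendsto_sum tendsto_ln tendsto_add tendsto_mult tendsto_const wlim)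
      fix i assume "i \<in> {..<q}"
      then have "0 \<le> b * w \<omega> i" using b w0 by simp
      then show "1 + b * w \<omega> i \<noteq> 0" by simp
    qed simp
    have "(\<lambda>k. max 0 (1 - eps k * (\<Sum>i<q. y k i))) \<longlonglongrightarrow> max 0 (1 - 0 * (\<Sum>i<q. 1 / ?l i))"
      by (intro tendsto_max tendsto_diff tendsto_mult tendsto_const tendsto_sum eps0 ylim) simp
    moreover have "mat_trace (H.R k ?x) = (\<Sum>i<q. y k i)" for k
      unfolding H.specD(7)[OF S] by (rule mat_trace_spectral[OF V])
    ultimately have 3: "(\<lambda>k. sk k \<omega>) \<longlonglongrightarrow> 1" unfolding sk_def by simp
    show ?case using 1 2 3 by blast
  qed
  define t where "t \<omega> = lim (\<lambda>k. tk k \<omega>)" for \<omega>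
  define u where "u \<omega> = lim (\<lambda>k. uk k \<omega>)" for \<omega>
  have meas: "t \<in> borel_measurable M" "u \<in> borel_measurable M"
    unfolding t_def u_def by (rule borel_measurable_lim_metric, rule meas_tk meas_uk)+
  have eqs: "AE \<omega> in M. t \<omega> = mat_trace (F (\<Phi> \<omega>) * (V \<omega> * mat_diag q (w \<omega>) * (V \<omega>)\<^sup>T)) \<and> u \<omega> = (\<Sum>i<q. ln (1 + b * w \<omega> i))"
    using lim by eventually_elim (auto simp: t_def u_def intro: limI)
  have tlim: "AE \<omega> in M. (\<lambda>k. tk k \<omega>) \<longlonglongrightarrow> t \<omega>"
    using lim eqs by eventually_elim simp
  have slim: "AE \<omega> in M. (\<lambda>k. sk k \<omega>) \<longlonglongrightarrow> 1" using lim by eventually_elim simp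
  have int_t: "integrable M t"
    by (rule integrable_dominated_convergence[OF meas(1) meas_tk int_bd tlim]) (use tk_bd in auto)
  have lim_t: "(\<lambda>k. \<integral>\<omega>. tk k \<omega> \<partial>M) \<longlonglongrightarrow> (\<integral>\<omega>. t \<omega> \<partial>M)"
    by (rule integral_dominated_convergence[OF meas(1) meas_tk int_bd tlim]) (use tk_bd in auto)
  have sk_le: "AE \<omega> in M. norm (sk k \<omega>) \<le> 1" for k
  proof (rule AE_I2)
    fix \<omega>
    obtain U k' y where S: "H.spec k (\<Phi> \<omega>) U k' y" by (rule H.spec_exists)
    have "0 \<le> mat_trace (H.R k (\<Phi> \<omega>))"
      unfolding H.specD(7)[OF S] mat_trace_spectral[OF H.specD(1)[OF S]]
      using H.specD(5)[OF S] by (intro sum_nonneg) (auto intro: less_imp_le)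
    then have "0 \<le> eps k * mat_trace (H.R k (\<Phi> \<omega>))" by (simp add: eps_def)
    then show "norm (sk k \<omega>) \<le> 1" by (simp add: sk_def)
  qed
  have lim_s: "(\<lambda>k. \<integral>\<omega>. sk k \<omega> \<partial>M) \<longlonglongrightarrow> (\<integral>\<omega>. 1 \<partial>M)"
    by (rule integral_dominated_convergence[OF _ meas_sk _ slim sk_le]) auto
  have le: "(\<integral>\<omega>. tk k \<omega> \<partial>M) \<le> real m - (real q - 1) * (\<integral>\<omega>. sk k \<omega> \<partial>M)" for k
  proof -
    have "(\<integral>\<omega>. tk k \<omega> \<partial>M) = (\<integral>x. H.quad k x \<partial>gauss_vector ?I)"
      unfolding tk_def using integral_distr[OF \<Phi> tame_measurable[OF H.tame_quad[of k]]] by (simp add: law)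
    moreover have "(\<integral>\<omega>. sk k \<omega> \<partial>M) = (\<integral>x. max 0 (1 - eps k * mat_trace (H.R k x)) \<partial>gauss_vector ?I)"
      unfolding sk_def using integral_distr[OF \<Phi> tame_measurable[OF H.tame_shrink[of k]]] by (simp add: law)
    ultimately show ?thesis using H.haff_integral_le[of k] by simp
  qed
  have "(\<lambda>k. real m - (real q - 1) * (\<integral>\<omega>. sk k \<omega> \<partial>M)) \<longlonglongrightarrow> real m - (real q - 1) * (\<integral>\<omega>. 1 \<partial>M)"
    by (intro tendsto_intros lim_s)
  then have "(\<integral>\<omega>. t \<omega> \<partial>M) \<le> real m - (real q - 1) * (\<integral>\<omega>. 1 \<partial>M)"
    by (rule LIMSEQ_le[OF lim_t]) (use le in blast)
  then have "(\<integral>\<omega>. t \<omega> \<partial>M) \<le> real m - real q + 1" by (simp add: prob_space)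
  with int_t meas(2) eqs[unfolded F_def] show ?thesis
    by (intro exI[of _ t] exI[of _ u] conjI)
qed

text \<open>The losses involve eigenvectors and eigenvalues of unknown measurability and are only
  almost surely equal to integrable functions. On the completion this suffices for integrability and
  for equality of the integrals.\<close>

lemma completion_AE_eq:
  fixes f g :: "'a \<Rightarrow> real"
  assumes f: "integrable M f" and eq: "AE x in M. f x = g x"
  shows "integrable (completion M) g" "integral\<^sup>L (completion M) g = integral\<^sup>L M f"
proof -
  have fm: "f \<in> borel_measurable (completion M)" using f by (intro measurable_completion) simp
  have eq': "AE x in completion M. f x = g x" using eq by (rule AE_completion)
  have gm: "g \<in> borel_measurable (completion M)"
  proof (rule measurableI)
    fix B :: "real set" assume B: "B \<in> sets borel"
    show "g -` B \<inter> space (completion M) \<in> sets (completion M)"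
    proof (rule completion.in_sets_AE[OF _ measurable_sets[OF fm B]])
      show "AE x in completion M. (x \<in> f -` B \<inter> space (completion M)) = (x \<in> g -` B \<inter> space (completion M))"
        using eq' by eventually_elim auto
    qed auto
  qed simp
  have intf: "integrable (completion M) f" using f by (subst integrable_completion) auto
  show "integrable (completion M) g"
    using integrable_cong_AE[OF fm gm eq'] intf by simp
  show "integral\<^sup>L (completion M) g = integral\<^sup>L M f"
    using integral_cong_AE[OF fm gm eq'] integral_completion[of f M] f by simp
qed

section \<open>Losses of both estimators as functions of the Gaussian entries\<close>

abbreviation gram_mat :: "nat \<Rightarrow> nat \<Rightarrow> (nat \<times> nat \<Rightarrow> real) \<Rightarrow> real mat" where
  "gram_mat m q x \<equiv> (Matrix.mat m q x)\<^sup>T * Matrix.mat m q x"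

lemma mat_tame_entries: "mat_tame ({..<m} \<times> {..<q}) m q (Matrix.mat m q)"
  by (auto simp: mat_tame_def intro!: tame_component)

lemma mat_tame_gram_mat: "mat_tame ({..<m} \<times> {..<q}) q q (gram_mat m q)"
  by (rule mat_tame_mult[OF mat_tame_transpose[OF mat_tame_entries] mat_tame_entries])

lemma integrable_ln_det_gram_mat:
  assumes qm: "q \<le> m"
  shows "integrable (gauss_vector ({..<m} \<times> {..<q})) (\<lambda>x. ln (Determinant.det (gram_mat m q x)))"
proof -
  let ?I = "{..<m} \<times> {..<q}"
  let ?d = "\<lambda>x. Determinant.det (Matrix.mat q q x)"
  have sub: "{..<q} \<times> {..<q} \<subseteq> ?I" using qm by auto
  note dm = measurable_leading_det[OF sub]
  have fin: "(\<integral>\<^sup>+x. neg_ln (?d x) \<partial>gauss_vector ?I) < \<infinity>"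
  proof -
    have "(\<integral>\<^sup>+x. neg_ln (?d x) \<partial>gauss_vector ?I) \<le> of_nat q * neg_ln_const"
      by (rule nn_integral_neg_ln_leading_det[OF _ sub]) simp
    also have "\<dots> < \<infinity>" using neg_ln_const_finite by (simp add: ennreal_mult_less_top of_nat_less_top)
    finally show ?thesis .
  qed
  have "AE x in gauss_vector ?I. neg_ln (?d x) \<noteq> \<infinity>"
    by (rule nn_integral_noteq_infinite[OF measurable_compose[OF dm neg_ln_measurable]]) (use fin in auto)
  then have nz: "AE x in gauss_vector ?I. ?d x \<noteq> 0" by eventually_elim (auto simp: neg_ln_def)
  have int1: "integrable (gauss_vector ?I) (\<lambda>x. max 0 (- ln \<bar>?d x\<bar>))"
  proof (rule integrableI_bounded)
    show "(\<lambda>x. max 0 (- ln \<bar>?d x\<bar>)) \<in> borel_measurable (gauss_vector ?I)" using dm by measurable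
    have "(\<integral>\<^sup>+x. ennreal (norm (max 0 (- ln \<bar>?d x\<bar>))) \<partial>gauss_vector ?I) \<le> (\<integral>\<^sup>+x. neg_ln (?d x) \<partial>gauss_vector ?I)"
      by (rule nn_integral_mono) (auto simp: neg_ln_def max_def intro: ennreal_leI)
    also note fin
    finally show "(\<integral>\<^sup>+x. ennreal (norm (max 0 (- ln \<bar>?d x\<bar>))) \<partial>gauss_vector ?I) < \<infinity>" .
  qed
  have int2: "integrable (gauss_vector ?I) (\<lambda>x. mat_trace (gram_mat m q x))"
    by (rule tame_integrable[OF _ mat_tame_trace[OF mat_tame_gram_mat]]) simp
  have dom: "integrable (gauss_vector ?I) (\<lambda>x. mat_trace (gram_mat m q x) + 2 * max 0 (- ln \<bar>?d x\<bar>))"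
    by (intro Bochner_Integration.integrable_add Bochner_Integration.integrable_mult_right int1 int2)
  show ?thesis
  proof (rule Bochner_Integration.integrable_bound[OF dom])
    show "(\<lambda>x. ln (Determinant.det (gram_mat m q x))) \<in> borel_measurable (gauss_vector ?I)"
      by (rule borel_measurable_ln[OF measurable_det[OF mat_tame_measurable[OF mat_tame_gram_mat]]])
    show "AE x in gauss_vector ?I. norm (ln (Determinant.det (gram_mat m q x))) \<le> norm (mat_trace (gram_mat m q x) + 2 * max 0 (- ln \<bar>?d x\<bar>))"
      using nz
    proof eventually_elim
      case (elim x)
      have "\<bar>ln (Determinant.det (gram_mat m q x))\<bar> \<le> mat_trace (gram_mat m q x) + 2 * max 0 (- ln \<bar>?d x\<bar>)"
        by (rule abs_ln_det_gram_le[OF mat_carrier elim det_gram_ge_leading[OF qm]])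
      then show ?case by (simp add: abs_le_iff)
    qed
  qed
qed

text \<open>Common interface of the two bridge lemmas. The quantifier over \<open>d\<close> serves
  both estimators: \<open>d\<close> is constant for the multiple of S and a (1 + b w) for the Haff
  type estimator.\<close>

definition spectral_bridge ::
    "nat \<Rightarrow> nat \<Rightarrow> real mat \<Rightarrow> real mat \<Rightarrow> real mat \<Rightarrow> real mat \<Rightarrow> (nat \<times> nat \<Rightarrow> real) \<Rightarrow> real mat \<Rightarrow> (nat \<Rightarrow> real) \<Rightarrow> real mat \<Rightarrow> bool" where
  "spectral_bridge m q K C D Sig x H l V \<longleftrightarrow>
     orthogonal_matrix q V \<and> (\<forall>i<q. 0 < l i) \<and>
     C\<^sup>T * ((Matrix.mat m q x)\<^sup>T * (K * (Matrix.mat m q x * C))) = V * mat_diag q l * V\<^sup>T \<and>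
     0 < Determinant.det (gram_mat m q x) \<and>
     (\<forall>d. (\<forall>i<q. 0 < d i) \<longrightarrow>
       mat_trace (mp_inverse Sig * (H * mat_diag q (\<lambda>i. l i * d i) * H\<^sup>T)) = mat_trace (D * gram_mat m q x * C * (V * mat_diag q d * V\<^sup>T)) \<and>
       prod_mset (pos_eigenvalues (mp_inverse Sig * (H * mat_diag q (\<lambda>i. l i * d i) * H\<^sup>T)))
         = (\<Prod>i<q. d i) * Determinant.det (gram_mat m q x))"

text \<open>Setting b = 0 gives the loss of a S, so one formula evaluates both losses and their
  difference is the last bracket. The logarithm of the Gram determinant cancels in it; what matters
  is its integrability.\<close>

lemma stein_loss_spectral:
  assumes br: "spectral_bridge m q K C D Sig x H l V" and C: "C \<in> carrier_mat q q" and D: "D \<in> carrier_mat q q"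
    and CD: "C * D = 1\<^sub>m q" and a: "0 < a" and w: "\<And>i. i < q \<Longrightarrow> 0 \<le> w i" and b: "0 \<le> b"
  shows "stein_loss q (H * mat_diag q (\<lambda>i. l i * (a * (1 + b * w i))) * H\<^sup>T) Sig
     = a * mat_trace (gram_mat m q x) - real q * ln a - ln (Determinant.det (gram_mat m q x)) - real q
       + (a * b * mat_trace (D * gram_mat m q x * C * (V * mat_diag q w * V\<^sup>T)) - (\<Sum>i<q. ln (1 + b * w i)))"
proof -
  define d where "d i = a * (1 + b * w i)" for i
  define F where "F = D * gram_mat m q x * C"
  have F: "F \<in> carrier_mat q q" using C D by (auto simp: F_def intro!: carrier_matI)
  have pos: "0 < 1 + b * w i" if "i < q" for i
  proof -
    have "0 \<le> b * w i" using w[OF that] b by simp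
    then show ?thesis by simp
  qed
  have d: "0 < d i" if "i < q" for i using pos[OF that] a by (simp add: d_def)
  have V: "orthogonal_matrix q V" and det: "0 < Determinant.det (gram_mat m q x)" using br by (auto simp: spectral_bridge_def)
  have Vc: "V \<in> carrier_mat q q" "V * V\<^sup>T = 1\<^sub>m q" using V by (auto simp: orthogonal_matrix_def)
  define e where "e i = (V\<^sup>T * F * V) $$ (i,i)" for i
  have tr: "mat_trace (F * (V * mat_diag q u * V\<^sup>T)) = (\<Sum>i<q. u i * e i)" for u
    unfolding e_def by (rule mat_trace_mult_spectral[OF F Vc(1)])
  have "mat_trace (F * (V * mat_diag q (\<lambda>_. 1) * V\<^sup>T)) = mat_trace F"
    using F by (simp only: spectral_one[OF V] right_mult_one_mat[OF F])
  also have "mat_trace F = mat_trace (gram_mat m q x)"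
  proof -
    have "mat_trace (D * (gram_mat m q x * C)) = mat_trace (gram_mat m q x * C * D)"
      by (rule mat_trace_commute) (use C D in auto)
    also have "gram_mat m q x * C * D = gram_mat m q x" using C D CD by (simp add: mat_mult_assoc mat_one_mult)
    finally show ?thesis unfolding F_def using C D by (simp add: mat_mult_assoc)
  qed
  finally have e1: "(\<Sum>i<q. e i) = mat_trace (gram_mat m q x)" unfolding tr by simp
  have "mat_trace (F * (V * mat_diag q d * V\<^sup>T)) = (\<Sum>i<q. a * e i + a * b * (w i * e i))"
    unfolding tr d_def by (intro sum.cong refl) (simp add: algebra_simps)
  also have "\<dots> = a * mat_trace (gram_mat m q x) + a * b * mat_trace (F * (V * mat_diag q w * V\<^sup>T))"
    unfolding tr sum.distrib by (simp add: sum_distrib_left[symmetric] e1)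
  finally have t1: "mat_trace (F * (V * mat_diag q d * V\<^sup>T)) = a * mat_trace (gram_mat m q x) + a * b * mat_trace (F * (V * mat_diag q w * V\<^sup>T))" .
  have "ln ((\<Prod>i<q. d i) * Determinant.det (gram_mat m q x)) = ln (\<Prod>i<q. d i) + ln (Determinant.det (gram_mat m q x))"
    using d det by (intro ln_mult_pos prod_pos) auto
  also have "ln (\<Prod>i<q. d i) = (\<Sum>i<q. ln (d i))"
    using d by (intro ln_prod) (auto simp: less_imp_neq[symmetric])
  also have "\<dots> = (\<Sum>i<q. ln a + ln (1 + b * w i))"
    unfolding d_def using a pos by (intro sum.cong refl ln_mult_pos) auto
  finally have t2: "ln ((\<Prod>i<q. d i) * Determinant.det (gram_mat m q x)) = real q * ln a + (\<Sum>i<q. ln (1 + b * w i)) + ln (Determinant.det (gram_mat m q x))"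
    by (simp add: sum.distrib)
  have "mat_trace (mp_inverse Sig * (H * mat_diag q (\<lambda>i. l i * d i) * H\<^sup>T)) = mat_trace (F * (V * mat_diag q d * V\<^sup>T))"
    "prod_mset (pos_eigenvalues (mp_inverse Sig * (H * mat_diag q (\<lambda>i. l i * d i) * H\<^sup>T))) = (\<Prod>i<q. d i) * Determinant.det (gram_mat m q x)"
    using br d unfolding spectral_bridge_def F_def by blast+
  then show ?thesis unfolding stein_loss_def det_pos_eigenvalue_mat d_def[symmetric] F_def[symmetric] using t1 t2 by simp
qed

lemma haff_estimator_spectral:
  fixes H :: "real mat"
  assumes H: "H \<in> carrier_mat p q"
  shows "haff_estimator q a \<alpha> b (H * mat_diag q l * H\<^sup>T) H l
     = H * mat_diag q (\<lambda>i. l i * (a * (1 + b * (l i powr (- \<alpha>) / (\<Sum>j<q. l j powr (- \<alpha>)))))) * H\<^sup>T"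
proof -
  let ?w = "\<lambda>i. l i powr (- \<alpha>) / (\<Sum>j<q. l j powr (- \<alpha>))"
  have Psi: "haff_Psi q \<alpha> b l = mat_diag q (\<lambda>i. b * ?w i)"
    unfolding haff_Psi_def Let_def by (rule eq_matI) auto
  have index: "(H * mat_diag q d * H\<^sup>T) $$ (i,j) = (\<Sum>k<q. H $$ (i,k) * H $$ (j,k) * d k)" if ij: "i < p" "j < p" for d i j
  proof -
    have "(H * mat_diag q d * H\<^sup>T) $$ (i,j) = (\<Sum>k<q. (H * mat_diag q d) $$ (i,k) * H $$ (j,k))"
      using H ij by (subst mat_mult_index) auto
    also have "\<dots> = (\<Sum>k<q. H $$ (i,k) * H $$ (j,k) * d k)"
      by (intro sum.cong) (auto simp: mat_diag_mult_right[OF H] ij mult_ac)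
    finally show ?thesis .
  qed
  have "H * mat_diag q l * mat_diag q (\<lambda>i. b * ?w i) * H\<^sup>T = H * mat_diag q (\<lambda>i. l i * (b * ?w i)) * H\<^sup>T"
  proof -
    have "H * mat_diag q l * mat_diag q (\<lambda>i. b * ?w i) * H\<^sup>T = H * (mat_diag q l * mat_diag q (\<lambda>i. b * ?w i)) * H\<^sup>T"
      using H by (simp add: mat_mult_assoc del: mat_diag_diag)
    then show ?thesis unfolding mat_diag_diag .
  qed
  then have "haff_estimator q a \<alpha> b (H * mat_diag q l * H\<^sup>T) H l
      = a \<cdot>\<^sub>m (H * mat_diag q l * H\<^sup>T + H * mat_diag q (\<lambda>i. l i * (b * ?w i)) * H\<^sup>T)"
    unfolding haff_estimator_def Psi by simp
  also have "\<dots> = H * mat_diag q (\<lambda>i. l i * (a * (1 + b * ?w i))) * H\<^sup>T"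
  proof (rule eq_matI)
    fix i j assume "i < dim_row (H * mat_diag q (\<lambda>i. l i * (a * (1 + b * ?w i))) * H\<^sup>T)"
      "j < dim_col (H * mat_diag q (\<lambda>i. l i * (a * (1 + b * ?w i))) * H\<^sup>T)"
    then have ij: "i < p" "j < p" using H by auto
    have "(a \<cdot>\<^sub>m (H * mat_diag q l * H\<^sup>T + H * mat_diag q (\<lambda>i. l i * (b * ?w i)) * H\<^sup>T)) $$ (i,j)
      = a * ((\<Sum>k<q. H $$ (i,k) * H $$ (j,k) * l k) + (\<Sum>k<q. H $$ (i,k) * H $$ (j,k) * (l k * (b * ?w k))))"
      using H ij by (simp add: index[OF ij] del: index_mult_mat(1))
    also have "\<dots> = (\<Sum>k<q. H $$ (i,k) * H $$ (j,k) * (l k * (a * (1 + b * ?w k))))"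
      unfolding sum.distrib[symmetric] sum_distrib_left by (intro sum.cong refl) (simp add: algebra_simps)
    finally show "(a \<cdot>\<^sub>m (H * mat_diag q l * H\<^sup>T + H * mat_diag q (\<lambda>i. l i * (b * ?w i)) * H\<^sup>T)) $$ (i,j)
      = (H * mat_diag q (\<lambda>i. l i * (a * (1 + b * ?w i))) * H\<^sup>T) $$ (i,j)"
      unfolding index[OF ij] .
  qed (use H in auto)
  finally show ?thesis .
qed

text \<open>The dummy term with coefficient 0 puts the multiple of S into the shape that
  \<open>stein_loss_spectral\<close> expects.\<close>

lemma smult_spectral:
  fixes H :: "real mat"
  assumes H: "H \<in> carrier_mat p q"
  shows "a \<cdot>\<^sub>m (H * mat_diag q l * H\<^sup>T) = H * mat_diag q (\<lambda>i. l i * (a * (1 + 0 * w i))) * H\<^sup>T"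
proof -
  have "mat_diag q (\<lambda>i. l i * (a * (1 + 0 * w i))) = a \<cdot>\<^sub>m mat_diag q l" by (rule eq_matI) auto
  moreover have "H * (a \<cdot>\<^sub>m mat_diag q l) * H\<^sup>T = a \<cdot>\<^sub>m (H * mat_diag q l * H\<^sup>T)"
    using H by (simp add: mult_smult_distrib[of _ p q _ q] mult_smult_assoc_mat[of _ p q _ p])
  ultimately show ?thesis by simp
qed

text \<open>\<open>fo\<close> is the loss of a S as a function of the Gaussian entries and a b t - u
  is the loss difference, so the claim reduces to comparing a b (m - q + 1) with ln (1 + b).\<close>

theorem stein_risk_improvement:
  fixes M :: "'w measure" and \<Phi> :: "'w \<Rightarrow> nat \<times> nat \<Rightarrow> real" and H :: "'w \<Rightarrow> real mat" and l :: "'w \<Rightarrow> nat \<Rightarrow> real"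
  assumes M: "prob_space M" and \<Phi>: "\<Phi> \<in> measurable M (gauss_vector ({..<m} \<times> {..<q}))"
    and law: "distr M (gauss_vector ({..<m} \<times> {..<q})) \<Phi> = gauss_vector ({..<m} \<times> {..<q})"
    and q: "0 < q" and qm: "q \<le> m" and J: "J \<in> carrier_mat m m" and K: "K = J\<^sup>T * J"
    and CD: "C \<in> carrier_mat q q" "D \<in> carrier_mat q q" "C * D = 1\<^sub>m q" "D * C = 1\<^sub>m q"
    and \<alpha>: "1 \<le> \<alpha>" and b: "0 < b" "b \<le> 2 * (real q - 1) / (real m - real q + 1)"
    and eig: "AE \<omega> in M. eigen_decomposition q (S \<omega>) (H \<omega>) (l \<omega>)"
    and br: "AE \<omega> in M. \<exists>V. spectral_bridge m q K C D Sig (\<Phi> \<omega>) (H \<omega>) (l \<omega>) V"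
  defines "a \<equiv> 1 / real m"
  shows "finite_stein_risk M q (\<lambda>\<omega>. haff_estimator q a \<alpha> b (S \<omega>) (H \<omega>) (l \<omega>)) Sig"
    "finite_stein_risk M q (\<lambda>\<omega>. a \<cdot>\<^sub>m S \<omega>) Sig"
    "stein_risk M q (\<lambda>\<omega>. haff_estimator q a \<alpha> b (S \<omega>) (H \<omega>) (l \<omega>)) Sig - stein_risk M q (\<lambda>\<omega>. a \<cdot>\<^sub>m S \<omega>) Sig \<le> 0"
proof -
  interpret prob_space M by fact
  let ?I = "{..<m} \<times> {..<q}"
  have a: "0 < a" using q qm by (simp add: a_def)
  \<comment> \<open>Chosen pointwise; only almost sure properties of \<open>V\<close> are used
    below, never its measurability.\<close>
  define V where "V \<omega> = (SOME V. spectral_bridge m q K C D Sig (\<Phi> \<omega>) (H \<omega>) (l \<omega>) V)" for \<omega>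
  have brV: "AE \<omega> in M. spectral_bridge m q K C D Sig (\<Phi> \<omega>) (H \<omega>) (l \<omega>) (V \<omega>)"
    using br unfolding V_def by eventually_elim (rule someI_ex)
  define w where "w \<omega> i = l \<omega> i powr (- \<alpha>) / (\<Sum>j<q. l \<omega> j powr (- \<alpha>))" for \<omega> i
  have spec: "AE \<omega> in M. orthogonal_matrix q (V \<omega>) \<and> (\<forall>i<q. 0 < l \<omega> i) \<and>
        C\<^sup>T * ((Matrix.mat m q (\<Phi> \<omega>))\<^sup>T * (K * (Matrix.mat m q (\<Phi> \<omega>) * C))) = V \<omega> * mat_diag q (l \<omega>) * (V \<omega>)\<^sup>T"
    using brV by eventually_elim (simp add: spectral_bridge_def)
  obtain t u where t: "integrable M t" "(\<integral>\<omega>. t \<omega> \<partial>M) \<le> real m - real q + 1" and u: "u \<in> borel_measurable M"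
    and tu: "AE \<omega> in M. t \<omega> = mat_trace (D * gram_mat m q (\<Phi> \<omega>) * C * (V \<omega> * mat_diag q (w \<omega>) * (V \<omega>)\<^sup>T)) \<and>
       u \<omega> = (\<Sum>i<q. ln (1 + b * w \<omega> i))"
    using haff_weighted_trace_bound[OF M \<Phi> law q J K CD \<alpha> less_imp_le[OF b(1)] spec] unfolding w_def by blast
  have wprop: "AE \<omega> in M. (\<forall>i<q. 0 \<le> w \<omega> i \<and> w \<omega> i \<le> 1) \<and> (\<Sum>i<q. w \<omega> i) = 1"
    using spec
  proof eventually_elim
    case (elim \<omega>)
    have "0 < l \<omega> j powr (- \<alpha>)" if "j < q" for j using elim that by (metis less_irrefl powr_gt_zero)
    then have T: "0 < (\<Sum>j<q. l \<omega> j powr (- \<alpha>))" using q by (intro sum_pos) auto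
    have "l \<omega> i powr (- \<alpha>) \<le> (\<Sum>j<q. l \<omega> j powr (- \<alpha>))" if "i < q" for i
      by (rule member_le_sum) (use that in auto)
    then show ?case unfolding w_def sum_divide_distrib[symmetric] using T by auto
  qed
  \<comment> \<open>The lower bound enters the risk comparison, the upper one serves integrability
    of \<open>u\<close>.\<close>
  have u_bounds: "AE \<omega> in M. ln (1 + b) \<le> u \<omega> \<and> u \<omega> \<le> real q * ln (1 + b)"
    using wprop tu
  proof eventually_elim
    case (elim \<omega>)
    have "ln (1 + b) \<le> (\<Sum>i<q. ln (1 + b * w \<omega> i))" using elim b by (intro sum_ln_weights_ge) auto
    moreover have "(\<Sum>i<q. ln (1 + b * w \<omega> i)) \<le> (\<Sum>i<q. ln (1 + b))"
    proof (rule sum_mono)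
      fix i assume "i \<in> {..<q}"
      then have wi: "0 \<le> w \<omega> i" "w \<omega> i \<le> 1" using elim by auto
      then have "0 \<le> b * w \<omega> i" "b * w \<omega> i \<le> b * 1" using b by (auto intro!: mult_left_mono simp del: mult_1_right)
      then show "ln (1 + b * w \<omega> i) \<le> ln (1 + b)" using b by simp
    qed
    ultimately show ?case using elim by simp
  qed
  have int_u: "integrable M u"
  proof (rule integrable_const_bound[where B = "real q * ln (1 + b)"])
    have "0 \<le> ln (1 + b)" using b by simp
    then show "AE \<omega> in M. norm (u \<omega>) \<le> real q * ln (1 + b)"
      using u_bounds by (elim eventually_mono) auto
  qed (rule u)
  define fo where "fo \<omega> = a * mat_trace (gram_mat m q (\<Phi> \<omega>)) - real q * ln a - ln (Determinant.det (gram_mat m q (\<Phi> \<omega>))) - real q" for \<omega>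
  have int_fo: "integrable M fo"
  proof -
    have "integrable M (\<lambda>\<omega>. mat_trace (gram_mat m q (\<Phi> \<omega>)))"
      by (rule integrable_distr[OF \<Phi>]) (unfold law, rule tame_integrable[OF _ mat_tame_trace[OF mat_tame_gram_mat]], simp)
    moreover have "integrable M (\<lambda>\<omega>. ln (Determinant.det (gram_mat m q (\<Phi> \<omega>))))"
      by (rule integrable_distr[OF \<Phi>]) (unfold law, rule integrable_ln_det_gram_mat[OF qm])
    ultimately show ?thesis unfolding fo_def[abs_def]
      by (intro Bochner_Integration.integrable_diff Bochner_Integration.integrable_mult_right integrable_const)
  qed
  define fa where "fa \<omega> = fo \<omega> + (a * b * t \<omega> - u \<omega>)" for \<omega>
  have int_d: "integrable M (\<lambda>\<omega>. a * b * t \<omega> - u \<omega>)"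
    by (intro Bochner_Integration.integrable_diff Bochner_Integration.integrable_mult_right t int_u)
  have int_fa: "integrable M fa" unfolding fa_def[abs_def] by (intro Bochner_Integration.integrable_add int_fo int_d)
  have loss_o: "AE \<omega> in M. fo \<omega> = stein_loss q (a \<cdot>\<^sub>m S \<omega>) Sig"
    using eig brV
  proof eventually_elim
    case (elim \<omega>)
    then have H: "H \<omega> \<in> carrier_mat (dim_row (S \<omega>)) q" and S: "S \<omega> = H \<omega> * mat_diag q (l \<omega>) * (H \<omega>)\<^sup>T"
      by (auto simp: eigen_decomposition_def)
    have "stein_loss q (a \<cdot>\<^sub>m S \<omega>) Sig = stein_loss q (H \<omega> * mat_diag q (\<lambda>i. l \<omega> i * (a * (1 + 0 * 0))) * (H \<omega>)\<^sup>T) Sig"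
      by (subst S) (simp only: smult_spectral[OF H, of a "l \<omega>" "\<lambda>_. 0"])
    also have "\<dots> = fo \<omega>"
      unfolding fo_def by (subst stein_loss_spectral[OF elim(2) CD(1-3) a]) auto
    finally show ?case by simp
  qed
  have loss_a: "AE \<omega> in M. fa \<omega> = stein_loss q (haff_estimator q a \<alpha> b (S \<omega>) (H \<omega>) (l \<omega>)) Sig"
    using eig brV tu wprop
  proof eventually_elim
    case (elim \<omega>)
    then have H: "H \<omega> \<in> carrier_mat (dim_row (S \<omega>)) q" and S: "S \<omega> = H \<omega> * mat_diag q (l \<omega>) * (H \<omega>)\<^sup>T"
      by (auto simp: eigen_decomposition_def)
    have "haff_estimator q a \<alpha> b (S \<omega>) (H \<omega>) (l \<omega>) = H \<omega> * mat_diag q (\<lambda>i. l \<omega> i * (a * (1 + b * w \<omega> i))) * (H \<omega>)\<^sup>T"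
      by (subst S) (simp only: haff_estimator_spectral[OF H] w_def)
    moreover have "stein_loss q (H \<omega> * mat_diag q (\<lambda>i. l \<omega> i * (a * (1 + b * w \<omega> i))) * (H \<omega>)\<^sup>T) Sig = fa \<omega>"
      unfolding fa_def fo_def using elim b by (subst stein_loss_spectral[OF elim(2) CD(1-3) a]) auto
    ultimately show ?case by simp
  qed
  note ca = completion_AE_eq[OF int_fa loss_a] and co = completion_AE_eq[OF int_fo loss_o]
  show "finite_stein_risk M q (\<lambda>\<omega>. haff_estimator q a \<alpha> b (S \<omega>) (H \<omega>) (l \<omega>)) Sig"
    unfolding finite_stein_risk_def by (rule ca(1))
  show "finite_stein_risk M q (\<lambda>\<omega>. a \<cdot>\<^sub>m S \<omega>) Sig"
    unfolding finite_stein_risk_def by (rule co(1))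
  have "stein_risk M q (\<lambda>\<omega>. haff_estimator q a \<alpha> b (S \<omega>) (H \<omega>) (l \<omega>)) Sig - stein_risk M q (\<lambda>\<omega>. a \<cdot>\<^sub>m S \<omega>) Sig
      = (\<integral>\<omega>. fa \<omega> \<partial>M) - (\<integral>\<omega>. fo \<omega> \<partial>M)"
    unfolding stein_risk_def ca(2) co(2) ..
  also have "\<dots> = a * b * (\<integral>\<omega>. t \<omega> \<partial>M) - (\<integral>\<omega>. u \<omega> \<partial>M)"
    unfolding fa_def using int_fo int_d t int_u by simp
  also have "\<dots> \<le> a * b * (real m - real q + 1) - ln (1 + b)"
  proof -
    have "(\<integral>\<omega>. ln (1 + b) \<partial>M) \<le> (\<integral>\<omega>. u \<omega> \<partial>M)"
      using u_bounds by (intro integral_mono_AE int_u integrable_const) auto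
    moreover have "a * b * (\<integral>\<omega>. t \<omega> \<partial>M) \<le> a * b * (real m - real q + 1)"
      using t a b by (intro mult_left_mono) auto
    ultimately show ?thesis by (simp add: prob_space)
  qed
  also have "\<dots> \<le> 0"
  proof -
    have mq: "0 < real m - real q + 1" using qm by simp
    have "b * (real m - real q + 1) \<le> 2 * (real q - 1)" using b(2) mq by (simp add: le_divide_eq)
    \<comment> \<open>The bound on b rearranged into the form that matches 2 / (2 + b).\<close>
    then have "(real m - real q + 1) * (2 + b) \<le> 2 * real m" by (simp add: algebra_simps)
    then have "(real m - real q + 1) / real m \<le> 2 / (2 + b)" using b q qm by (simp add: field_simps)
    then have "b * ((real m - real q + 1) / real m) \<le> b * (2 / (2 + b))" using b by (intro mult_left_mono) auto
    also have "\<dots> \<le> ln (1 + b)" using ln_add_one_ge_pade[of b] b by (simp add: mult.commute)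
    finally show ?thesis by (simp add: a_def mult_ac)
  qed
  finally show "stein_risk M q (\<lambda>\<omega>. haff_estimator q a \<alpha> b (S \<omega>) (H \<omega>) (l \<omega>)) Sig - stein_risk M q (\<lambda>\<omega>. a \<cdot>\<^sub>m S \<omega>) Sig \<le> 0" .
qed

theorem proposition2:
  fixes p n r q m :: nat
    and B Sig :: "real mat"
    and M :: "'w measure"
    and Z X S H :: "'w \<Rightarrow> real mat"
    and l :: "'w \<Rightarrow> nat \<Rightarrow> real"
    and \<alpha> b a\<^sub>o :: real
    and Sighat_alpha Sighat_ao :: "'w \<Rightarrow> real mat"
  assumes "1 \<le> p" and "1 \<le> n" and "1 \<le> r" and "r \<le> p"
    and "B \<in> carrier_mat p r"
    and "Sig = B * B\<^sup>T"
    and "vec_space.rank p Sig = r"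
    and "prob_space M"
    and "iid_std_normal_columns M r n Z"
    and "X = (\<lambda>\<omega>. B * Z \<omega>)"
    and "S = (\<lambda>\<omega>. X \<omega> * (X \<omega>)\<^sup>T)"
    and "q = min n r" and "m = max n r" and "a\<^sub>o = 1 / real m"
    and "AE \<omega> in M. eigen_decomposition q (S \<omega>) (H \<omega>) (l \<omega>)"
    and "1 \<le> \<alpha>"
    and "0 < b" and "b \<le> 2 * (real q - 1) / (real m - real q + 1)"
    and "Sighat_alpha = (\<lambda>\<omega>. haff_estimator q a\<^sub>o \<alpha> b (S \<omega>) (H \<omega>) (l \<omega>))"
    and "Sighat_ao = (\<lambda>\<omega>. a\<^sub>o \<cdot>\<^sub>m S \<omega>)"
  shows "finite_stein_risk M q Sighat_alpha Sig \<and>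
         finite_stein_risk M q Sighat_ao Sig \<and>
         stein_risk M q Sighat_alpha Sig - stein_risk M q Sighat_ao Sig \<le> 0"
proof -
  note B = assms(5) and Sig = assms(6) and rank = assms(7)[unfolded assms(6)] and M = assms(8) and Z = assms(9)
  have S: "S \<omega> = B * Z \<omega> * (B * Z \<omega>)\<^sup>T" for \<omega> using assms(10,11) by simp
  have Zc: "Z \<omega> \<in> carrier_mat r n" if "\<omega> \<in> space M" for \<omega>
    using Z that by (auto simp: iid_std_normal_columns_def)
  have qm: "0 < q" "q \<le> m" using assms(2,3,12,13) by auto
  obtain U e where U: "orthogonal_matrix r U" "B\<^sup>T * B = U * mat_diag r e * U\<^sup>T" and e: "\<And>i. i < r \<Longrightarrow> 0 \<le> e i"
    using gram_spectral_decomposition[OF B] by blast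
  \<comment> \<open>A square root of B^T B. For n \<le> r only its Gram matrix enters, as
    \<open>K\<close>; for r < n it supplies the change of coordinates C = J^T, D = J^-T.\<close>
  define J where "J = mat_diag r (\<lambda>i. sqrt (e i)) * U\<^sup>T"
  have J: "J \<in> carrier_mat r r" "J\<^sup>T * J = B\<^sup>T * B" 
    unfolding J_def U(2) using mat_sqrt_gram(1,2)[OF U(1), of e] e by simp_all
  have "(Determinant.det J)\<^sup>2 = Determinant.det (J\<^sup>T * J)"
    by (rule det_gram_square[OF J(1), symmetric])
  then have "Determinant.det J \<noteq> 0" using det_gram_of_full_rank[OF B rank] J(2) by auto
  then obtain Ji where Ji: "Ji \<in> carrier_mat r r" "J * Ji = 1\<^sub>m r" "Ji * J = 1\<^sub>m r"
    using det_nonzero_inverse[OF J(1)] by blast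
  have AE_S: "AE \<omega> in M. \<omega> \<in> space M \<and> eigen_decomposition q (B * Z \<omega> * (B * Z \<omega>)\<^sup>T) (H \<omega>) (l \<omega>)"
    using assms(15) AE_space unfolding S by eventually_elim simp
  have "\<exists>\<Phi> L C D. \<Phi> \<in> measurable M (gauss_vector ({..<m} \<times> {..<q})) \<and>
      distr M (gauss_vector ({..<m} \<times> {..<q})) \<Phi> = gauss_vector ({..<m} \<times> {..<q}) \<and>
      L \<in> carrier_mat m m \<and> C \<in> carrier_mat q q \<and> D \<in> carrier_mat q q \<and> C * D = 1\<^sub>m q \<and> D * C = 1\<^sub>m q \<and>
      (AE \<omega> in M. \<exists>V. spectral_bridge m q (L\<^sup>T * L) C D Sig (\<Phi> \<omega>) (H \<omega>) (l \<omega>) V)"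
  proof (cases "n \<le> r")
    case True
    then have mq: "m = r" "q = n" using assms(12,13) by auto
    define \<Phi> where "\<Phi> \<omega> = (\<lambda>i\<in>{..<r} \<times> {..<n}. Z \<omega> $$ i)" for \<omega>
    have \<Phi>: "\<Phi> \<in> measurable M (gauss_vector ({..<r} \<times> {..<n}))"
      "distr M (gauss_vector ({..<r} \<times> {..<n})) \<Phi> = gauss_vector ({..<r} \<times> {..<n})"
      using iid_std_normal_columns_entries[OF M Z assms(2), of id "{..<r} \<times> {..<n}"] by (simp_all add: \<Phi>_def[abs_def])
    have "AE \<omega> in M. \<exists>V. spectral_bridge r n (J\<^sup>T * J) (1\<^sub>m n) (1\<^sub>m n) Sig (\<Phi> \<omega>) (H \<omega>) (l \<omega>) V"
      using AE_S unfolding mq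
    proof eventually_elim
      case (elim \<omega>)
      have Zw: "Z \<omega> \<in> carrier_mat r n" using elim Zc by blast
      have mat: "Matrix.mat r n (\<Phi> \<omega>) = Z \<omega>" using Zw by (intro eq_matI) (auto simp: \<Phi>_def)
      obtain V where "orthogonal_matrix n V" "(Z \<omega>)\<^sup>T * (B\<^sup>T * B) * Z \<omega> = V * mat_diag n (l \<omega>) * V\<^sup>T"
        "0 < Determinant.det ((Z \<omega>)\<^sup>T * Z \<omega>)"
        "\<And>d. (\<And>i. i < n \<Longrightarrow> 0 < d i) \<Longrightarrow>
          mat_trace (mp_inverse (B * B\<^sup>T) * (H \<omega> * mat_diag n (\<lambda>i. l \<omega> i * d i) * (H \<omega>)\<^sup>T)) = mat_trace ((Z \<omega>)\<^sup>T * Z \<omega> * (V * mat_diag n d * V\<^sup>T)) \<and>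
          prod_mset (pos_eigenvalues (mp_inverse (B * B\<^sup>T) * (H \<omega> * mat_diag n (\<lambda>i. l \<omega> i * d i) * (H \<omega>)\<^sup>T)))
            = (\<Prod>i<n. d i) * Determinant.det ((Z \<omega>)\<^sup>T * Z \<omega>)"
        using haff_bridge_wide[OF B Zw rank conjunct2[OF elim]] by blast
      note V = this
      have pos: "\<forall>i<n. 0 < l \<omega> i" using elim by (simp add: eigen_decomposition_def)
      have G: "1\<^sub>m n * ((Z \<omega>)\<^sup>T * Z \<omega>) * 1\<^sub>m n = (Z \<omega>)\<^sup>T * Z \<omega>" using Zw by simp
      have E: "(1\<^sub>m n)\<^sup>T * ((Z \<omega>)\<^sup>T * (B\<^sup>T * B * (Z \<omega> * 1\<^sub>m n))) = (Z \<omega>)\<^sup>T * (B\<^sup>T * B) * Z \<omega>"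
        using Zw B by (simp add: mat_mult_assoc mat_one_mult)
      have "spectral_bridge r n (J\<^sup>T * J) (1\<^sub>m n) (1\<^sub>m n) Sig (\<Phi> \<omega>) (H \<omega>) (l \<omega>) V"
        unfolding spectral_bridge_def mat J(2) Sig G E
        using V(1-3) pos by (intro conjI allI impI V(4)[THEN conjunct1] V(4)[THEN conjunct2]) simp_all
      then show ?case by blast
    qed
    then show ?thesis unfolding mq using \<Phi> J(1)
      by (intro exI[of _ \<Phi>] exI[of _ J] exI[of _ "1\<^sub>m n"]) simp
  next
    case False
    then have mq: "m = n" "q = r" using assms(12,13) by auto
    \<comment> \<open>The m by q Gaussian matrix is now the transpose of Z, so the entries are read
      with exchanged indices.\<close>
    let ?s = "\<lambda>(a, c). (c, a)"
    define \<Phi> where "\<Phi> \<omega> = (\<lambda>i\<in>{..<n} \<times> {..<r}. Z \<omega> $$ ?s i)" for \<omega>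
    have bij: "bij_betw ?s ({..<n} \<times> {..<r}) ({..<r} \<times> {..<n})"
      by (rule bij_betwI[where g = ?s]) auto
    note \<Phi> = iid_std_normal_columns_entries[OF M Z assms(2) bij, folded \<Phi>_def[abs_def]]
    have CD: "J\<^sup>T * Ji\<^sup>T = 1\<^sub>m r" "Ji\<^sup>T * J\<^sup>T = 1\<^sub>m r"
      using J(1) Ji by (simp_all flip: transpose_mult[of _ r r _ r])
    have "AE \<omega> in M. \<exists>V. spectral_bridge n r ((1\<^sub>m n)\<^sup>T * 1\<^sub>m n) (J\<^sup>T) (Ji\<^sup>T) Sig (\<Phi> \<omega>) (H \<omega>) (l \<omega>) V"
      using AE_S unfolding mq
    proof eventually_elim
      case (elim \<omega>)
      have Zw: "Z \<omega> \<in> carrier_mat r n" using elim Zc by blast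
      have mat: "Matrix.mat n r (\<Phi> \<omega>) = (Z \<omega>)\<^sup>T" using Zw by (intro eq_matI) (auto simp: \<Phi>_def)
      obtain V where "orthogonal_matrix r V" "J * (Z \<omega> * (Z \<omega>)\<^sup>T) * J\<^sup>T = V * mat_diag r (l \<omega>) * V\<^sup>T"
        "0 < Determinant.det (Z \<omega> * (Z \<omega>)\<^sup>T)"
        "\<And>d. (\<And>i. i < r \<Longrightarrow> 0 < d i) \<Longrightarrow>
          mat_trace (mp_inverse (B * B\<^sup>T) * (H \<omega> * mat_diag r (\<lambda>i. l \<omega> i * d i) * (H \<omega>)\<^sup>T)) = mat_trace (Ji\<^sup>T * (Z \<omega> * (Z \<omega>)\<^sup>T) * J\<^sup>T * (V * mat_diag r d * V\<^sup>T)) \<and>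
          prod_mset (pos_eigenvalues (mp_inverse (B * B\<^sup>T) * (H \<omega> * mat_diag r (\<lambda>i. l \<omega> i * d i) * (H \<omega>)\<^sup>T)))
            = (\<Prod>i<r. d i) * Determinant.det (Z \<omega> * (Z \<omega>)\<^sup>T)"
        using haff_bridge_tall[OF B Zw J Ji conjunct2[OF elim]] by blast
      note V = this
      have pos: "\<forall>i<r. 0 < l \<omega> i" using elim by (simp add: eigen_decomposition_def)
      have E: "J * (Z \<omega> * ((1\<^sub>m n)\<^sup>T * 1\<^sub>m n * ((Z \<omega>)\<^sup>T * J\<^sup>T))) = J * (Z \<omega> * (Z \<omega>)\<^sup>T) * J\<^sup>T"
        using Zw J(1) by (simp add: mat_mult_assoc mat_one_mult)
      have "spectral_bridge n r ((1\<^sub>m n)\<^sup>T * 1\<^sub>m n) (J\<^sup>T) (Ji\<^sup>T) Sig (\<Phi> \<omega>) (H \<omega>) (l \<omega>) V"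
        unfolding spectral_bridge_def mat Matrix.transpose_transpose Sig E
        using V(1-3) pos by (intro conjI allI impI V(4)[THEN conjunct1] V(4)[THEN conjunct2]) simp_all
      then show ?case by blast
    qed
    then show ?thesis unfolding mq using \<Phi> J(1) Ji(1) CD
      by (intro exI[of _ \<Phi>] exI[of _ "1\<^sub>m n"] exI[of _ "J\<^sup>T"] exI[of _ "Ji\<^sup>T"]) simp
  qed
  then obtain \<Phi> L C D where
    \<Phi>: "\<Phi> \<in> measurable M (gauss_vector ({..<m} \<times> {..<q}))"
      "distr M (gauss_vector ({..<m} \<times> {..<q})) \<Phi> = gauss_vector ({..<m} \<times> {..<q})"
    and L: "L \<in> carrier_mat m m"
    and CD: "C \<in> carrier_mat q q" "D \<in> carrier_mat q q" "C * D = 1\<^sub>m q" "D * C = 1\<^sub>m q"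
    and br: "AE \<omega> in M. \<exists>V. spectral_bridge m q (L\<^sup>T * L) C D Sig (\<Phi> \<omega>) (H \<omega>) (l \<omega>) V"
    by blast
  show ?thesis
    unfolding assms(14,19,20)
    using stein_risk_improvement[OF M \<Phi> qm L refl CD assms(16-18) assms(15) br] by blast
qed

end
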